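(* Let $j\ge2$ and $n-j\ge2$. The projection $PGC'_{n,j}\to HGC_{n,j}$ is a quasi-isomorphism.
   Context: Fix integers $j\ge 2$, $n$ with $n-j\ge 2$. Coefficients are in $\mathbb Q$. **Plain graphs.** A plain graph is a finite graph with three types of vertices (white, external black, internal black) and two types of edges (dashed, solid). White vertices have at least three dashed half-edges and no solid one; internal black vertices have at least three solid half-edges and no dashed one; external black vertices carry arbitrary numbers of both. Each component contains an external black vertex. Double edges (two edges of the same type joining the same two vertices) and loop edges are allowed. A plain graph is admissible if every external black vertex has at least one dashed edge. A chord is a dashed edge joining two black vertices. Degrees: dashed edge $n-1$, solid edge $j-1$, white vertex $-n$, black vertex $-j$; $|\Gamma|$ is the sum of all these degrees. A label is an ordering of $E(\Gamma)\cup V(\Gamma)$ (solid edges before dashed ones, black vertices before white ones) and a choice of orientation of every edge; interchanging two neighbouring elements of degrees $d,d'$ changes the orientation of the graph by $(-1)^{dd'}$, reversing an edge of degree $d$ changes it by $(-1)^{d+1}$. Orientation relations: two labeled graphs with the same underlying graph are identified up to the corresponding sign. **Contractions.** For an edge $e=\{p,q\}$, $q>p$, $\Gamma/e$ is the contraction (the new vertex takes the place of $p$; it is external black if an endpoint is external black) and $\sigma(e)=(-1)^{|\Gamma|+1}(-1)^{\deg V(\Gamma/e)}\Phi(e)\tau(e)\eta(e)$, where $\deg V$ is the sum of the degrees of the vertices, $\tau(e)$ (resp. $\Phi(e)$) is the Koszul sign of moving $e$ (resp. $q$) to the end of the ordered graded set $E(\Gamma)$ (resp. $V(\Gamma)$),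 and $\eta(e)=1$ if $e$ is oriented from $p$ to $q$, otherwise $(-1)^j$ for $e$ solid and $(-1)^n$ for $e$ dashed. **$PGC'_{n,j}$** is spanned by connected labeled admissible plain graphs modulo orientation relations only (double and loop edges are allowed); $d\Gamma=\sum_e\sigma(e)\Gamma/e$ over all edges which are neither chords nor loop edges. **$HGC_{n,j}$ (hairy graph complex).** A hairy graph is an admissible plain graph without internal black vertices and without solid edges all of whose external black vertices have exactly one dashed edge, called a hair. Double edges and loop edges at white vertices are allowed. $HGC_{n,j}$ is spanned by connected labeled hairy graphs modulo orientation relations; $d\Gamma=\sum_e\sigma(e)\Gamma/e$ over all edges except loop edges and hairs. The projection $PGC'_{n,j}\to HGC_{n,j}$ is the identity on hairy graphs and sends all other plain graphs to $0$. *)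

theory Defs
  imports Complex_Main "HOL-Algebra.Coset" "HOL-Library.Poly_Mapping"
begin

section \<open>Cochain complexes and quasi-isomorphisms\<close>

text \<open>
  Groups are those of HOL-Algebra, written multiplicatively in the records. In the application they
  are the additive groups of rational vector spaces; since additive maps between such spaces are
  automatically linear over the rationals, an isomorphism of groups is an isomorphism of vector
  spaces.
\<close>

record 'a cochain_data =
  obj :: "int \<Rightarrow> 'a monoid"
  diff :: "int \<Rightarrow> 'a \<Rightarrow> 'a"

definition cochain_complex :: "'a cochain_data \<Rightarrow> bool" where
  "cochain_complex C \<longleftrightarrow>
     (\<forall>k. comm_group (obj C k)) \<and>
     (\<forall>k. diff C k \<in> hom (obj C k) (obj C (k + 1))) \<and>
     (\<forall>k. \<forall>x \<in> carrier (obj C k). diff C (k + 1) (diff C k x) = \<one>\<^bsub>obj C (k + 2)\<^esub>)"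

definition cochain_map ::
  "'a cochain_data \<Rightarrow> 'b cochain_data \<Rightarrow> (int \<Rightarrow> 'a \<Rightarrow> 'b) \<Rightarrow> bool" where
  "cochain_map C D f \<longleftrightarrow>
     (\<forall>k. f k \<in> hom (obj C k) (obj D k)) \<and>
     (\<forall>k. \<forall>x \<in> carrier (obj C k). f (k + 1) (diff C k x) = diff D k (f k x))"

definition cocycles :: "'a cochain_data \<Rightarrow> int \<Rightarrow> 'a set" where
  "cocycles C k = kernel (obj C k) (obj C (k + 1)) (diff C k)"

definition coboundaries :: "'a cochain_data \<Rightarrow> int \<Rightarrow> 'a set" where
  "coboundaries C k = diff C (k - 1) ` carrier (obj C (k - 1))"

definition cohomology :: "'a cochain_data \<Rightarrow> int \<Rightarrow> 'a set monoid" where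
  "cohomology C k = (obj C k)\<lparr>carrier := cocycles C k\<rparr> Mod coboundaries C k"

text \<open>
  The map that \<open>f\<close> induces from a quotient group to \<open>H Mod N\<close>, as a map on cosets. If \<open>f\<close> is
  compatible with the subgroups, the value at a coset \<open>X\<close> is the coset of \<open>f x\<close> for any \<open>x\<close> in
  \<open>X\<close>; otherwise it is a union of several cosets, hence not an element of the quotient.
\<close>

definition coset_map :: "'b monoid \<Rightarrow> 'b set \<Rightarrow> ('a \<Rightarrow> 'b) \<Rightarrow> 'a set \<Rightarrow> 'b set" where
  "coset_map H N f X = N <#>\<^bsub>H\<^esub> (f ` X)"

definition cohomology_map :: "'b cochain_data \<Rightarrow> (int \<Rightarrow> 'a \<Rightarrow> 'b) \<Rightarrow> int \<Rightarrow> 'a set \<Rightarrow> 'b set" where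
  "cohomology_map D f k = coset_map (obj D k) (coboundaries D k) (f k)"

definition quasi_isomorphism ::
  "'a cochain_data \<Rightarrow> 'b cochain_data \<Rightarrow> (int \<Rightarrow> 'a \<Rightarrow> 'b) \<Rightarrow> bool" where
  "quasi_isomorphism C D f \<longleftrightarrow>
     cochain_complex C \<and> cochain_complex D \<and> cochain_map C D f \<and>
     (\<forall>k. cohomology_map D f k \<in> iso (cohomology C k) (cohomology D k))"


section \<open>Labeled graphs\<close>

text \<open>
  A labeled graph is given by the list of its vertices and the list of its edges, in the order of
  the label. A vertex is named by its position in the vertex list, and an edge records its
  orientation by its source and target. Thus every isomorphism class of labeled graphs has exactly
  one representative. In the ordering of all edges and vertices, the edges precede the vertices.
\<close>

datatype vkind = External | Internal | White
datatype ekind = Solid | Dashed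
datatype edge = Edge (kind: ekind) (src: nat) (tgt: nat)
datatype lgraph = LGraph (verts: "vkind list") (edges: "edge list")

abbreviation nverts :: "lgraph \<Rightarrow> nat" where "nverts g \<equiv> length (verts g)"
abbreviation nedges :: "lgraph \<Rightarrow> nat" where "nedges g \<equiv> length (edges g)"

text \<open>Booleans are ordered by \<open>False < True\<close>, so the two \<open>sorted\<close> conditions say that black
  vertices precede white ones and that solid edges precede dashed ones.\<close>

definition labeled_graph :: "lgraph \<Rightarrow> bool" where
  "labeled_graph g \<longleftrightarrow>
     (\<forall>e \<in> set (edges g). src e < nverts g \<and> tgt e < nverts g) \<and>
     sorted (map (\<lambda>v. v = White) (verts g)) \<and>
     sorted (map (\<lambda>e. kind e = Dashed) (edges g))"

text \<open>Number of half-edges of a given kind at a vertex; a loop edge contributes two.\<close>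

definition valence :: "lgraph \<Rightarrow> ekind \<Rightarrow> nat \<Rightarrow> nat" where
  "valence g t v =
     (\<Sum>e\<leftarrow>edges g. if kind e = t then of_bool (src e = v) + of_bool (tgt e = v) else 0)"

definition linked :: "lgraph \<Rightarrow> (nat \<times> nat) set" where
  "linked g = {(u, v). \<exists>e \<in> set (edges g). {src e, tgt e} = {u, v}}\<^sup>*"

definition plain_graph :: "lgraph \<Rightarrow> bool" where
  "plain_graph g \<longleftrightarrow> labeled_graph g \<and>
     (\<forall>v < nverts g.
        (verts g ! v = White \<longrightarrow> valence g Dashed v \<ge> 3 \<and> valence g Solid v = 0) \<and>
        (verts g ! v = Internal \<longrightarrow> valence g Solid v \<ge> 3 \<and> valence g Dashed v = 0) \<and>
        (\<exists>u < nverts g. verts g ! u = External \<and> (v, u) \<in> linked g))"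

definition admissible :: "lgraph \<Rightarrow> bool" where
  "admissible g \<longleftrightarrow> (\<forall>v < nverts g. verts g ! v = External \<longrightarrow> valence g Dashed v \<ge> 1)"

definition connected_graph :: "lgraph \<Rightarrow> bool" where
  "connected_graph g \<longleftrightarrow> verts g \<noteq> [] \<and> (\<forall>u < nverts g. \<forall>v < nverts g. (u, v) \<in> linked g)"

text \<open>Exactly one dashed half-edge: a hair is not a loop edge.\<close>

definition hairy :: "lgraph \<Rightarrow> bool" where
  "hairy g \<longleftrightarrow> plain_graph g \<and> admissible g \<and>
     (\<forall>v < nverts g. verts g ! v \<noteq> Internal) \<and>
     (\<forall>e \<in> set (edges g). kind e \<noteq> Solid) \<and>
     (\<forall>v < nverts g. verts g ! v = External \<longrightarrow> valence g Dashed v = 1)"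

definition is_loop :: "lgraph \<Rightarrow> edge \<Rightarrow> bool" where
  "is_loop g e \<longleftrightarrow> src e = tgt e"

definition is_chord :: "lgraph \<Rightarrow> edge \<Rightarrow> bool" where
  "is_chord g e \<longleftrightarrow> kind e = Dashed \<and> verts g ! src e \<noteq> White \<and> verts g ! tgt e \<noteq> White"

definition is_hair :: "lgraph \<Rightarrow> edge \<Rightarrow> bool" where
  "is_hair g e \<longleftrightarrow> kind e = Dashed \<and> (verts g ! src e = External \<or> verts g ! tgt e = External)"


section \<open>Degrees and orientation relations\<close>

fun edge_deg :: "int \<Rightarrow> int \<Rightarrow> ekind \<Rightarrow> int" where
  "edge_deg n j Solid = j - 1"
| "edge_deg n j Dashed = n - 1"

fun vert_deg :: "int \<Rightarrow> int \<Rightarrow> vkind \<Rightarrow> int" where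
  "vert_deg n j White = - n"
| "vert_deg n j External = - j"
| "vert_deg n j Internal = - j"

definition edge_degs :: "int \<Rightarrow> int \<Rightarrow> lgraph \<Rightarrow> int list" where
  "edge_degs n j g = map (\<lambda>e. edge_deg n j (kind e)) (edges g)"

definition vert_degs :: "int \<Rightarrow> int \<Rightarrow> lgraph \<Rightarrow> int list" where
  "vert_degs n j g = map (vert_deg n j) (verts g)"

definition degree :: "int \<Rightarrow> int \<Rightarrow> lgraph \<Rightarrow> int" where
  "degree n j g = sum_list (edge_degs n j g) + sum_list (vert_degs n j g)"

definition sgn_pow :: "int \<Rightarrow> rat" where
  "sgn_pow k = (- 1) powi k"

definition swap_adjacent :: "nat \<Rightarrow> 'a list \<Rightarrow> 'a list" where
  "swap_adjacent i xs = xs[i := xs ! Suc i, Suc i := xs ! i]"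

fun rename_edge :: "(nat \<Rightarrow> nat) \<Rightarrow> edge \<Rightarrow> edge" where
  "rename_edge r (Edge t a b) = Edge t (r a) (r b)"

fun reverse_edge :: "edge \<Rightarrow> edge" where
  "reverse_edge (Edge t a b) = Edge t b a"

text \<open>
  \<open>relabel n j g s h\<close>: the label of \<open>h\<close> arises from that of \<open>g\<close> by one elementary change, of sign
  \<open>s\<close>. When vertices are interchanged, the edges have to follow because vertices are named by
  position. Reversing a loop edge gives back the same graph, since the two half-edges of a loop edge
  are exchanged by an automorphism.
\<close>

inductive relabel :: "int \<Rightarrow> int \<Rightarrow> lgraph \<Rightarrow> rat \<Rightarrow> lgraph \<Rightarrow> bool" for n j :: int where
  swap_edges:
    "\<lbrakk>Suc i < nedges g; kind (edges g ! i) = kind (edges g ! Suc i)\<rbrakk> \<Longrightarrow>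
     relabel n j g (sgn_pow (edge_degs n j g ! i * edge_degs n j g ! Suc i))
       (LGraph (verts g) (swap_adjacent i (edges g)))"
| swap_verts:
    "\<lbrakk>Suc i < nverts g; (verts g ! i = White) = (verts g ! Suc i = White)\<rbrakk> \<Longrightarrow>
     relabel n j g (sgn_pow (vert_degs n j g ! i * vert_degs n j g ! Suc i))
       (LGraph (swap_adjacent i (verts g))
         (map (rename_edge (\<lambda>v. if v = i then Suc i else if v = Suc i then i else v)) (edges g)))"
| reverse:
    "i < nedges g \<Longrightarrow>
     relabel n j g (sgn_pow (edge_degs n j g ! i + 1))
       (LGraph (verts g) ((edges g)[i := reverse_edge (edges g ! i)]))"


section \<open>Contraction of edges\<close>

definition remove_nth :: "nat \<Rightarrow> 'a list \<Rightarrow> 'a list" where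
  "remove_nth i xs = take i xs @ drop (Suc i) xs"

text \<open>The endpoints of the \<open>i\<close>-th edge, the smaller one first.\<close>

definition endp :: "lgraph \<Rightarrow> nat \<Rightarrow> nat" where
  "endp g i = min (src (edges g ! i)) (tgt (edges g ! i))"

definition endq :: "lgraph \<Rightarrow> nat \<Rightarrow> nat" where
  "endq g i = max (src (edges g ! i)) (tgt (edges g ! i))"

definition contract :: "lgraph \<Rightarrow> nat \<Rightarrow> lgraph" where
  "contract g i =
     (let p = endp g i; q = endq g i;
          w = (if verts g ! p = External \<or> verts g ! q = External then External else verts g ! p);
          r = (\<lambda>v. if v = q then p else if v > q then v - 1 else v)
      in LGraph (remove_nth q ((verts g)[p := w])) (map (rename_edge r) (remove_nth i (edges g))))"

text \<open>Koszul sign of moving the \<open>i\<close>-th element of a list of graded elements to the end.\<close>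

definition koszul_to_end :: "int list \<Rightarrow> nat \<Rightarrow> rat" where
  "koszul_to_end ds i = sgn_pow (ds ! i * sum_list (drop (Suc i) ds))"

definition eta :: "int \<Rightarrow> int \<Rightarrow> lgraph \<Rightarrow> nat \<Rightarrow> rat" where
  "eta n j g i =
     (if src (edges g ! i) = endp g i then 1
      else case kind (edges g ! i) of Solid \<Rightarrow> sgn_pow j | Dashed \<Rightarrow> sgn_pow n)"

definition contr_sign :: "int \<Rightarrow> int \<Rightarrow> lgraph \<Rightarrow> nat \<Rightarrow> rat" where
  "contr_sign n j g i =
     sgn_pow (degree n j g + 1) * sgn_pow (sum_list (vert_degs n j (contract g i))) *
     koszul_to_end (vert_degs n j g) (endq g i) * koszul_to_end (edge_degs n j g) i * eta n j g i"


section \<open>The graph complexes\<close>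

definition qscale :: "rat \<Rightarrow> ('a \<Rightarrow>\<^sub>0 rat) \<Rightarrow> ('a \<Rightarrow>\<^sub>0 rat)" where
  "qscale c = Poly_Mapping.map ((*) c)"

lemma lookup_qscale [simp]: "Poly_Mapping.lookup (qscale c x) a = c * Poly_Mapping.lookup x a"
  by (cases "Poly_Mapping.lookup x a = 0") (simp_all add: qscale_def Poly_Mapping.map.rep_eq)

global_interpretation qfree: vector_space "qscale :: rat \<Rightarrow> ('a \<Rightarrow>\<^sub>0 rat) \<Rightarrow> ('a \<Rightarrow>\<^sub>0 rat)"
  by standard (rule poly_mapping_eqI; simp add: lookup_add algebra_simps)+

definition extend_linearly :: "('a \<Rightarrow> 'b \<Rightarrow>\<^sub>0 rat) \<Rightarrow> ('a \<Rightarrow>\<^sub>0 rat) \<Rightarrow> ('b \<Rightarrow>\<^sub>0 rat)" where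
  "extend_linearly f x = (\<Sum>a \<in> Poly_Mapping.keys x. qscale (Poly_Mapping.lookup x a) (f a))"

text \<open>The degree \<open>k\<close> part of the rational vector space freely spanned by \<open>X\<close>.\<close>

definition chains :: "int \<Rightarrow> int \<Rightarrow> lgraph set \<Rightarrow> int \<Rightarrow> (lgraph \<Rightarrow>\<^sub>0 rat) monoid" where
  "chains n j X k =
     \<lparr>carrier = {x. Poly_Mapping.keys x \<subseteq> {g \<in> X. degree n j g = k}}, mult = (+), one = 0\<rparr>"

definition orientation_relations ::
  "int \<Rightarrow> int \<Rightarrow> lgraph set \<Rightarrow> int \<Rightarrow> (lgraph \<Rightarrow>\<^sub>0 rat) set" where
  "orientation_relations n j X k =
     qfree.span {Poly_Mapping.single h 1 - Poly_Mapping.single g s | g s h.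
                   g \<in> X \<and> degree n j g = k \<and> relabel n j g s h}"

text \<open>A map on labeled graphs, extended linearly and passed to the quotients by the orientation
  relations; \<open>X\<close> and \<open>k\<close> belong to the target.\<close>

definition graph_map ::
  "int \<Rightarrow> int \<Rightarrow> lgraph set \<Rightarrow> int \<Rightarrow> (lgraph \<Rightarrow> lgraph \<Rightarrow>\<^sub>0 rat) \<Rightarrow>
   (lgraph \<Rightarrow>\<^sub>0 rat) set \<Rightarrow> (lgraph \<Rightarrow>\<^sub>0 rat) set" where
  "graph_map n j X k f =
     coset_map (chains n j X k) (orientation_relations n j X k) (extend_linearly f)"

definition contraction_sum ::
  "int \<Rightarrow> int \<Rightarrow> (lgraph \<Rightarrow> edge \<Rightarrow> bool) \<Rightarrow> lgraph \<Rightarrow> (lgraph \<Rightarrow>\<^sub>0 rat)" where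
  "contraction_sum n j P g =
     (\<Sum>i | i < nedges g \<and> P g (edges g ! i).
        Poly_Mapping.single (contract g i) (contr_sign n j g i))"

text \<open>The complex spanned by \<open>X\<close> modulo orientation relations whose differential contracts the
  edges satisfying \<open>P\<close>.\<close>

definition graph_complex ::
  "int \<Rightarrow> int \<Rightarrow> lgraph set \<Rightarrow> (lgraph \<Rightarrow> edge \<Rightarrow> bool) \<Rightarrow> (lgraph \<Rightarrow>\<^sub>0 rat) set cochain_data" where
  "graph_complex n j X P =
     \<lparr>obj = (\<lambda>k. chains n j X k Mod orientation_relations n j X k),
      diff = (\<lambda>k. graph_map n j X (k + 1) (contraction_sum n j P))\<rparr>"

definition plain_graphs :: "lgraph set" where
  "plain_graphs = {g. plain_graph g \<and> admissible g \<and> connected_graph g}"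

definition hairy_graphs :: "lgraph set" where
  "hairy_graphs = {g. hairy g \<and> connected_graph g}"

definition PGC' :: "int \<Rightarrow> int \<Rightarrow> (lgraph \<Rightarrow>\<^sub>0 rat) set cochain_data" where
  "PGC' n j = graph_complex n j plain_graphs (\<lambda>g e. \<not> is_chord g e \<and> \<not> is_loop g e)"

definition HGC :: "int \<Rightarrow> int \<Rightarrow> (lgraph \<Rightarrow>\<^sub>0 rat) set cochain_data" where
  "HGC n j = graph_complex n j hairy_graphs (\<lambda>g e. \<not> is_loop g e \<and> \<not> is_hair g e)"

definition hairy_projection ::
  "int \<Rightarrow> int \<Rightarrow> int \<Rightarrow> (lgraph \<Rightarrow>\<^sub>0 rat) set \<Rightarrow> (lgraph \<Rightarrow>\<^sub>0 rat) set" where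
  "hairy_projection n j k =
     graph_map n j hairy_graphs k (\<lambda>g. if hairy g then Poly_Mapping.single g 1 else 0)"

end

(* The differential is a sum of a part contracting solid edges and a part contracting dashed edges.
   For a dashed half-edge x at an external vertex v, pulling x out of v replaces v by a solid edge
   from the core of v to a new external vertex that carries only x. This inverts the contraction of
   the solid edge at x and commutes with the contraction of all other solid edges. Hence, summed
   over all x, it is a contracting homotopy for the solid part of the differential, up to the factor
   N, the number of the half-edges x whose vertex has a second dashed or a solid half-edge. In a
   connected graph N = 0 precisely if the graph is hairy. The dashed part lowers the number of white
   vertices, so by induction on this number the kernel of the projection is acyclic. *)

theory Submission
  imports Defs "HOL-Library.Multiset"
begin

section \<open>Lists and signs\<close>

text \<open>The obstacle is orientation: graphs are given only up to relabelings with signs, whereas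
  contracting and pulling out need positions. All constructions therefore act on labeled graphs.
  There the differential squares to zero, and pulling out commutes with solid contractions, as
  equalities of labeled graphs. In the homotopy formula the relations enter only for an antenna, a
  half-edge that is already pulled out: contracting its solid edge and pulling it out again restores
  the graph up to relabeling. The homotopy needs no sign computation of its own. It takes the sign
  of contracting the new edge, and the anticommutation of two contractions, proved for the square of
  the differential, supplies the remaining signs. The number N splits into the half-edges that can
  be pulled out, which recover the graph by pulling out and then contracting, and the antennas,
  which recover it by contracting and then pulling out. Solid contractions preserve N, so dividing
  by it is compatible with the solid part of the differential.\<close>

lemma sgn_pow_parity: "sgn_pow k = (if even k then 1 else - 1)"
proof (cases "even k")
  case True
  then obtain m where "k = 2 * m" by blast
  then show ?thesis by (simp add: sgn_pow_def power_int_mult)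
next
  case False
  then obtain m where "k = 2 * m + 1" by (elim oddE)
  then show ?thesis by (simp add: sgn_pow_def power_int_add power_int_mult)
qed

lemma sgn_pow_add: "sgn_pow (a + b) = sgn_pow a * sgn_pow b"
  by (simp add: sgn_pow_parity)

lemma sgn_pow_sq [simp]: "sgn_pow a * sgn_pow a = 1" "sgn_pow a * (sgn_pow a * x) = x"
  by (auto simp: sgn_pow_parity)

text \<open>\<open>squeeze q\<close> renumbers the positions that survive the deletion of position
  \<open>q\<close>; \<open>bump q\<close> is its inverse, which skips \<open>q\<close>. Every
  contraction and every pull-out renumbers vertices and edges in this way.\<close>

definition squeeze :: "nat \<Rightarrow> nat \<Rightarrow> nat" where
  "squeeze q v = (if v > q then v - 1 else v)"

definition bump :: "nat \<Rightarrow> nat \<Rightarrow> nat" where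
  "bump q v = (if v < q then v else Suc v)"

lemma squeeze_bump [simp]: "squeeze q (bump q v) = v"
  by (auto simp: squeeze_def bump_def)

lemma bump_squeeze [simp]: "v \<noteq> q \<Longrightarrow> bump q (squeeze q v) = v"
  by (auto simp: squeeze_def bump_def)

lemma bump_neq [simp]: "bump q v \<noteq> q" "q \<noteq> bump q v"
  by (auto simp: bump_def)

lemma bump_eq_iff [simp]: "bump q u = bump q v \<longleftrightarrow> u = v"
  by (metis squeeze_bump)

lemma bump_less [simp]: "q < m \<Longrightarrow> bump q v < m \<longleftrightarrow> v < m - 1"
  by (auto simp: bump_def)

lemma length_remove_nth [simp]: "q < length xs \<Longrightarrow> length (remove_nth q xs) = length xs - 1"
  by (simp add: remove_nth_def)

lemma nth_remove_nth:
  "q < length xs \<Longrightarrow> u < length xs - 1 \<Longrightarrow> remove_nth q xs ! u = xs ! bump q u"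
  by (auto simp: remove_nth_def nth_append min_def bump_def)

lemma nth_remove_nth_squeeze:
  "q < length xs \<Longrightarrow> v < length xs \<Longrightarrow> v \<noteq> q \<Longrightarrow> remove_nth q xs ! squeeze q v = xs ! v"
  by (subst nth_remove_nth) (auto simp: squeeze_def bump_def)

lemma map_remove_nth: "map f (remove_nth i xs) = remove_nth i (map f xs)"
  by (simp add: remove_nth_def take_map drop_map)

lemma set_remove_nth_subset: "set (remove_nth i xs) \<subseteq> set xs"
  by (auto simp: remove_nth_def dest: in_set_takeD in_set_dropD)

lemma sorted_remove_nth: "sorted xs \<Longrightarrow> sorted (remove_nth i xs)"
proof -
  assume "sorted xs"
  then have "sorted (take i xs @ drop i xs)" by simp
  then show ?thesis
    unfolding remove_nth_def sorted_append
    using sorted_wrt_drop[of "(\<le>)" xs "Suc i"] \<open>sorted xs\<close> set_drop_subset_set_drop[of i "Suc i" xs]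
    by auto
qed

lemma sum_list_remove_nth:
  fixes xs :: "int list"
  assumes "i < length xs"
  shows "sum_list (remove_nth i xs) = sum_list xs - xs ! i"
proof -
  have "sum_list xs = sum_list (take i xs @ xs ! i # drop (Suc i) xs)"
    using id_take_nth_drop[OF assms] by simp
  then show ?thesis by (simp add: remove_nth_def)
qed

text \<open>The total degree that the element at \<open>i\<close> passes on its way to the end: the
  second factor in the exponent of \<open>koszul_to_end\<close>.\<close>

definition tail_sum :: "int list \<Rightarrow> nat \<Rightarrow> int" where
  "tail_sum xs i = sum_list (drop (Suc i) xs)"

lemma tail_sum_remove_nth:
  assumes "i < length xs" "k < length xs" "i \<noteq> k"
  shows "tail_sum (remove_nth i xs) (squeeze i k) = tail_sum xs k - (if k < i then xs ! i else 0)"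
proof (cases "k < i")
  case True
  have "drop (Suc k) (remove_nth i xs) = remove_nth (i - Suc k) (drop (Suc k) xs)"
    using True assms by (auto simp: remove_nth_def drop_take Suc_diff_Suc)
  moreover have "drop (Suc k) xs ! (i - Suc k) = xs ! i" using True assms by simp
  ultimately show ?thesis
    using True assms by (simp add: tail_sum_def squeeze_def sum_list_remove_nth)
next
  case False
  then have "drop k (remove_nth i xs) = drop (Suc k) xs"
    using assms by (auto simp: remove_nth_def)
  then show ?thesis using False assms by (simp add: tail_sum_def squeeze_def)
qed

lemma bump_commute: "i < k \<Longrightarrow> bump i (bump (k - 1) u) = bump k (bump i u)"
  by (auto simp: bump_def)

lemma remove_nth_commute:
  assumes "i < k" "k < length xs"
  shows "remove_nth (k - 1) (remove_nth i xs) = remove_nth i (remove_nth k xs)"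
  by (rule nth_equalityI) (use assms in \<open>simp_all add: nth_remove_nth bump_commute[simplified]\<close>)

lemma remove_nth_squeeze_commute:
  assumes "i \<noteq> k" "i < length xs" "k < length xs"
  shows "remove_nth (squeeze i k) (remove_nth i xs) = remove_nth (squeeze k i) (remove_nth k xs)"
  using assms remove_nth_commute[of i k xs] remove_nth_commute[of k i xs]
  by (auto simp: squeeze_def)

lemma squeeze_less: "i < m \<Longrightarrow> k < m \<Longrightarrow> i \<noteq> k \<Longrightarrow> squeeze i k < m - 1"
  by (auto simp: squeeze_def)

section \<open>Adjacent transpositions of lists\<close>

lemma length_swap_adjacent [simp]: "length (swap_adjacent i xs) = length xs"
  by (simp add: swap_adjacent_def)

definition flip :: "nat \<Rightarrow> nat \<Rightarrow> nat" where
  "flip i v = (if v = i then Suc i else if v = Suc i then i else v)"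

lemma flip_flip [simp]: "flip i (flip i v) = v"
  by (simp add: flip_def)

lemma flip_eq_iff [simp]: "flip i u = flip i v \<longleftrightarrow> u = v"
  by (metis flip_flip)

lemma flip_less [simp]: "Suc i < m \<Longrightarrow> flip i v < m \<longleftrightarrow> v < m"
  by (auto simp: flip_def)

lemma nth_swap_adjacent:
  "Suc i < length xs \<Longrightarrow> swap_adjacent i xs ! v = xs ! flip i v"
  by (auto simp: swap_adjacent_def flip_def nth_list_update)

lemma map_swap_adjacent:
  "Suc i < length xs \<Longrightarrow> map f (swap_adjacent i xs) = swap_adjacent i (map f xs)"
  by (auto simp: swap_adjacent_def map_update)

lemma mset_swap_adjacent: "Suc i < length xs \<Longrightarrow> mset (swap_adjacent i xs) = mset xs"
  unfolding swap_adjacent_def by (rule mset_swap) auto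

lemma flip_bump:
  "k \<noteq> i \<Longrightarrow> k \<noteq> Suc i \<Longrightarrow> flip i (bump k u) = bump k (flip (squeeze k i) u)"
  unfolding flip_def bump_def squeeze_def by (cases "i < k") auto

lemma flip_bump_flip:
  "k = i \<or> k = Suc i \<Longrightarrow> flip i (bump (flip i k) u) = bump k u"
  unfolding flip_def bump_def by auto

lemma remove_nth_swap_adjacent:
  assumes "Suc i < length xs" "k < length xs" "k \<noteq> i" "k \<noteq> Suc i"
  shows "remove_nth k (swap_adjacent i xs) = swap_adjacent (squeeze k i) (remove_nth k xs)"
proof (rule nth_equalityI)
  have s: "Suc (squeeze k i) < length xs - 1" using assms by (auto simp: squeeze_def)
  fix u assume "u < length (remove_nth k (swap_adjacent i xs))"
  then show "remove_nth k (swap_adjacent i xs) ! u = swap_adjacent (squeeze k i) (remove_nth k xs) ! u"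
    using assms s by (simp add: nth_remove_nth nth_swap_adjacent flip_bump)
qed (use assms in simp)

lemma remove_nth_swap_adjacent_hit:
  assumes "Suc i < length xs" "k = i \<or> k = Suc i"
  shows "remove_nth (flip i k) (swap_adjacent i xs) = remove_nth k xs"
proof -
  have [simp]: "flip i k < length xs" "k < length xs" using assms by auto
  show ?thesis
    by (rule nth_equalityI) (use assms in \<open>simp_all add: nth_remove_nth nth_swap_adjacent flip_bump_flip\<close>)
qed

text \<open>An element is followed to its new position \<open>flip i k\<close>. Only the two swapped
  elements see a different tail, since each moves to the other side of its partner.\<close>

lemma tail_sum_swap_adjacent:
  assumes "Suc i < length xs"
  shows "tail_sum (swap_adjacent i xs) (flip i k) =
    (if k = i then tail_sum xs k - xs ! Suc i else if k = Suc i then tail_sum xs k + xs ! i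
     else tail_sum xs k)"
proof -
  have xs: "xs = take i xs @ xs ! i # xs ! Suc i # drop (Suc (Suc i)) xs"
    using assms by (metis Cons_nth_drop_Suc Suc_lessD id_take_nth_drop)
  define A where "A = take i xs"
  define B where "B = drop (Suc (Suc i)) xs"
  define a where "a = xs ! i"
  define b where "b = xs ! Suc i"
  have i: "i = length A" using assms by (simp add: A_def)
  have x: "xs = A @ a # b # B" using xs by (simp add: A_def B_def a_def b_def)
  have s: "swap_adjacent i xs = A @ b # a # B"
    unfolding swap_adjacent_def x i by (simp add: nth_append list_update_append)
  consider "k < length A" | "k = length A" | "k = Suc (length A)"
    | "Suc (Suc (length A)) \<le> k"
    by linarith
  then show ?thesis
  proof cases
    case 1
    then have "Suc k - length A = 0" by simp
    with 1 show ?thesis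
      by (simp add: s tail_sum_def flip_def) (simp add: x i numeral_3_eq_3)
  next
    case 2
    then show ?thesis
      by (simp add: s tail_sum_def flip_def) (simp add: x i nth_append)
  next
    case 3
    then show ?thesis
      by (simp add: s tail_sum_def flip_def) (simp add: x i nth_append)
  next
    case 4
    then obtain m where "k = Suc (Suc (length A)) + m" using le_Suc_ex by blast
    then show ?thesis
      by (simp add: s tail_sum_def flip_def) (simp add: x i numeral_3_eq_3)
  qed
qed

lemma sum_list_swap_adjacent [simp]:
  fixes xs :: "int list"
  shows "Suc i < length xs \<Longrightarrow> sum_list (swap_adjacent i xs) = sum_list xs"
  by (metis mset_swap_adjacent sum_mset_sum_list)

section \<open>Contractions\<close>

definition merge :: "nat \<Rightarrow> nat \<Rightarrow> nat \<Rightarrow> nat" where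
  "merge p q v = (if v = q then p else squeeze q v)"

definition join_kind :: "vkind \<Rightarrow> vkind \<Rightarrow> vkind" where
  "join_kind a b = (if a = External \<or> b = External then External else a)"

lemma kind_rename_edge [simp]: "kind (rename_edge r e) = kind e"
  and src_rename_edge [simp]: "src (rename_edge r e) = r (src e)"
  and tgt_rename_edge [simp]: "tgt (rename_edge r e) = r (tgt e)"
  by (cases e; simp)+

lemma kind_reverse_edge [simp]: "kind (reverse_edge e) = kind e"
  and src_reverse_edge [simp]: "src (reverse_edge e) = tgt e"
  and tgt_reverse_edge [simp]: "tgt (reverse_edge e) = src e"
  by (cases e; simp)+

lemma rename_edge_comp: "rename_edge r (rename_edge s e) = rename_edge (r \<circ> s) e"
  by (cases e) simp

lemma rename_edge_reverse: "rename_edge r (reverse_edge e) = reverse_edge (rename_edge r e)"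
  by (cases e) simp

section \<open>A contraction deletes one vertex and one edge\<close>

lemma verts_contract:
  "verts (contract g i) =
     remove_nth (endq g i) ((verts g)[endp g i := join_kind (verts g ! endp g i) (verts g ! endq g i)])"
  by (simp add: contract_def Let_def join_kind_def)

lemma edges_contract:
  "edges (contract g i) = map (rename_edge (merge (endp g i) (endq g i))) (remove_nth i (edges g))"
  unfolding contract_def Let_def merge_def squeeze_def by simp

text \<open>White vertices form a final segment. So if an edge has a white endpoint at all, its
  larger endpoint, which a contraction deletes, is white.\<close>

lemma sorted_white:
  assumes "labeled_graph g" "u \<le> v" "v < nverts g" "verts g ! u = White"
  shows "verts g ! v = White"
proof -
  have "map (\<lambda>v. v = White) (verts g) ! u \<le> map (\<lambda>v. v = White) (verts g) ! v"
    using assms by (intro sorted_nth_mono) (auto simp: labeled_graph_def)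
  then show ?thesis using assms by simp
qed

text \<open>On plain graphs this means neither a chord nor a loop edge
  (\<open>contractible_iff\<close>). This form depends only on the edge and its endpoints, and it
  ties the degree of the deleted vertex to that of the deleted edge
  (\<open>contractible_degs\<close>), which is what the sign computations use.\<close>

definition contractible :: "lgraph \<Rightarrow> nat \<Rightarrow> bool" where
  "contractible g i \<longleftrightarrow> i < nedges g \<and> endp g i < endq g i \<and> endq g i < nverts g \<and>
     (kind (edges g ! i) = Dashed \<longleftrightarrow> verts g ! endq g i = White)"

lemma endp_le_endq: "endp g i \<le> endq g i"
  by (simp add: endp_def endq_def)

lemma endq_less: "labeled_graph g \<Longrightarrow> i < nedges g \<Longrightarrow> endq g i < nverts g"
  by (auto simp: labeled_graph_def endq_def)

text \<open>A white \<open>p\<close> forces a white \<open>q\<close>, and a black \<open>p\<close>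
  merges to a black vertex. The merged vertex thus keeps the degree and the colour of
  \<open>p\<close>, and a contraction just deletes the entry of \<open>q\<close> from the list of
  vertex degrees.\<close>

lemma join_endp:
  assumes "labeled_graph g" "contractible g i"
  shows "vert_deg n j (join_kind (verts g ! endp g i) (verts g ! endq g i)) = vert_deg n j (verts g ! endp g i)"
    "join_kind (verts g ! endp g i) (verts g ! endq g i) = White \<longleftrightarrow> verts g ! endp g i = White"
proof -
  have "verts g ! endp g i = White \<Longrightarrow> verts g ! endq g i = White"
    using assms sorted_white[of g "endp g i" "endq g i"] by (simp add: contractible_def)
  then show "vert_deg n j (join_kind (verts g ! endp g i) (verts g ! endq g i)) = vert_deg n j (verts g ! endp g i)"
    "join_kind (verts g ! endp g i) (verts g ! endq g i) = White \<longleftrightarrow> verts g ! endp g i = White"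
    by (cases "verts g ! endp g i"; auto simp: join_kind_def)+
qed

lemma nverts_contract [simp]: "contractible g i \<Longrightarrow> nverts (contract g i) = nverts g - 1"
  by (simp add: verts_contract contractible_def)

lemma nedges_contract [simp]: "contractible g i \<Longrightarrow> nedges (contract g i) = nedges g - 1"
  by (simp add: edges_contract contractible_def)

lemma vert_degs_contract:
  assumes "labeled_graph g" "contractible g i"
  shows "vert_degs n j (contract g i) = remove_nth (endq g i) (vert_degs n j g)"
  unfolding vert_degs_def verts_contract map_remove_nth map_update join_endp(1)[OF assms]
  using assms(2) by (simp add: contractible_def map_update[symmetric])

lemma map_white_contract:
  assumes "labeled_graph g" "contractible g i"
  shows "map (\<lambda>v. v = White) (verts (contract g i)) =
    remove_nth (endq g i) (map (\<lambda>v. v = White) (verts g))"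
proof -
  have "(map f xs)[p := f (xs ! p)] = map f xs" for f :: "vkind \<Rightarrow> bool" and xs p
    by (metis list_update_id map_update)
  then show ?thesis
    unfolding verts_contract map_remove_nth map_update join_endp(2)[OF assms] by metis
qed

lemma map_kind_contract: "map kind (edges (contract g i)) = remove_nth i (map kind (edges g))"
  by (simp add: edges_contract map_remove_nth comp_def)

lemma edge_degs_alt: "edge_degs n j g = map (edge_deg n j) (map kind (edges g))"
  by (simp add: edge_degs_def)

lemma edge_degs_contract: "edge_degs n j (contract g i) = remove_nth i (edge_degs n j g)"
  by (simp add: edge_degs_alt map_kind_contract map_remove_nth)

lemma length_degs [simp]:
  "length (vert_degs n j g) = nverts g" "length (edge_degs n j g) = nedges g"
  by (simp_all add: vert_degs_def edge_degs_def)

text \<open>This is \<open>- n = - (n - 1) - 1\<close> for a dashed edge and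
  \<open>- j = - (j - 1) - 1\<close> for a solid one. The deleted edge and vertex have total degree
  -1, so a contraction raises the degree by one, and exactly one of the two is odd.\<close>

lemma contractible_degs:
  assumes "contractible g i"
  shows "vert_degs n j g ! endq g i = - (edge_degs n j g ! i) - 1"
  using assms
  by (cases "kind (edges g ! i)"; cases "verts g ! endq g i")
    (auto simp: contractible_def vert_degs_def edge_degs_def)

lemma degree_contract:
  assumes "labeled_graph g" "contractible g i"
  shows "degree n j (contract g i) = degree n j g + 1"
  using assms contractible_degs[of g i n j]
  by (simp add: degree_def vert_degs_contract edge_degs_contract sum_list_remove_nth contractible_def)

lemma labeled_graph_contract:
  assumes "labeled_graph g" "contractible g i"
  shows "labeled_graph (contract g i)"
proof -
  have "map (\<lambda>e. kind e = Dashed) (edges h) = map (\<lambda>t. t = Dashed) (map kind (edges h))" for h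
    by simp
  then have "sorted (map (\<lambda>e. kind e = Dashed) (edges (contract g i)))"
    using assms(1) by (simp only: map_kind_contract map_remove_nth) (simp add: labeled_graph_def sorted_remove_nth comp_def)
  moreover have "sorted (map (\<lambda>v. v = White) (verts (contract g i)))"
    using assms by (simp add: map_white_contract sorted_remove_nth labeled_graph_def)
  moreover have "merge (endp g i) (endq g i) u < nverts g - 1" if "u < nverts g" for u
    using assms that by (auto simp: merge_def squeeze_def contractible_def)
  ultimately show ?thesis
    using assms set_remove_nth_subset[of i "edges g"]
    by (auto simp: labeled_graph_def edges_contract)
qed

lemma edge_contract:
  assumes "i < nedges g" "k < nedges g" "i \<noteq> k"
  shows "edges (contract g i) ! squeeze i k = rename_edge (merge (endp g i) (endq g i)) (edges g ! k)"
proof -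
  have "squeeze i k < nedges g - 1" using assms squeeze_less by blast
  then show ?thesis using assms by (simp add: edges_contract nth_remove_nth_squeeze)
qed

lemma vert_contract:
  assumes "contractible g i" "v < nverts g"
  shows "verts (contract g i) ! merge (endp g i) (endq g i) v =
    (if v = endp g i \<or> v = endq g i then join_kind (verts g ! endp g i) (verts g ! endq g i) else verts g ! v)"
proof -
  have p: "squeeze (endq g i) (endp g i) = endp g i"
    using assms by (auto simp: squeeze_def contractible_def)
  let ?xs = "(verts g)[endp g i := join_kind (verts g ! endp g i) (verts g ! endq g i)]"
  have q: "endp g i < endq g i" "endq g i < nverts g" using assms by (auto simp: contractible_def)
  show ?thesis
  proof (cases "v = endq g i")
    case True
    then show ?thesis
      using q nth_remove_nth_squeeze[of "endq g i" ?xs "endp g i"]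
      by (simp add: merge_def verts_contract p)
  next
    case False
    then show ?thesis
      using q assms nth_remove_nth_squeeze[of "endq g i" ?xs v]
      by (simp add: merge_def verts_contract nth_list_update)
  qed
qed

text \<open>Reversing the contracted edge contributes its degree plus one, which is \<open>j\<close> or \<open>n\<close> as in \<open>eta\<close>.\<close>

definition contr_exp :: "int \<Rightarrow> int \<Rightarrow> lgraph \<Rightarrow> nat \<Rightarrow> int" where
  "contr_exp n j g i =
     degree n j g + 1 + sum_list (vert_degs n j (contract g i)) +
     vert_degs n j g ! endq g i * tail_sum (vert_degs n j g) (endq g i) +
     edge_degs n j g ! i * tail_sum (edge_degs n j g) i +
     (if src (edges g ! i) = endp g i then 0 else edge_degs n j g ! i + 1)"

lemma contr_sign_exp:
  assumes "i < nedges g"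
  shows "contr_sign n j g i = sgn_pow (contr_exp n j g i)"
  using assms
  by (cases "kind (edges g ! i)")
    (auto simp: contr_sign_def contr_exp_def eta_def koszul_to_end_def tail_sum_def sgn_pow_add
      edge_degs_def sgn_pow_parity)

text \<open>Merging may reverse the order of the endpoints of \<open>k\<close>: if both edges end at
  the same \<open>q\<close>, then \<open>q\<close> becomes \<open>endp g i\<close>, which can lie
  below \<open>endp g k\<close>. Hence \<open>min\<close> and \<open>max\<close>.\<close>

lemma endp_endq_contract:
  assumes "i < nedges g" "k < nedges g" "i \<noteq> k"
  shows
    "endp (contract g i) (squeeze i k) =
       min (merge (endp g i) (endq g i) (endp g k)) (merge (endp g i) (endq g i) (endq g k))"
    "endq (contract g i) (squeeze i k) =
       max (merge (endp g i) (endq g i) (endp g k)) (merge (endp g i) (endq g i) (endq g k))"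
proof -
  have *: "endp h l = min (f (endp g k)) (f (endq g k))" "endq h l = max (f (endp g k)) (f (endq g k))"
    if "src (edges h ! l) = f (src (edges g ! k))" "tgt (edges h ! l) = f (tgt (edges g ! k))" for h l and f :: "nat \<Rightarrow> nat"
    using that by (cases "src (edges g ! k) \<le> tgt (edges g ! k)";
        simp add: endp_def endq_def min.commute max.commute min_def max_def)+
  show
    "endp (contract g i) (squeeze i k) =
       min (merge (endp g i) (endq g i) (endp g k)) (merge (endp g i) (endq g i) (endq g k))"
    "endq (contract g i) (squeeze i k) =
       max (merge (endp g i) (endq g i) (endp g k)) (merge (endp g i) (endq g i) (endq g k))"
    by (rule *; simp add: edge_contract assms)+
qed

lemma src_eq_endp_or_endq: "src (edges g ! k) = endp g k \<or> src (edges g ! k) = endq g k"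
  and tgt_eq_endp_or_endq: "tgt (edges g ! k) = endp g k \<or> tgt (edges g ! k) = endq g k"
  by (auto simp: endp_def endq_def)

section \<open>The square of the differential\<close>

lemma merge_simps:
  "merge p q q = p" "v < q \<Longrightarrow> merge p q v = v" "q \<le> v \<Longrightarrow> merge p q (Suc v) = v"
  by (auto simp: merge_def squeeze_def)

text \<open>\<open>bump q\<close> chooses a representative in the original graph for each vertex of
  the contraction, with \<open>p\<close> standing for the merged pair. Comparing representatives
  decides when two vertices are merged.\<close>

lemma bump_merge: "p < q \<Longrightarrow> bump q (merge p q v) = (if v = q then p else v)"
  by (simp add: merge_def) (simp add: bump_def)

lemma merge_eq_iff:
  assumes "p < q"
  shows "merge p q u = merge p q v \<longleftrightarrow> u = v \<or> u \<in> {p, q} \<and> v \<in> {p, q}"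
proof -
  have "merge p q u = merge p q v \<longleftrightarrow> bump q (merge p q u) = bump q (merge p q v)"
    by simp
  then show ?thesis unfolding bump_merge[OF assms] by auto
qed

text \<open>The larger endpoint of the second edge is \<open>Suc q2\<close> in the original graph
  and \<open>q2\<close> after \<open>q1\<close> has been deleted; writing it as a successor avoids
  truncated subtraction.\<close>

lemma merge_commute:
  assumes "p1 < q1" "p2 < Suc q2" "q1 < Suc q2"
  shows "merge (merge p1 q1 p2) q2 (merge p1 q1 v) = merge p1 q1 (merge p2 (Suc q2) v)"
proof -
  consider "v < q1" | "v = q1" | w where "v = Suc w" "q1 \<le> w" "w < q2"
    | "v = Suc q2" | w where "v = Suc (Suc w)" "q2 \<le> w"
    by (metis less_iff_Suc_add linorder_neqE_nat not_less_eq Suc_leI le_add1 less_Suc_eq_le)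
  then show ?thesis
    by cases (use assms in \<open>simp_all add: merge_simps\<close>)
qed

text \<open>Two edges from \<open>p1\<close> and \<open>p2\<close> to the same \<open>q\<close>:
  whichever is contracted first, the other one becomes an edge between \<open>p1\<close> and
  \<open>p2\<close>.\<close>

lemma merge_commute_same_end:
  assumes "p1 < p2" "p2 < q"
  shows "merge p1 p2 (merge p1 q v) = merge p1 p2 (merge p2 q v)"
proof -
  consider "v < p2" | "v = p2" | "p2 < v" "v < q" | "v = q" | w where "v = Suc w" "q \<le> w"
    by (metis less_iff_Suc_add linorder_neqE_nat le_add1)
  then show ?thesis
    by cases (use assms in \<open>simp_all add: merge_simps\<close>)
qed

lemma ex_merge_eq:
  assumes "p < q" "q < m" "u < m - 1"
  shows "\<exists>v<m. merge p q v = u"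
  by (rule exI[of _ "bump q u"]) (use assms in \<open>simp add: merge_def\<close>)

lemma edges_contract_contract: "edges (contract (contract g i) k) =
      map (rename_edge (\<lambda>v. merge (endp (contract g i) k) (endq (contract g i) k)
        (merge (endp g i) (endq g i) v))) (remove_nth k (remove_nth i (edges g)))" 
    apply (simp only: edges_contract[of "contract g i"])
    apply (subst edges_contract[of g i])
    apply (simp only: map_remove_nth[symmetric] )
    apply (simp only: map_map)
    apply (rule map_cong)
    apply (rule refl)
    apply (simp only: comp_apply)
    apply (simp only:  rename_edge_comp)
    apply (simp only: comp_def)
done

lemma contract_contract_edges:
  assumes "i \<noteq> k" "i < nedges g" "k < nedges g"
    and "\<And>v. merge (endp (contract g i) (squeeze i k)) (endq (contract g i) (squeeze i k))
               (merge (endp g i) (endq g i) v) =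
             merge (endp (contract g k) (squeeze k i)) (endq (contract g k) (squeeze k i))
               (merge (endp g k) (endq g k) v)"
  shows "edges (contract (contract g i) (squeeze i k)) = edges (contract (contract g k) (squeeze k i))"
proof -
  have "map (rename_edge f) xs = map (rename_edge f') xs'"
    if "\<And>v. f v = f' v" "xs = xs'" for f f' :: "nat \<Rightarrow> nat" and xs xs'
    using that(2) ext[of f f', OF that(1)] by simp
  then show ?thesis
    unfolding edges_contract_contract
    by this (fact assms(4), rule remove_nth_squeeze_commute[OF assms(1-3)])
qed

text \<open>Every vertex of a double contraction is the image of a vertex of \<open>g\<close>, so it
  suffices to compare kinds along the common renaming.\<close>

lemma contract_contract_verts:
  assumes "contractible g i" "contractible g k"
    "contractible (contract g i) (squeeze i k)" "contractible (contract g k) (squeeze k i)"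
    and merge: "\<And>v. merge (endp (contract g i) (squeeze i k)) (endq (contract g i) (squeeze i k))
               (merge (endp g i) (endq g i) v) =
             merge (endp (contract g k) (squeeze k i)) (endq (contract g k) (squeeze k i))
               (merge (endp g k) (endq g k) v)"
    and eq: "\<And>v. v < nverts g \<Longrightarrow>
        verts (contract (contract g i) (squeeze i k)) !
          merge (endp (contract g i) (squeeze i k)) (endq (contract g i) (squeeze i k))
               (merge (endp g i) (endq g i) v) =
        verts (contract (contract g k) (squeeze k i)) !
          merge (endp (contract g k) (squeeze k i)) (endq (contract g k) (squeeze k i))
               (merge (endp g k) (endq g k) v)"
  shows "verts (contract (contract g i) (squeeze i k)) = verts (contract (contract g k) (squeeze k i))"
proof (rule nth_equalityI)
  fix u assume u: "u < nverts (contract (contract g i) (squeeze i k))"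
  have c: "endp (contract g i) (squeeze i k) < endq (contract g i) (squeeze i k)"
    "endq (contract g i) (squeeze i k) < nverts (contract g i)"
    "endp g i < endq g i" "endq g i < nverts g"
    using assms(1,3) by (simp_all only: contractible_def)
  obtain w where w: "w < nverts (contract g i)"
    "merge (endp (contract g i) (squeeze i k)) (endq (contract g i) (squeeze i k)) w = u"
    using ex_merge_eq[OF c(1,2)] u nverts_contract[OF assms(3)] by metis
  obtain v where v: "v < nverts g" "merge (endp g i) (endq g i) v = w"
    using ex_merge_eq[OF c(3,4)] w(1) nverts_contract[OF assms(1)] by metis
  then show "verts (contract (contract g i) (squeeze i k)) ! u = verts (contract (contract g k) (squeeze k i)) ! u"
    using eq[OF v(1)] merge[of v] by (simp add: v(2) w(2))
qed (use assms in simp)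

lemma vert_contract_contract:
  assumes "contractible g i" "contractible (contract g i) k" "v < nverts g"
    "merge (endp g i) (endq g i) x = endp (contract g i) k" "x < nverts g"
    "merge (endp g i) (endq g i) y = endq (contract g i) k" "y < nverts g"
  defines "w \<equiv> \<lambda>v. if v = endp g i \<or> v = endq g i
                    then join_kind (verts g ! endp g i) (verts g ! endq g i) else verts g ! v"
  shows "verts (contract (contract g i) k) !
      merge (endp (contract g i) k) (endq (contract g i) k) (merge (endp g i) (endq g i) v) =
    (if merge (endp g i) (endq g i) v = merge (endp g i) (endq g i) x \<or>
        merge (endp g i) (endq g i) v = merge (endp g i) (endq g i) y
     then join_kind (w x) (w y) else w v)"
proof -
  have "merge (endp g i) (endq g i) v < nverts (contract g i)"
    using assms by (auto simp: contractible_def[of g] nverts_contract[OF assms(1)] merge_def squeeze_def)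
  then show ?thesis
    using vert_contract[OF assms(2), of "merge (endp g i) (endq g i) v"]
      vert_contract[OF assms(1,3)] vert_contract[OF assms(1,5)] vert_contract[OF assms(1,7)]
    by (simp add: assms(4,6) w_def)
qed

text \<open>Here the two contractions delete different vertices. The first lowers
  \<open>endq g k\<close> by one, the second leaves both endpoints of \<open>i\<close> in place, and
  neither changes the colour of the larger endpoint of the other edge, so that edge stays
  contractible.\<close>

lemma contract_commute_less:
  assumes g: "labeled_graph g" and i: "contractible g i" and k: "contractible g k"
    and less: "endq g i < endq g k"
  shows "contract (contract g i) (squeeze i k) = contract (contract g k) (squeeze k i)"
    and "contractible (contract g i) (squeeze i k)"
    and "contractible (contract g k) (squeeze k i)"
    and "odd (contr_exp n j g i + contr_exp n j (contract g i) (squeeze i k) -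
         (contr_exp n j g k + contr_exp n j (contract g k) (squeeze k i)))"
proof -
  define p1 q1 p2 q2 where "p1 = endp g i" "q1 = endq g i" "p2 = endp g k" "q2 = endq g k"
  note pq = this
  have ik: "i \<noteq> k" using less by auto
  have iE: "i < nedges g" "k < nedges g" using i k by (auto simp: contractible_def)
  have o: "p1 < q1" "p2 < q2" "q1 < q2" "q2 < nverts g" "q1 < nverts g" "p1 < nverts g" "p2 < nverts g"
    using i k less by (auto simp: contractible_def pq)
  have m2: "merge p1 q1 p2 < q2 - 1" using o by (auto simp: merge_def squeeze_def)
  have m1: "merge p1 q1 q2 = q2 - 1" "merge p2 q2 p1 = p1" "merge p2 q2 q1 = q1"
    using o by (auto simp: merge_def squeeze_def)
  have e12: "endp (contract g i) (squeeze i k) = merge p1 q1 p2"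
    "endq (contract g i) (squeeze i k) = q2 - 1"
    using m2 m1 by (simp_all add: endp_endq_contract[OF iE ik] pq[symmetric])
  have e21: "endp (contract g k) (squeeze k i) = p1"
    "endq (contract g k) (squeeze k i) = q1"
    using o m1 by (simp_all add: endp_endq_contract[OF iE(2,1) ik[symmetric]] pq[symmetric])
  have v12: "verts (contract g i) ! (q2 - 1) = verts g ! q2"
    using vert_contract[OF i, of q2] o m1 by (simp add: pq[symmetric])
  have w2: "verts g ! p2 = White \<Longrightarrow> verts g ! q2 = White"
    using sorted_white[OF g, of p2 q2] o by simp
  have v21: "verts (contract g k) ! q1 = White \<longleftrightarrow> verts g ! q1 = White"
    using vert_contract[OF k, of q1] o m1 w2 by (auto simp: pq[symmetric] join_kind_def)
  have nv: "nverts (contract g i) = nverts g - 1" "nverts (contract g k) = nverts g - 1"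
    "nedges (contract g i) = nedges g - 1" "nedges (contract g k) = nedges g - 1"
    using i k by simp_all
  have q2': "q2 - 1 < nverts g - 1" "q1 < nverts g - 1" using o by linarith+
  show c12: "contractible (contract g i) (squeeze i k)"
    using o m2 k i iE ik squeeze_less[OF iE ik]
    unfolding contractible_def e12 v12 edge_contract[OF iE ik]
    using q2' by (simp add: nv pq)
  show c21: "contractible (contract g k) (squeeze k i)"
    using o i k iE ik squeeze_less[OF iE(2,1) ik[symmetric]]
    unfolding contractible_def e21 v21 edge_contract[OF iE(2,1) ik[symmetric]]
    using q2' by (auto simp: nv pq)
  have mm: "merge (merge p1 q1 p2) (q2 - 1) (merge p1 q1 v) = merge p1 q1 (merge p2 q2 v)" for v
    using o merge_commute[of p1 q1 p2 "q2 - 1" v] by simp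
  have "verts (contract (contract g i) (squeeze i k)) = verts (contract (contract g k) (squeeze k i))"
  proof (rule contract_contract_verts[OF i k c12 c21], unfold e12 e21 pq[symmetric])
    fix v assume v: "v < nverts g"
    note * = vert_contract_contract[OF i c12 v, of p2 q2, unfolded e12 pq[symmetric]]
    note ** = vert_contract_contract[OF k c21 v, of p1 q1, unfolded e21 pq[symmetric]]
    show "verts (contract (contract g i) (squeeze i k)) ! merge (merge p1 q1 p2) (q2 - 1) (merge p1 q1 v) =
      verts (contract (contract g k) (squeeze k i)) ! merge p1 q1 (merge p2 q2 v)"
      unfolding *[OF refl o(7) m1(1) o(4)] **[OF m1(2) o(6) m1(3) o(5)]
      unfolding merge_eq_iff[OF o(1)] merge_eq_iff[OF o(2)] 
      using o(1-3) by (cases "v = p1"; cases "v = q1"; cases "v = p2"; cases "v = q2"; cases "p1 = p2"; cases "p2 = q1") (simp_all add: join_kind_def)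
  qed (rule mm)
  moreover have "edges (contract (contract g i) (squeeze i k)) = edges (contract (contract g k) (squeeze k i))"
    by (rule contract_contract_edges[OF ik iE]) (unfold e12 e21 pq[symmetric], rule mm)
  ultimately show eq: "contract (contract g i) (squeeze i k) = contract (contract g k) (squeeze k i)"
    using lgraph.expand by blast
  define a b where "a = edge_degs n j g ! i" "b = edge_degs n j g ! k"
  note ab = this
  have vq: "vert_degs n j g ! q1 = - a - 1" "vert_degs n j g ! q2 = - b - 1"
    using contractible_degs[OF i] contractible_degs[OF k] by (simp_all add: ab pq)
  have ed: "edge_degs n j (contract g i) ! squeeze i k = b" "edge_degs n j (contract g k) ! squeeze k i = a"
    using iE ik by (simp_all add: edge_degs_contract nth_remove_nth_squeeze ab)
  have et: "tail_sum (edge_degs n j (contract g i)) (squeeze i k) =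
      tail_sum (edge_degs n j g) k - (if k < i then a else 0)"
    "tail_sum (edge_degs n j (contract g k)) (squeeze k i) =
      tail_sum (edge_degs n j g) i - (if i < k then b else 0)"
    using iE ik by (simp_all add: edge_degs_contract tail_sum_remove_nth ab)
  have sq: "squeeze q1 q2 = q2 - 1" "squeeze q2 q1 = q1" using o by (auto simp: squeeze_def)
  have vd: "vert_degs n j (contract g i) ! (q2 - 1) = - b - 1"
    "vert_degs n j (contract g k) ! q1 = - a - 1"
    using nth_remove_nth_squeeze[of q1 "vert_degs n j g" q2] nth_remove_nth_squeeze[of q2 "vert_degs n j g" q1]
      o vq by (simp_all add: vert_degs_contract g i k pq[symmetric] sq)
  have vt: "tail_sum (vert_degs n j (contract g i)) (q2 - 1) = tail_sum (vert_degs n j g) q2"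
    "tail_sum (vert_degs n j (contract g k)) q1 = tail_sum (vert_degs n j g) q1 + b + 1"
    using tail_sum_remove_nth[of q1 "vert_degs n j g" q2] tail_sum_remove_nth[of q2 "vert_degs n j g" q1]
      o vq by (simp_all add: vert_degs_contract g i k pq[symmetric] sq)
  have vs: "sum_list (vert_degs n j (contract g i)) = sum_list (vert_degs n j g) + a + 1"
    "sum_list (vert_degs n j (contract g k)) = sum_list (vert_degs n j g) + b + 1"
    using o vq by (simp_all add: vert_degs_contract g i k pq[symmetric] sum_list_remove_nth)
  have s12: "src (edges (contract g i) ! squeeze i k) = merge p1 q1 p2 \<longleftrightarrow> src (edges g ! k) = p2"
    using src_eq_endp_or_endq[of g k] o m1 m2 by (auto simp: edge_contract[OF iE ik] pq[symmetric])
  have s21: "src (edges (contract g k) ! squeeze k i) = p1 \<longleftrightarrow> src (edges g ! i) = p1"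
    using src_eq_endp_or_endq[of g i] o m1 by (auto simp: edge_contract[OF iE(2,1) ik[symmetric]] pq[symmetric])
  \<comment> \<open>Modulo 2, the order of the edges contributes \<open>a * b\<close>, the order of
    the deleted vertices \<open>(a + 1) * (b + 1)\<close>, and the vertex degrees of the two
    intermediate graphs \<open>a + b\<close>. The sum is odd.\<close>
  show "odd (contr_exp n j g i + contr_exp n j (contract g i) (squeeze i k) -
         (contr_exp n j g k + contr_exp n j (contract g k) (squeeze k i)))"
    unfolding contr_exp_def eq e12 e21 s12 s21 pq[symmetric] ed et vd vt vs vq ab[symmetric]
      degree_contract[OF g i] degree_contract[OF g k]
    using ik by (cases "i < k"; cases "even a"; cases "even b"; auto)
qed

text \<open>Both contractions delete the same vertex. If it is white while the two other endpoints
  are black, then either contraction turns the other edge into a chord. So the second contraction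
  must be assumed possible, and possible in one order means possible in the other.\<close>

lemma contract_commute_same_end:
  assumes g: "labeled_graph g" and i: "contractible g i" and k: "contractible g k"
    and same: "endq g i = endq g k" and less: "endp g i < endp g k" and
    ex: "contractible (contract g i) (squeeze i k) \<or> contractible (contract g k) (squeeze k i)"
  shows "contract (contract g i) (squeeze i k) = contract (contract g k) (squeeze k i)"
    and "contractible (contract g i) (squeeze i k)"
    and "contractible (contract g k) (squeeze k i)"
    and "odd (contr_exp n j g i + contr_exp n j (contract g i) (squeeze i k) -
         (contr_exp n j g k + contr_exp n j (contract g k) (squeeze k i)))"
proof -
  define p1 p2 q where "p1 = endp g i" "p2 = endp g k" "q = endq g k"
  note pq = this
  have ik: "i \<noteq> k" using less by auto
  have iE: "i < nedges g" "k < nedges g" using i k by (auto simp: contractible_def)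
  have o: "p1 < p2" "p2 < q" "p1 < q" "q < nverts g" "p1 < nverts g" "p2 < nverts g"
    using i k less same by (auto simp: contractible_def pq)
  have m1: "merge p1 q q = p1" "merge p2 q q = p2" "merge p1 q p2 = p2" "merge p2 q p1 = p1" "merge p2 q p2 = p2"
    using o by (auto simp: merge_def squeeze_def)
  have e12: "endp (contract g i) (squeeze i k) = p1" "endq (contract g i) (squeeze i k) = p2"
    using m1 o by (simp_all add: endp_endq_contract[OF iE ik] pq[symmetric] same)
  have e21: "endp (contract g k) (squeeze k i) = p1" "endq (contract g k) (squeeze k i) = p2"
    using m1 o by (simp_all add: endp_endq_contract[OF iE(2,1) ik[symmetric]] pq[symmetric] same)
  have kk: "kind (edges g ! i) = Dashed \<longleftrightarrow> kind (edges g ! k) = Dashed"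
    using i k same by (simp add: contractible_def)
  have v12: "verts (contract g i) ! p2 = verts g ! p2"
    using vert_contract[OF i, of p2] o m1 by (simp add: pq[symmetric] same)
  have w2: "verts g ! p2 = White \<Longrightarrow> verts g ! q = White"
    using sorted_white[OF g, of p2 q] o by simp
  have v21: "verts (contract g k) ! p2 = White \<longleftrightarrow> verts g ! p2 = White"
    using vert_contract[OF k, of p2] o m1 w2 by (auto simp: pq[symmetric] join_kind_def)
  have c: "contractible (contract g i) (squeeze i k) \<longleftrightarrow> contractible (contract g k) (squeeze k i)"
    using o i k iE ik squeeze_less[OF iE(2,1) ik[symmetric]] squeeze_less[OF iE ik] kk
    unfolding contractible_def[of "contract g k"] contractible_def[of "contract g i"] e21 v21 e12 v12
      edge_contract[OF iE(2,1) ik[symmetric]] edge_contract[OF iE ik]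
    by (auto simp: nverts_contract nedges_contract)
  with ex show c12: "contractible (contract g i) (squeeze i k)" 
    and c21: "contractible (contract g k) (squeeze k i)" by auto
  have mm: "merge p1 p2 (merge p1 q v) = merge p1 p2 (merge p2 q v)" for v
    using o by (intro merge_commute_same_end) auto
  have "verts (contract (contract g i) (squeeze i k)) = verts (contract (contract g k) (squeeze k i))"
  proof (rule contract_contract_verts[OF i k c12 c21], unfold e12 e21 same pq[symmetric])
    fix v assume v: "v < nverts g"
    note * = vert_contract_contract[OF i c12 v, of q p2, unfolded e12 same pq[symmetric]]
    note ** = vert_contract_contract[OF k c21 v, of p1 q, unfolded e21 same pq[symmetric]]
    show "verts (contract (contract g i) (squeeze i k)) ! merge p1 p2 (merge p1 q v) =
      verts (contract (contract g k) (squeeze k i)) ! merge p1 p2 (merge p2 q v)"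
      unfolding *[OF m1(1) o(4) m1(3) o(6)] **[OF m1(4) o(5) m1(2) o(4)]
      unfolding merge_eq_iff[OF o(1)] merge_eq_iff[OF o(2)] merge_eq_iff[OF o(3)]
      using o(1-3) by (cases "v = p1"; cases "v = q"; cases "v = p2"; cases "p1 = p2"; cases "p2 = q") (simp_all add: join_kind_def)
  qed (rule mm)
  moreover have "edges (contract (contract g i) (squeeze i k)) = edges (contract (contract g k) (squeeze k i))"
    by (rule contract_contract_edges[OF ik iE]) (unfold e12 e21 same pq[symmetric], rule mm)
  ultimately show eq: "contract (contract g i) (squeeze i k) = contract (contract g k) (squeeze k i)"
    using lgraph.expand by blast
  define a b where "a = edge_degs n j g ! i" "b = edge_degs n j g ! k"
  note ab = this
  have vq: "vert_degs n j g ! q = - b - 1" and a_b: "a = b"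
    using contractible_degs[OF i, of n j] contractible_degs[OF k, of n j] same by (simp_all add: ab pq)
  have ed: "edge_degs n j (contract g i) ! squeeze i k = b" "edge_degs n j (contract g k) ! squeeze k i = a"
    using iE ik by (simp_all add: edge_degs_contract nth_remove_nth_squeeze ab)
  have et: "tail_sum (edge_degs n j (contract g i)) (squeeze i k) =
      tail_sum (edge_degs n j g) k - (if k < i then a else 0)"
    "tail_sum (edge_degs n j (contract g k)) (squeeze k i) =
      tail_sum (edge_degs n j g) i - (if i < k then b else 0)"
    using iE ik by (simp_all add: edge_degs_contract tail_sum_remove_nth ab)
  have vd: "vert_degs n j (contract g i) = vert_degs n j (contract g k)"
    by (simp add: vert_degs_contract g i k same)
  have s12: "src (edges (contract g i) ! squeeze i k) = p1 \<longleftrightarrow> src (edges g ! k) \<noteq> p2"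
    using src_eq_endp_or_endq[of g k] o m1 by (auto simp: edge_contract[OF iE ik] same pq[symmetric])
  have s21: "src (edges (contract g k) ! squeeze k i) = p1 \<longleftrightarrow> src (edges g ! i) = p1"
    using src_eq_endp_or_endq[of g i] o m1 by (auto simp: edge_contract[OF iE(2,1) ik[symmetric]] same pq[symmetric])
  \<comment> \<open>The vertex terms agree on both sides and \<open>a = b\<close>. The order of the
    edges contributes \<open>a * a\<close>. Contracting \<open>i\<close> first reverses
    \<open>k\<close> relative to the order of its endpoints, since \<open>q\<close> moves below
    \<open>p2\<close>, and this contributes \<open>a + 1\<close>. The sum is odd.\<close>
  show "odd (contr_exp n j g i + contr_exp n j (contract g i) (squeeze i k) -
         (contr_exp n j g k + contr_exp n j (contract g k) (squeeze k i)))"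
    unfolding contr_exp_def eq e12 e21 s12 s21 same pq[symmetric] ed et vd vq ab[symmetric]
      degree_contract[OF g i] degree_contract[OF g k] a_b
    using ik by (cases "i < k"; cases "even a"; cases "even b"; auto)
qed

text \<open>The basic sign rule. It gives both the vanishing of the square of the differential and,
  applied to the new edge of a pull-out, the signs of the homotopy
  (\<open>blow_signs\<close>).\<close>

lemma contract_commute:
  assumes g: "labeled_graph g" and i: "contractible g i" and k: "contractible g k"
    and ik: "i \<noteq> k" and ex: "contractible (contract g i) (squeeze i k)"
  shows "contract (contract g i) (squeeze i k) = contract (contract g k) (squeeze k i)"
    and "contractible (contract g k) (squeeze k i)"
    and "contr_sign n j g i * contr_sign n j (contract g i) (squeeze i k) =
         - (contr_sign n j g k * contr_sign n j (contract g k) (squeeze k i))"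
proof -
  have iE: "i < nedges g" "k < nedges g" using i k by (auto simp: contractible_def)
  have "contract (contract g i) (squeeze i k) = contract (contract g k) (squeeze k i) \<and>
    contractible (contract g k) (squeeze k i) \<and>
    odd (contr_exp n j g i + contr_exp n j (contract g i) (squeeze i k) -
         (contr_exp n j g k + contr_exp n j (contract g k) (squeeze k i)))"
  proof (cases "endq g i" "endq g k" rule: linorder_cases)
    case less
    then show ?thesis using contract_commute_less(1,3)[OF g i k less] contract_commute_less(4)[OF g i k less, of n j] by blast
  next
    case greater
    then show ?thesis using contract_commute_less(1-3)[OF g k i greater] contract_commute_less(4)[OF g k i greater, of n j] by auto
  next
    case equal
    \<comment> \<open>Parallel edges are excluded: the contraction of one would make the other a
      loop edge.\<close>
    have "endp g k < endq g k" using k by (simp add: contractible_def)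
    then have "merge (endp g k) (endq g k) (endp g k) = merge (endp g k) (endq g k) (endq g k)"
      by (simp add: merge_eq_iff)
    then have "endp g i \<noteq> endp g k"
      using ex by (auto simp: contractible_def[of "contract g i"] endp_endq_contract[OF iE ik] equal)
    then consider "endp g i < endp g k" | "endp g k < endp g i" by linarith
    then show ?thesis
    proof cases
      case 1
      then show ?thesis using contract_commute_same_end(1,3)[OF g i k equal 1] contract_commute_same_end(4)[OF g i k equal 1, of n j] ex by blast
    next
      case 2
      then show ?thesis using contract_commute_same_end(1-3)[OF g k i equal[symmetric] 2]
        contract_commute_same_end(4)[OF g k i equal[symmetric] 2, of n j] ex by auto
    qed
  qed
  moreover from calculation have "squeeze i k < nedges (contract g i)" "squeeze k i < nedges (contract g k)"
    using ex by (auto simp: contractible_def[of "contract g i"] contractible_def[of "contract g k"])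
  ultimately show "contract (contract g i) (squeeze i k) = contract (contract g k) (squeeze k i)"
    and "contractible (contract g k) (squeeze k i)"
    and "contr_sign n j g i * contr_sign n j (contract g i) (squeeze i k) =
         - (contr_sign n j g k * contr_sign n j (contract g k) (squeeze k i))"
    using iE by (auto simp: contr_sign_exp sgn_pow_parity)
qed

section \<open>Half-edges and relabelings\<close>

text \<open>A half-edge is a pair of the index of an edge and a Boolean, which is true at the source.\<close>

definition hvert :: "lgraph \<Rightarrow> nat \<times> bool \<Rightarrow> nat" where
  "hvert g x = (if snd x then src (edges g ! fst x) else tgt (edges g ! fst x))"

definition halves :: "lgraph \<Rightarrow> ekind \<Rightarrow> nat \<Rightarrow> (nat \<times> bool) set" where
  "halves g t v = {x. fst x < nedges g \<and> kind (edges g ! fst x) = t \<and> hvert g x = v}"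

lemma finite_halves [simp]: "finite (halves g t v)"
  by (rule finite_subset[of _ "{..<nedges g} \<times> UNIV"]) (auto simp: halves_def)

text \<open>The two half-edges of a loop edge are distinct pairs, so both are counted. Changes of
  valence can now be read off from bijections of half-edges.\<close>

lemma valence_card: "valence g t v = card (halves g t v)"
proof -
  have "halves g t v = ({..<nedges g} \<times> UNIV) \<inter> {x. kind (edges g ! fst x) = t \<and> hvert g x = v}"
    by (auto simp: halves_def)
  then have "card (halves g t v) =
      (\<Sum>x \<in> {..<nedges g} \<times> UNIV. of_bool (kind (edges g ! fst x) = t \<and> hvert g x = v))"
    by simp
  also have "\<dots> = (\<Sum>k<nedges g. \<Sum>b\<in>UNIV. of_bool (kind (edges g ! k) = t \<and> hvert g (k, b) = v))"
    by (simp add: sum.cartesian_product split_def del: sum_of_bool_eq)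
  also have "\<dots> = valence g t v"
    unfolding valence_def sum_list_sum_nth atLeast0LessThan length_map
    by (rule sum.cong) (auto simp: UNIV_bool hvert_def)
  finally show ?thesis by simp
qed

text \<open>A relabeling, possibly trivial, together with the maps \<open>t\<close> on vertices and \<open>f\<close> on half-edges
  that it induces.\<close>

inductive step :: "int \<Rightarrow> int \<Rightarrow> lgraph \<Rightarrow> rat \<Rightarrow> (nat \<Rightarrow> nat) \<Rightarrow> (nat \<times> bool \<Rightarrow> nat \<times> bool) \<Rightarrow> lgraph \<Rightarrow> bool"
  for n j :: int where
  refl: "step n j g 1 id id g"
| swap_edges:
    "\<lbrakk>Suc e < nedges g; kind (edges g ! e) = kind (edges g ! Suc e)\<rbrakk> \<Longrightarrow>
     step n j g (sgn_pow (edge_degs n j g ! e * edge_degs n j g ! Suc e)) id (apfst (flip e))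
       (LGraph (verts g) (swap_adjacent e (edges g)))"
| swap_verts:
    "\<lbrakk>Suc e < nverts g; (verts g ! e = White) = (verts g ! Suc e = White)\<rbrakk> \<Longrightarrow>
     step n j g (sgn_pow (vert_degs n j g ! e * vert_degs n j g ! Suc e)) (flip e) id
       (LGraph (swap_adjacent e (verts g)) (map (rename_edge (flip e)) (edges g)))"
| reverse:
    "e < nedges g \<Longrightarrow>
     step n j g (sgn_pow (edge_degs n j g ! e + 1)) id (\<lambda>(k, b). (k, b \<noteq> (k = e)))
       (LGraph (verts g) ((edges g)[e := reverse_edge (edges g ! e)]))"

lemma relabel_imp_step: "relabel n j g s h \<Longrightarrow> \<exists>t f. step n j g s t f h"
  by (induction rule: relabel.induct) (auto intro: step.intros simp flip: flip_def)

lemma step_imp_relabel: "step n j g s t f h \<Longrightarrow> relabel n j g s h \<or> (s = 1 \<and> h = g)"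
  by (induction rule: step.induct) (auto intro: relabel.intros simp: flip_def[abs_def])

lemma vert_degs_nth: "v < nverts g \<Longrightarrow> vert_degs n j g ! v = vert_deg n j (verts g ! v)"
  and edge_degs_nth: "k < nedges g \<Longrightarrow> edge_degs n j g ! k = edge_deg n j (kind (edges g ! k))"
  by (simp_all add: vert_degs_def edge_degs_def)

lemma vert_deg_White: "(a = White) = (b = White) \<Longrightarrow> vert_deg n j a = vert_deg n j b"
  by (cases a; cases b) auto

lemma step_bij:
  assumes "step n j g s t f h"
  shows "t (t v) = v" "f (f x) = x" "nverts h = nverts g" "nedges h = nedges g"
    "t v < nverts g \<longleftrightarrow> v < nverts g" "fst (f x) < nedges g \<longleftrightarrow> fst x < nedges g"
    "fst (f x) = fst (f (fst x, b))"
    "s * s = 1"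
  using assms by (induction rule: step.induct) (auto simp: apfst_def map_prod_def split: prod.splits)

lemma swap_adjacent_same: "xs ! i = xs ! Suc i \<Longrightarrow> swap_adjacent i xs = xs"
  by (simp add: swap_adjacent_def) (metis list_update_id)

text \<open>Swapped neighbours agree in colour or in edge kind. Hence the lists of colours and of
  edge kinds are fixed and not merely permuted, which leaves degrees and the number of black
  vertices unchanged.\<close>

lemma step_transport:
  assumes "step n j g s t f h"
  shows "v < nverts g \<Longrightarrow> verts h ! t v = verts g ! v"
    "fst x < nedges g \<Longrightarrow> kind (edges h ! fst (f x)) = kind (edges g ! fst x)"
    "fst x < nedges g \<Longrightarrow> hvert h (f x) = t (hvert g x)"
    "map (\<lambda>v. v = White) (verts h) = map (\<lambda>v. v = White) (verts g)"
    "map kind (edges h) = map kind (edges g)"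
  using assms
proof (atomize (full), induction rule: step.induct)
  case (refl g)
  then show ?case by simp
next
  case (swap_edges e g)
  then show ?case
    by (cases x) (simp add: hvert_def nth_swap_adjacent map_swap_adjacent swap_adjacent_same)
next
  case (swap_verts e g)
  then show ?case
    by (cases x) (simp add: hvert_def nth_swap_adjacent map_swap_adjacent swap_adjacent_same comp_def)
next
  case (reverse e g)
  have "map kind ((edges g)[e := reverse_edge (edges g ! e)]) = map kind (edges g)"
    using reverse by (simp add: map_update list_update_same_conv)
  then show ?case using reverse
    by (cases x) (auto simp: hvert_def nth_list_update)
qed

lemma step_labeled_graph:
  assumes "step n j g s t f h" "labeled_graph g"
  shows "labeled_graph h"
proof -
  have d: "map (\<lambda>e. kind e = Dashed) (edges h) = map (\<lambda>t. t = Dashed) (map kind (edges h))" for h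
    by simp
  have "hvert h x < nverts h" if "fst x < nedges h" for x
  proof -
    have x: "fst (f x) < nedges g" using that step_bij[OF assms(1)] by metis
    have "hvert h x = t (hvert g (f x))"
      using step_transport(3)[OF assms(1) x] step_bij(2)[OF assms(1)] by metis
    moreover have "hvert g (f x) < nverts g"
      using x assms(2) by (auto simp: hvert_def labeled_graph_def)
    ultimately show ?thesis using step_bij[OF assms(1)] by metis
  qed
  from this[of "(_, True)"] this[of "(_, False)"] show ?thesis
    using assms(2) step_transport(4)[OF assms(1)] 
    unfolding labeled_graph_def d step_transport(5)[OF assms(1)]
    by (auto simp: in_set_conv_nth hvert_def)
qed

text \<open>Only the unordered pair is carried along, since a swap of vertices can exchange the
  smaller and the larger endpoint.\<close>

lemma step_endpoints:
  assumes "step n j g s t f h" "i < nedges g"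
  defines "i' \<equiv> fst (f (i, True))"
  shows "{endp h i', endq h i'} = t ` {endp g i, endq g i}"
proof -
  have *: "{endp g i, endq g i} = {hvert g (i, True), hvert g (i, False)}" for g i
    by (auto simp: endp_def endq_def hvert_def min_def max_def)
  have f: "fst (f (i, b)) = i'" for b
    using step_bij(7)[OF assms(1), of "(i, b)" True] by (simp add: i'_def)
  have ne: "f (i, True) \<noteq> f (i, False)" using step_bij(2)[OF assms(1)] by (metis prod.inject)
  obtain b c where bc: "f (i, True) = (i', b)" "f (i, False) = (i', c)"
    using f[of True] f[of False] by (metis prod.collapse)
  then have "b = (\<not> c)" using ne by auto
  then have "{hvert h (i', True), hvert h (i', False)} = {hvert h (f (i, True)), hvert h (f (i, False))}"
    unfolding bc by (cases c) auto
  also have "\<dots> = {t (hvert g (i, True)), t (hvert g (i, False))}"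
    using step_transport(3)[OF assms(1), of "(i, True)"] step_transport(3)[OF assms(1), of "(i, False)"] assms(2)
    by simp
  finally show ?thesis
    unfolding *[of h i'] *[of g i] by simp
qed

lemma endp_less: "labeled_graph g \<Longrightarrow> i < nedges g \<Longrightarrow> endp g i < nverts g"
  using endp_le_endq[of g i] endq_less[of g i] by simp

lemma step_contractible_iff:
  assumes st: "step n j g s t f h" and g: "labeled_graph g" and iE: "i < nedges g"
  shows "contractible h (fst (f (i, True))) \<longleftrightarrow> contractible g i"
proof -
  let ?i = "fst (f (i, True))"
  have k: "?i < nedges h" using step_bij(4,6)[OF st] iE by simp
  have ends: "{endp h ?i, endq h ?i} = t ` {endp g i, endq g i}" by (rule step_endpoints[OF st iE])
  have "endp h ?i = endq h ?i \<longleftrightarrow> t (endp g i) = t (endq g i)"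
    using ends by (auto simp: doubleton_eq_iff)
  then have lt: "endp h ?i < endq h ?i \<longleftrightarrow> endp g i < endq g i"
    using step_bij(1)[OF st] endp_le_endq[of h ?i] endp_le_endq[of g i] by (metis le_neq_implies_less nat_less_le)
  have white: "verts h ! t v = White \<longleftrightarrow> verts g ! v = White" if "v < nverts g" for v
    using step_transport(1)[OF st that] by simp
  have q: "endq h ?i < nverts h" using endq_less step_labeled_graph[OF st g] k by blast
  \<comment> \<open>\<open>contractible\<close> asks for the colour of the larger endpoint, which a
    relabeling may exchange with the smaller one. Since white vertices come last, it amounts to the
    symmetric condition that some endpoint is white.\<close>
  have some: "verts g ! endq g i = White \<longleftrightarrow> (\<exists>v \<in> {endp g i, endq g i}. verts g ! v = White)"
    using sorted_white[OF g endp_le_endq endq_less[OF g iE]] by auto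
  have some': "verts h ! endq h ?i = White \<longleftrightarrow> (\<exists>v \<in> {endp h ?i, endq h ?i}. verts h ! v = White)"
    using sorted_white[OF step_labeled_graph[OF st g] endp_le_endq q] by auto
  have "verts h ! endq h ?i = White \<longleftrightarrow> verts g ! endq g i = White"
    unfolding some some' ends using endq_less[OF g iE] endp_less[OF g iE] by (simp add: white)
  then show ?thesis
    using k q lt iE endq_less[OF g iE] step_transport(2)[OF st, of "(i, True)"] by (simp add: contractible_def)
qed

lemma step_contractible:
  assumes "step n j g s t f h" "labeled_graph g" "contractible g i"
  shows "contractible h (fst (f (i, True)))"
  using step_contractible_iff[OF assms(1,2)] assms(3) by (simp add: contractible_def[of g])

section \<open>Contracting an edge of a relabeled graph\<close>

lemma endp_endq_cong:
  assumes "edges h ! k = edges g ! i"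
  shows "endp h k = endp g i" "endq h k = endq g i"
  using assms by (simp_all add: endp_def endq_def)

lemma Suc_squeeze: "i \<noteq> e \<Longrightarrow> i \<noteq> Suc e \<Longrightarrow> Suc (squeeze i e) = squeeze i (Suc e)"
  by (auto simp: squeeze_def)

lemma squeeze_flip:
  assumes "i \<noteq> e" "i \<noteq> Suc e" "k \<noteq> i"
  shows "flip (squeeze i e) (squeeze i k) = squeeze i (flip e k)"
proof -
  have "flip e k = bump i (flip (squeeze i e) (squeeze i k))"
    using flip_bump[OF assms(1,2), of "squeeze i k"] assms(3) by simp
  then show ?thesis by simp
qed

lemma squeeze_flip_hit:
  assumes "i = e \<or> i = Suc e" "k \<noteq> i"
  shows "squeeze (flip e i) (flip e k) = squeeze i k"
proof -
  have "bump (flip e i) (squeeze i k) = flip e k"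
    using flip_bump_flip[OF assms(1), of "squeeze i k"] assms(2) by (metis bump_squeeze flip_flip)
  then show ?thesis by (metis squeeze_bump)
qed

text \<open>The relabeling descends to the contractions at corresponding edges. Its sign is
  corrected by both contraction signs, as the differential requires in order to pass to the
  quotient. The values of \<open>f'\<close> are recorded in order to follow a half-edge into the
  contraction.\<close>

definition step_over :: "int \<Rightarrow> int \<Rightarrow> lgraph \<Rightarrow> rat \<Rightarrow> (nat \<times> bool \<Rightarrow> nat \<times> bool) \<Rightarrow> lgraph \<Rightarrow> nat \<Rightarrow> bool" where
  "step_over n j g s f h i \<longleftrightarrow>
     (\<exists>t' f'. step n j (contract g i)
           (s * contr_sign n j g i * contr_sign n j h (fst (f (i, True)))) t' f'
           (contract h (fst (f (i, True)))) \<and>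
        (\<forall>k b. k < nedges g \<longrightarrow> k \<noteq> i \<longrightarrow>
           f' (squeeze i k, b) = apfst (squeeze (fst (f (i, True)))) (f (k, b))))"

text \<open>If \<open>i\<close> is one of the swapped edges, both contractions are the same graph,
  and the Koszul sign of moving \<open>i\<close> to the end changes by exactly the sign of the swap.
  Otherwise the swap survives at squeezed positions.\<close>

lemma step_over_swap_edges:
  assumes g: "labeled_graph g" and i: "contractible g i"
    and e: "Suc e < nedges g" "kind (edges g ! e) = kind (edges g ! Suc e)"
  shows "step_over n j g (sgn_pow (edge_degs n j g ! e * edge_degs n j g ! Suc e)) (apfst (flip e))
    (LGraph (verts g) (swap_adjacent e (edges g))) i"
proof -
  define h where "h = LGraph (verts g) (swap_adjacent e (edges g))"
  define i' where "i' = flip e i"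
  have h: "verts h = verts g" "edges h = swap_adjacent e (edges g)" by (simp_all add: h_def)
  have iE: "i < nedges g" using i by (simp add: contractible_def)
  have i'E: "i' < nedges h" using iE e by (simp add: i'_def h)
  have ei: "edges h ! i' = edges g ! i" using e by (simp add: h i'_def nth_swap_adjacent)
  note ends = endp_endq_cong[OF ei]
  have vd: "vert_degs n j h = vert_degs n j g" by (simp add: vert_degs_def h)
  have ed: "edge_degs n j h = swap_adjacent e (edge_degs n j g)"
    using e by (simp add: edge_degs_def h map_swap_adjacent)
  have vc: "verts (contract h i') = verts (contract g i)" by (simp add: verts_contract ends h)
  then have vdc: "vert_degs n j (contract h i') = vert_degs n j (contract g i)" by (simp add: vert_degs_def)
  have deg: "degree n j h = degree n j g" using e by (simp add: degree_def vd ed)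
  let ?ed = "edge_degs n j g"
  have edi: "edge_degs n j h ! i' = ?ed ! i"
    using e by (simp add: ed i'_def nth_swap_adjacent)
  have ts: "tail_sum (edge_degs n j h) i' =
    (if i = e then tail_sum ?ed i - ?ed ! Suc e else if i = Suc e then tail_sum ?ed i + ?ed ! e
     else tail_sum ?ed i)"
    using e by (simp add: ed i'_def tail_sum_swap_adjacent)
  have ex: "contr_exp n j h i' = contr_exp n j g i +
     (if i = e \<or> i = Suc e then (if i = e then -1 else 1) * (?ed ! e * ?ed ! Suc e) else 0)"
    unfolding contr_exp_def vdc deg vd ends edi ei ts by (auto simp: algebra_simps)
  have sg: "contr_sign n j g i = sgn_pow (contr_exp n j g i)" "contr_sign n j h i' = sgn_pow (contr_exp n j h i')"
    using iE i'E by (simp_all add: contr_sign_exp)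
  have "step_over n j g (sgn_pow (?ed ! e * ?ed ! Suc e)) (apfst (flip e)) h i"
  proof (cases "i = e \<or> i = Suc e")
    case True
    have "edges (contract h i') = edges (contract g i)"
      unfolding edges_contract ends h unfolding i'_def using remove_nth_swap_adjacent_hit[OF e(1) True] by simp
    with vc have c: "contract h i' = contract g i" using lgraph.expand by blast
    have "sgn_pow (?ed ! e * ?ed ! Suc e) * contr_sign n j g i * contr_sign n j h i' = 1"
      using True unfolding sg ex by (auto simp: sgn_pow_parity)
    then have "step n j (contract g i)
      (sgn_pow (?ed ! e * ?ed ! Suc e) * contr_sign n j g i * contr_sign n j h i') id id (contract h i')"
      unfolding c by (simp add: step.refl)
    then show ?thesis
      unfolding step_over_def using squeeze_flip_hit[OF True]
      by (auto simp: i'_def intro!: exI)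
  next
    case False
    let ?e = "squeeze i e"
    have fi: "flip e i = i" using False by (simp add: flip_def)
    have es: "edges (contract h i') = swap_adjacent ?e (edges (contract g i))"
    proof -
      have "Suc ?e < length (remove_nth i (edges g))"
        using e iE False squeeze_less[of i "nedges g" "Suc e"] by (simp add: Suc_squeeze)
      then show ?thesis
        using False e iE remove_nth_swap_adjacent[of e "edges g" i]
        unfolding edges_contract ends h unfolding i'_def
        by (simp add: flip_def map_swap_adjacent)
    qed
    have c: "contract h i' = LGraph (verts (contract g i)) (swap_adjacent ?e (edges (contract g i)))"
      using es vc by (metis lgraph.collapse)
    have Suc: "Suc ?e = squeeze i (Suc e)" using False by (simp add: Suc_squeeze)
    have l: "Suc ?e < nedges (contract g i)"
      unfolding Suc nedges_contract[OF i] using squeeze_less[of i "nedges g" "Suc e"] e iE False by auto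
    have "sgn_pow (?ed ! e * ?ed ! Suc e) * contr_sign n j g i * contr_sign n j h i' =
      sgn_pow (edge_degs n j (contract g i) ! ?e * edge_degs n j (contract g i) ! Suc ?e)"
      unfolding sg ex edge_degs_contract Suc using False e iE
      by (simp add: nth_remove_nth_squeeze)
    moreover have "kind (edges (contract g i) ! ?e) = kind (edges (contract g i) ! Suc ?e)"
      unfolding Suc using e iE False by (simp add: edge_contract)
    ultimately have "step n j (contract g i)
      (sgn_pow (?ed ! e * ?ed ! Suc e) * contr_sign n j g i * contr_sign n j h i') id (apfst (flip ?e)) (contract h i')"
      unfolding c using step.swap_edges[OF l] by simp
    then show ?thesis
      unfolding step_over_def using squeeze_flip[of i e] False fi
      by (auto simp: i'_def intro!: exI)
  qed
  then show ?thesis by (simp add: h_def)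
qed

text \<open>Reversing the contracted edge affects only \<open>eta\<close>, by the same factor as the
  sign of the reversal. Any other reversal survives the contraction.\<close>

lemma step_over_reverse:
  assumes g: "labeled_graph g" and i: "contractible g i" and e: "e < nedges g"
  shows "step_over n j g (sgn_pow (edge_degs n j g ! e + 1)) (\<lambda>(k, b). (k, b \<noteq> (k = e)))
       (LGraph (verts g) ((edges g)[e := reverse_edge (edges g ! e)])) i"
proof -
  define h where "h = LGraph (verts g) ((edges g)[e := reverse_edge (edges g ! e)])"
  have h: "verts h = verts g" "edges h = (edges g)[e := reverse_edge (edges g ! e)]" by (simp_all add: h_def)
  have iE: "i < nedges g" using i by (simp add: contractible_def)
  have ends: "endp h i = endp g i" "endq h i = endq g i"
    using e by (cases "e = i"; simp add: endp_def endq_def h min.commute max.commute)+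
  have vd: "vert_degs n j h = vert_degs n j g" by (simp add: vert_degs_def h)
  have ed: "edge_degs n j h = edge_degs n j g"
    using e by (simp add: edge_degs_def h map_update list_update_same_conv)
  have vc: "verts (contract h i) = verts (contract g i)" by (simp add: verts_contract ends h)
  then have vdc: "vert_degs n j (contract h i) = vert_degs n j (contract g i)" by (simp add: vert_degs_def)
  have deg: "degree n j h = degree n j g" by (simp add: degree_def vd ed)
  have sg: "contr_sign n j g i = sgn_pow (contr_exp n j g i)" "contr_sign n j h i = sgn_pow (contr_exp n j h i)"
    using iE by (simp_all add: contr_sign_exp h)
  let ?s = "sgn_pow (edge_degs n j g ! e + 1)"
  have ne: "endp g i \<noteq> endq g i" using i by (simp add: contractible_def)
  have src: "src (edges h ! i) = endp g i \<longleftrightarrow> (src (edges g ! i) = endp g i) \<noteq> (e = i)"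
    using ne e by (cases "e = i") (auto simp: h endp_def endq_def min_def max_def split: if_splits)
  have "step_over n j g ?s (\<lambda>(k, b). (k, b \<noteq> (k = e))) h i"
  proof (cases "i = e")
    case True
    have "edges (contract h i) = edges (contract g i)"
      unfolding edges_contract ends unfolding h True by (simp add: remove_nth_def)
    with vc have c: "contract h i = contract g i" using lgraph.expand by blast
    have "?s * contr_sign n j g i * contr_sign n j h i = 1"
      unfolding sg contr_exp_def vdc deg vd ends ed src unfolding True by (auto simp: sgn_pow_parity)
    then have "step n j (contract g i) (?s * contr_sign n j g i * contr_sign n j h i) id id (contract h i)"
      unfolding c by (simp add: step.refl)
    then show ?thesis
      unfolding step_over_def using True by (auto intro!: exI)
  next
    case False
    let ?e = "squeeze i e"
    have es: "edges (contract h i) = (edges (contract g i))[?e := reverse_edge (edges (contract g i) ! ?e)]"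
    proof (rule nth_equalityI)
      fix u assume "u < nedges (contract h i)"
      then have u: "u < nedges g - 1" using iE by (simp add: edges_contract h)
      then have b: "bump i u < nedges g" "bump i u \<noteq> i" "squeeze i (bump i u) = u" using iE by auto
      have "?e < nedges g - 1" using squeeze_less[OF iE e] False by simp
      then show "edges (contract h i) ! u =
         (edges (contract g i))[?e := reverse_edge (edges (contract g i) ! ?e)] ! u"
        using edge_contract[of i h "bump i u"] edge_contract[of i g "bump i u"] edge_contract[of i g e]
          b iE e False u
        by (auto simp: ends h nth_list_update nedges_contract[OF i] rename_edge_reverse bump_squeeze)
    qed (use iE in \<open>simp add: edges_contract h\<close>)
    have c: "contract h i = LGraph (verts (contract g i)) ((edges (contract g i))[?e := reverse_edge (edges (contract g i) ! ?e)])"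
      using es vc by (metis lgraph.collapse)
    have l: "?e < nedges (contract g i)"
      unfolding nedges_contract[OF i] using squeeze_less[OF iE e] False by auto
    have "?s * contr_sign n j g i * contr_sign n j h i = sgn_pow (edge_degs n j (contract g i) ! ?e + 1)"
      unfolding sg edge_degs_contract using False e iE ends
      by (simp add: nth_remove_nth_squeeze contr_exp_def vdc deg vd ends ed src)
    then have "step n j (contract g i) (?s * contr_sign n j g i * contr_sign n j h i)
        id (\<lambda>(k, b). (k, b \<noteq> (k = ?e))) (contract h i)"
      unfolding c using step.reverse[OF l] by simp
    moreover have "squeeze i k = ?e \<longleftrightarrow> k = e" if "k \<noteq> i" for k
      using that False by (metis bump_squeeze)
    ultimately show ?thesis
      unfolding step_over_def by (auto intro!: exI)
  qed
  then show ?thesis by (simp add: h_def)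
qed

lemma merge_flip_commute:
  assumes "p < q" "q \<noteq> e" "q \<noteq> Suc e"
  shows "merge (flip e p) q (flip e v) = flip (squeeze q e) (merge p q v)"
proof (cases "v = q")
  case True
  have "flip e q = q" "squeeze q p = p" using assms by (auto simp: flip_def squeeze_def)
  then show ?thesis using squeeze_flip[OF assms(2,3), of p] assms
    by (simp add: merge_def True) (auto simp: flip_def squeeze_def)
next
  case False
  have "flip e v \<noteq> q" using False assms by (metis flip_flip flip_def)
  then show ?thesis using squeeze_flip[OF assms(2,3) False] False by (simp add: merge_def)
qed

lemma merge_flip_end:
  "q = e \<or> q = Suc e \<Longrightarrow> p < e \<Longrightarrow> merge p (flip e q) (flip e v) = merge p q v"
  using squeeze_flip_hit[of q e v] by (simp add: merge_def)

lemma merge_flip_both: "merge e (Suc e) (flip e v) = merge e (Suc e) v"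
  by (simp add: merge_def) (auto simp: flip_def squeeze_def)

lemma swap_adjacent_update:
  "Suc e < length xs \<Longrightarrow> p < length xs \<Longrightarrow>
   (swap_adjacent e xs)[flip e p := w] = swap_adjacent e (xs[p := w])"
  by (rule nth_equalityI) (auto simp: nth_swap_adjacent nth_list_update)

text \<open>If the deleted vertex \<open>q\<close> is not swapped, the swap survives. Otherwise both
  contractions are the same graph. If \<open>q\<close> is swapped with a vertex other than
  \<open>p\<close>, its Koszul sign changes by the sign of the swap. If \<open>p\<close> and
  \<open>q\<close> are swapped, the Koszul sign stays and the edge is reversed relative to its
  endpoints. This costs its degree plus one, which has the parity of the vertex degree and so of its
  square.\<close>

lemma step_over_swap_verts:
  assumes g: "labeled_graph g" and i: "contractible g i"
    and e: "Suc e < nverts g" "(verts g ! e = White) = (verts g ! Suc e = White)"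
  shows "step_over n j g (sgn_pow (vert_degs n j g ! e * vert_degs n j g ! Suc e)) id
    (LGraph (swap_adjacent e (verts g)) (map (rename_edge (flip e)) (edges g))) i"
proof -
  define h where "h = LGraph (swap_adjacent e (verts g)) (map (rename_edge (flip e)) (edges g))"
  have h: "verts h = swap_adjacent e (verts g)" "edges h = map (rename_edge (flip e)) (edges g)"
    by (simp_all add: h_def)
  define p q where "p = endp g i" "q = endq g i"
  note pq = this
  have o: "p < q" "q < nverts g" "i < nedges g" using i by (auto simp: contractible_def pq)
  have st: "step n j g (sgn_pow (vert_degs n j g ! e * vert_degs n j g ! Suc e)) (flip e) id h"
    unfolding h_def by (rule step.swap_verts[OF e])
  have lh: "labeled_graph h" using step_labeled_graph[OF st g] .
  have ch: "contractible h i" using step_contractible[OF st g i] by simp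
  let ?vd = "vert_degs n j g"
  let ?s = "sgn_pow (?vd ! e * ?vd ! Suc e)"
  have vd: "vert_degs n j h = swap_adjacent e ?vd"
    using e by (simp add: vert_degs_def h map_swap_adjacent)
  have ed: "edge_degs n j h = edge_degs n j g" by (simp add: edge_degs_def h comp_def)
  have deg: "degree n j h = degree n j g" using e by (simp add: degree_def vd ed)
  have sg: "contr_sign n j g i = sgn_pow (contr_exp n j g i)" "contr_sign n j h i = sgn_pow (contr_exp n j h i)"
    using o by (simp_all add: contr_sign_exp h)
  have src: "src (edges h ! i) = flip e (src (edges g ! i))" using o by (simp add: h)
  have ends: "endp h i = min (flip e p) (flip e q)" "endq h i = max (flip e p) (flip e q)"
    using o by (cases "src (edges g ! i) \<le> tgt (edges g ! i)";
        simp add: endp_def endq_def h pq min.commute max.commute min_def max_def)+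
  have vde: "?vd ! e = ?vd ! Suc e"
    using e by (simp add: vert_degs_nth vert_deg_White[OF e(2)])
  have qh: "endq h i < nverts g" using ch by (simp add: contractible_def h)
  have vs: "sum_list (vert_degs n j (contract h i)) = sum_list ?vd - vert_degs n j h ! endq h i"
    "sum_list (vert_degs n j (contract g i)) = sum_list ?vd - ?vd ! q"
    using qh o e by (simp_all add: vert_degs_contract g lh i ch sum_list_remove_nth vd pq[symmetric])
  have vq: "?vd ! q = - (edge_degs n j g ! i) - 1" using contractible_degs[OF i] by (simp add: pq)
  have "step_over n j g ?s id h i"
  proof (cases "q = e \<or> q = Suc e")
    case False
    let ?e = "squeeze q e"
    have fq: "flip e q = q" and fp: "flip e p < q" using False o by (auto simp: flip_def)
    have e': "endp h i = flip e p" "endq h i = q" using fq fp by (simp_all add: ends)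
    have Suc: "Suc ?e = squeeze q (Suc e)" using False by (simp add: Suc_squeeze)
    have l: "?e < nverts g - 1" "Suc ?e < nverts g - 1"
      unfolding Suc using squeeze_less[of q "nverts g" "Suc e"] squeeze_less[of q "nverts g" e] e o False
      by auto
    have "map (rename_edge (merge (flip e p) q)) (remove_nth i (edges h)) =
        map (rename_edge (flip ?e)) (edges (contract g i))"
      using False o merge_flip_commute[of p q e]
      by (simp add: h edges_contract pq[symmetric] map_remove_nth rename_edge_comp comp_def)
    then have ec: "edges (contract h i) = map (rename_edge (flip ?e)) (edges (contract g i))"
      by (simp add: edges_contract[of h] e')
    have vc: "verts (contract h i) = swap_adjacent ?e (verts (contract g i))"
      using o e False fq swap_adjacent_update[of e "verts g" p]
        remove_nth_swap_adjacent[of e "(verts g)[p := join_kind (verts g ! p) (verts g ! q)]" q]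
      by (simp add: verts_contract e' pq[symmetric] h nth_swap_adjacent)
    have c: "contract h i = LGraph (swap_adjacent ?e (verts (contract g i))) (map (rename_edge (flip ?e)) (edges (contract g i)))"
      using ec vc by (metis lgraph.collapse)
    have w: "(verts (contract g i) ! ?e = White) = (verts (contract g i) ! Suc ?e = White)"
    proof -
      have "verts (contract g i) ! squeeze q v = White \<longleftrightarrow> verts g ! v = White"
        if "v \<noteq> q" "v < nverts g" for v
        using arg_cong[OF map_white_contract[OF g i], of "\<lambda>xs. xs ! squeeze q v"] that o
          squeeze_less[of q "nverts g" v]
        by (simp add: pq[symmetric] nth_remove_nth_squeeze nverts_contract[OF i])
      then show ?thesis unfolding Suc using False e by auto
    qed
    have d: "vert_degs n j (contract g i) ! ?e = ?vd ! e" "vert_degs n j (contract g i) ! Suc ?e = ?vd ! Suc e"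
      unfolding Suc vert_degs_contract[OF g i] using False e o
      by (simp_all add: pq[symmetric] nth_remove_nth_squeeze)
    have "tail_sum (swap_adjacent e ?vd) q = tail_sum ?vd q"
      using tail_sum_swap_adjacent[of e ?vd q] e False fq by simp
    moreover have "swap_adjacent e ?vd ! q = ?vd ! q" using e fq by (simp add: nth_swap_adjacent)
    ultimately have "contr_exp n j h i = contr_exp n j g i"
      unfolding contr_exp_def deg vs e' vd ed pq[symmetric] src by (simp add: vs pq)
    then have "?s * contr_sign n j g i * contr_sign n j h i =
       sgn_pow (vert_degs n j (contract g i) ! ?e * vert_degs n j (contract g i) ! Suc ?e)"
      unfolding sg d by (auto simp: sgn_pow_parity)
    then have "step n j (contract g i) (?s * contr_sign n j g i * contr_sign n j h i) (flip ?e) id (contract h i)"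
      unfolding c using step.swap_verts[OF _ w] l by (simp add: nverts_contract[OF i])
    then show ?thesis
      unfolding step_over_def by (auto intro!: exI)
  next
    case True
    have "contract h i = contract g i \<and>
      odd (contr_exp n j h i - contr_exp n j g i - ?vd ! e * ?vd ! Suc e + 1)"
    proof (cases "p = e")
      case True
      then have qe: "q = Suc e" using \<open>q = e \<or> q = Suc e\<close> o by auto
      have e': "endp h i = e" "endq h i = Suc e" by (simp_all add: ends True qe flip_def)
      have "map (rename_edge (merge e (Suc e))) (edges h) = map (rename_edge (merge e (Suc e))) (edges g)"
        by (simp add: h rename_edge_comp comp_def merge_flip_both)
      then have ec: "edges (contract h i) = edges (contract g i)"
        by (simp add: edges_contract[of h] edges_contract[of g] pq[symmetric] e' True qe map_remove_nth)
      have "join_kind (verts g ! Suc e) (verts g ! e) = join_kind (verts g ! e) (verts g ! Suc e)"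
        using e(2) by (cases "verts g ! e"; cases "verts g ! Suc e") (auto simp: join_kind_def)
      then have vc: "verts (contract h i) = verts (contract g i)"
        using e by (intro nth_equalityI) (auto simp: verts_contract[of h] verts_contract[of g]
            pq[symmetric] e' True qe h nth_swap_adjacent nth_remove_nth nth_list_update bump_def flip_def)
      have ne: "p \<noteq> q" using o by simp
      have ts: "tail_sum (swap_adjacent e ?vd) (Suc e) = tail_sum ?vd (Suc e)"
        using tail_sum_swap_adjacent[of e ?vd e] e tail_sum_swap_adjacent[of e ?vd e]
        by (simp add: flip_def tail_sum_def Cons_nth_drop_Suc[symmetric, of "Suc e" ?vd])
      have "src (edges g ! i) = e \<or> src (edges g ! i) = Suc e"
        using src_eq_endp_or_endq[of g i] True qe pq by simp
      then have "odd (contr_exp n j h i - contr_exp n j g i - ?vd ! e * ?vd ! Suc e + 1)"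
        unfolding contr_exp_def deg vs e' vd ed pq[symmetric] src unfolding True qe ts
        using e vde vq qe by (auto simp: nth_swap_adjacent flip_def)
      then show ?thesis using ec vc lgraph.expand by blast
    next
      case False
      then have pe: "p < e" using True o by auto
      have fp: "flip e p = p" "p < flip e q" using pe True by (auto simp: flip_def)
      then have e': "endp h i = p" "endq h i = flip e q" by (simp_all add: ends)
      have "map (rename_edge (merge p (flip e q))) (edges h) = map (rename_edge (merge p q)) (edges g)"
        by (simp add: h rename_edge_comp comp_def merge_flip_end[OF True pe])
      then have ec: "edges (contract h i) = edges (contract g i)"
        by (simp add: edges_contract[of h] edges_contract[of g] pq[symmetric] e' map_remove_nth)
      have vc: "verts (contract h i) = verts (contract g i)"
        using remove_nth_swap_adjacent_hit[of e "(verts g)[p := join_kind (verts g ! p) (verts g ! q)]" q]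
          swap_adjacent_update[of e "verts g" p] e True o fp
        by (simp add: verts_contract[of h] verts_contract[of g] pq[symmetric] e' h nth_swap_adjacent)
      have "src (edges g ! i) = p \<or> src (edges g ! i) = q"
        using src_eq_endp_or_endq[of g i] pq by simp
      then have sr: "flip e (src (edges g ! i)) = p \<longleftrightarrow> src (edges g ! i) = p"
        using fp by (metis flip_eq_iff)
      have "odd (contr_exp n j h i - contr_exp n j g i - ?vd ! e * ?vd ! Suc e + 1)"
        unfolding contr_exp_def deg vs e' vd ed pq[symmetric] src sr
        using e vde True by (auto simp: nth_swap_adjacent tail_sum_swap_adjacent algebra_simps)
      then show ?thesis using ec vc lgraph.expand by blast
    qed
    then have c: "contract h i = contract g i" and
      od: "odd (contr_exp n j h i - contr_exp n j g i - ?vd ! e * ?vd ! Suc e + 1)" by auto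
    have "?s * contr_sign n j g i * contr_sign n j h i = 1"
      using od unfolding sg by (auto simp: sgn_pow_parity split: if_splits)
    then have "step n j (contract g i) (?s * contr_sign n j g i * contr_sign n j h i) id id (contract h i)"
      unfolding c by (simp add: step.refl)
    then show ?thesis
      unfolding step_over_def by (auto intro!: exI)
  qed
  then show ?thesis by (simp add: h_def)
qed

lemma step_contract:
  assumes st: "step n j g s t f h" and g: "labeled_graph g" and i: "contractible g i"
  obtains t' f' where
    "step n j (contract g i) (s * contr_sign n j g i * contr_sign n j h (fst (f (i, True)))) t' f'
       (contract h (fst (f (i, True))))"
    "\<And>k b. k < nedges g \<Longrightarrow> k \<noteq> i \<Longrightarrow> f' (squeeze i k, b) = apfst (squeeze (fst (f (i, True)))) (f (k, b))"
proof -
  have "i < nedges g" using i by (simp add: contractible_def)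
  then have "step_over n j g 1 id g i"
    unfolding step_over_def
    using step.refl[of n j "contract g i"] by (auto simp: contr_sign_exp intro!: exI)
  with st g i have "step_over n j g s f h i"
  proof (induction rule: step.induct)
    case (reverse e g)
    then show ?case using step_over_reverse by blast
  qed (auto intro: step_over_swap_edges step_over_swap_verts)
  then show ?thesis using that unfolding step_over_def by blast
qed

section \<open>Valence and connectivity\<close>

text \<open>Adjacency in terms of half-edges, on which relabelings and contractions act directly;
  \<open>apsnd Not\<close> passes to the other half of an edge.\<close>

definition adj :: "lgraph \<Rightarrow> nat \<Rightarrow> nat \<Rightarrow> bool" where
  "adj g u v \<longleftrightarrow> (\<exists>x. fst x < nedges g \<and> hvert g x = u \<and> hvert g (apsnd Not x) = v)"

lemma linked_adj: "linked g = {(u, v). adj g u v}\<^sup>*"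
proof -
  have "(\<exists>e \<in> set (edges g). {src e, tgt e} = {u, v}) \<longleftrightarrow> adj g u v" for u v
  proof
    assume "\<exists>e \<in> set (edges g). {src e, tgt e} = {u, v}"
    then obtain k where k: "k < nedges g" "{src (edges g ! k), tgt (edges g ! k)} = {u, v}"
      by (auto simp: in_set_conv_nth)
    then show "adj g u v"
      unfolding adj_def by (intro exI[of _ "(k, src (edges g ! k) = u)"]) (auto simp: hvert_def doubleton_eq_iff)
  next
    assume "adj g u v"
    then obtain k b where k: "k < nedges g" "hvert g (k, b) = u" "hvert g (k, \<not> b) = v"
      by (auto simp: adj_def)
    then show "\<exists>e \<in> set (edges g). {src e, tgt e} = {u, v}"
      by (intro bexI[of _ "edges g ! k"]) (cases b; auto simp: hvert_def)+
  qed
  then show ?thesis unfolding linked_def by simp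
qed

text \<open>An edge may go to a path of any length, even to a single vertex, as the contracted edge
  does.\<close>

lemma linked_map:
  assumes "(u, v) \<in> linked g" and "\<And>a b. adj g a b \<Longrightarrow> (F a, F b) \<in> linked h"
  shows "(F u, F v) \<in> linked h"
  using assms(1) unfolding linked_adj[of g]
proof (induction rule: rtrancl_induct)
  case base
  then show ?case by (simp add: linked_adj)
next
  case (step y z)
  then have "(F y, F z) \<in> linked h" using assms(2) by simp
  with step.IH show ?case unfolding linked_adj by (rule rtrancl_trans)
qed

lemma adj_linked: "adj g u v \<Longrightarrow> (u, v) \<in> linked g"
  by (simp add: linked_adj r_into_rtrancl)

lemma linked_refl [simp]: "(u, u) \<in> linked g"
  by (simp add: linked_adj)

lemma linked_trans: "(u, v) \<in> linked g \<Longrightarrow> (v, w) \<in> linked g \<Longrightarrow> (u, w) \<in> linked g"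
  unfolding linked_adj by (rule rtrancl_trans)

lemma hvert_less: "labeled_graph g \<Longrightarrow> fst x < nedges g \<Longrightarrow> hvert g x < nverts g"
  by (auto simp: hvert_def labeled_graph_def)

lemma step_valence:
  assumes "step n j g s t f h"
  shows "valence h k (t v) = valence g k v"
proof -
  note b = step_bij[OF assms] and tr = step_transport[OF assms]
  have "bij_betw f (halves g k v) (halves h k (t v))"
  proof (rule bij_betw_byWitness[where f' = f])
    show "f ` halves g k v \<subseteq> halves h k (t v)"
      using b tr(2,3) by (auto simp: halves_def)
    show "f ` halves h k (t v) \<subseteq> halves g k v"
    proof (clarsimp simp: halves_def)
      fix e c assume x: "e < nedges h" "k = kind (edges h ! e)" "hvert h (e, c) = t v"
      have l: "fst (f (e, c)) < nedges g" using x b by simp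
      have "t (hvert g (f (e, c))) = t v" using tr(3)[OF l] x b(2) by simp
      then have "hvert g (f (e, c)) = v" using b(1) by metis
      then show "fst (f (e, c)) < nedges g \<and> kind (edges g ! fst (f (e, c))) = kind (edges h ! e) \<and>
         hvert g (f (e, c)) = v"
        using l tr(2)[OF l] b(2) by simp
    qed
  qed (use b in auto)
  then show ?thesis using bij_betw_same_card by (fastforce simp: valence_card)
qed

lemma step_pair:
  assumes "step n j g s t f h"
  shows "f (apsnd Not x) = apsnd Not (f x)"
proof -
  obtain k b where x: "x = (k, b)" by fastforce
  have "fst (f (k, \<not> b)) = fst (f (k, b))"
    using step_bij(7)[OF assms, of "(k, b)" "\<not> b"] by simp
  moreover have "f (k, \<not> b) \<noteq> f (k, b)" using step_bij(2)[OF assms] by (metis prod.inject)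
  ultimately show ?thesis unfolding x by (cases "f (k, b)"; cases "f (k, \<not> b)") auto
qed

lemma step_adj:
  assumes "step n j g s t f h" "adj g u v"
  shows "adj h (t u) (t v)"
proof -
  obtain x where x: "fst x < nedges g" "hvert g x = u" "hvert g (apsnd Not x) = v"
    using assms(2) by (auto simp: adj_def)
  have "fst (apsnd Not x) < nedges g" using x by simp
  then show ?thesis
    using x step_bij(4,6)[OF assms(1)] step_transport(3)[OF assms(1)] step_pair[OF assms(1), of x]
    unfolding adj_def by metis
qed

lemma step_connected_graph:
  assumes "step n j g s t f h" "connected_graph g"
  shows "connected_graph h"
  unfolding connected_graph_def
proof safe
  note b = step_bij[OF assms(1)]
  assume "verts h = []"
  then show False using assms(2) b(3) by (simp add: connected_graph_def)
next
  note b = step_bij[OF assms(1)]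
  fix u v assume "u < nverts h" "v < nverts h"
  then have "(t u, t v) \<in> linked g" using assms(2) b by (simp add: connected_graph_def)
  then have "(t (t u), t (t v)) \<in> linked h"
    by (rule linked_map) (use step_adj[OF assms(1)] adj_linked in blast)
  then show "(u, v) \<in> linked h" using b by simp
qed

section \<open>Plain and hairy graphs, vertex by vertex\<close>

definition good_vertex :: "lgraph \<Rightarrow> nat \<Rightarrow> bool" where
  "good_vertex g v \<longleftrightarrow>
    (case verts g ! v of
       White \<Rightarrow> valence g Dashed v \<ge> 3 \<and> valence g Solid v = 0
     | Internal \<Rightarrow> valence g Solid v \<ge> 3 \<and> valence g Dashed v = 0
     | External \<Rightarrow> valence g Dashed v \<ge> 1)"

text \<open>In a connected graph one external vertex is linked to all vertices, so the condition on
  components becomes a single existence statement and what remains can be checked at each vertex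
  separately.\<close>

lemma plain_graphs_iff:
  "g \<in> plain_graphs \<longleftrightarrow> labeled_graph g \<and> connected_graph g \<and>
     (\<exists>u < nverts g. verts g ! u = External) \<and> (\<forall>v < nverts g. good_vertex g v)"
proof -
  have "(\<forall>v < nverts g. \<exists>u < nverts g. verts g ! u = External \<and> (v, u) \<in> linked g) \<longleftrightarrow>
    (\<exists>u < nverts g. verts g ! u = External)" if "connected_graph g"
  proof -
    have "0 < nverts g" using that by (simp add: connected_graph_def)
    then show ?thesis using that by (auto simp: connected_graph_def)
  qed
  moreover have "good_vertex g v \<longleftrightarrow>
     (verts g ! v = White \<longrightarrow> valence g Dashed v \<ge> 3 \<and> valence g Solid v = 0) \<and>
     (verts g ! v = Internal \<longrightarrow> valence g Solid v \<ge> 3 \<and> valence g Dashed v = 0) \<and>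
     (verts g ! v = External \<longrightarrow> valence g Dashed v \<ge> 1)" for v
    by (auto simp: good_vertex_def split: vkind.split)
  ultimately show ?thesis
    unfolding plain_graphs_def plain_graph_def admissible_def by auto
qed

lemma good_halves:
  assumes "g \<in> plain_graphs" "fst x < nedges g"
  shows "verts g ! hvert g x = White \<Longrightarrow> kind (edges g ! fst x) = Dashed"
    "verts g ! hvert g x = Internal \<Longrightarrow> kind (edges g ! fst x) = Solid"
proof -
  have l: "hvert g x < nverts g" using assms hvert_less by (auto simp: plain_graphs_iff)
  have "x \<in> halves g (kind (edges g ! fst x)) (hvert g x)" using assms(2) by (simp add: halves_def)
  then have "valence g (kind (edges g ! fst x)) (hvert g x) \<noteq> 0"
    by (auto simp: valence_card)
  moreover have "good_vertex g (hvert g x)" using assms(1) l by (simp add: plain_graphs_iff)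
  ultimately show "verts g ! hvert g x = White \<Longrightarrow> kind (edges g ! fst x) = Dashed"
    "verts g ! hvert g x = Internal \<Longrightarrow> kind (edges g ! fst x) = Solid"
    by (cases "kind (edges g ! fst x)"; simp add: good_vertex_def)+
qed

lemma step_plain_graphs:
  assumes "step n j g s t f h" "g \<in> plain_graphs"
  shows "h \<in> plain_graphs"
proof -
  note b = step_bij[OF assms(1)] and tr = step_transport[OF assms(1)]
  have v: "verts h ! v = verts g ! t v" if "v < nverts g" for v
    using tr(1)[of "t v"] b that by simp
  have val: "valence h k v = valence g k (t v)" for k v
    using step_valence[OF assms(1), of k "t v"] b by simp
  have "good_vertex h v" if "v < nverts h" for v
  proof -
    have "good_vertex g (t v)" using that b assms(2) by (simp add: plain_graphs_iff)
    then show ?thesis using v that b(3) unfolding good_vertex_def val by simp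
  qed
  moreover have "\<exists>u < nverts h. verts h ! u = External"
    using assms(2) tr(1) b by (metis plain_graphs_iff)
  ultimately show ?thesis
    using assms step_labeled_graph step_connected_graph by (auto simp: plain_graphs_iff)
qed

definition isolated :: "lgraph \<Rightarrow> nat \<Rightarrow> bool" where
  "isolated g v \<longleftrightarrow> valence g Dashed v = 1 \<and> valence g Solid v = 0"

lemma valence_Solid_eq_0_iff:
  "valence g Solid v = 0 \<longleftrightarrow> (\<forall>x. fst x < nedges g \<longrightarrow> hvert g x = v \<longrightarrow> kind (edges g ! fst x) \<noteq> Solid)"
proof -
  have "valence g Solid v = 0 \<longleftrightarrow> halves g Solid v = {}" by (simp add: valence_card)
  then show ?thesis by (auto simp: halves_def)
qed

text \<open>If no external vertex carries a solid half-edge, every solid edge joins internal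
  vertices, because white ones carry none either. Everything linked to an internal vertex would then
  be internal, against the existence of an external vertex in a connected graph. So there are
  neither internal vertices nor solid edges.\<close>

lemma hairy_iff_isolated:
  assumes g: "g \<in> plain_graphs"
  shows "hairy g \<longleftrightarrow> (\<forall>v < nverts g. verts g ! v = External \<longrightarrow> isolated g v)"
proof
  assume h: "hairy g"
  then have "valence g Solid v = 0" for v
    unfolding valence_Solid_eq_0_iff by (auto simp: hairy_def)
  then show "\<forall>v < nverts g. verts g ! v = External \<longrightarrow> isolated g v"
    using h by (auto simp: hairy_def isolated_def)
next
  assume iso: "\<forall>v < nverts g. verts g ! v = External \<longrightarrow> isolated g v"
  have lg: "labeled_graph g" using g by (simp add: plain_graphs_iff)
  have solid_end: "verts g ! hvert g x = Internal"
    if "fst x < nedges g" "kind (edges g ! fst x) = Solid" for x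
  proof -
    have "valence g Solid (hvert g x) \<noteq> 0" using that unfolding valence_Solid_eq_0_iff by blast
    then have "verts g ! hvert g x \<noteq> External"
      using iso hvert_less[OF lg that(1)] by (auto simp: isolated_def)
    then show ?thesis using good_halves(1)[OF g that(1)] that(2) by (cases "verts g ! hvert g x") auto
  qed
  have no_internal: "verts g ! v \<noteq> Internal" if v: "v < nverts g" for v
  proof
    assume i: "verts g ! v = Internal"
    obtain u where u: "u < nverts g" "verts g ! u = External" using g by (auto simp: plain_graphs_iff)
    have "(v, u) \<in> linked g" using g v u by (simp add: plain_graphs_iff connected_graph_def)
    then have "verts g ! u = Internal"
      unfolding linked_adj
    proof (induction rule: rtrancl_induct)
      case (step y z)
      then obtain x where x: "fst x < nedges g" "hvert g x = y" "hvert g (apsnd Not x) = z"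
        by (auto simp: adj_def)
      have "kind (edges g ! fst x) = Solid" using good_halves(2)[OF g x(1)] x step.IH by simp
      then show ?case using solid_end[of "apsnd Not x"] x by simp
    qed (rule i)
    with u show False by simp
  qed
  have "kind e \<noteq> Solid" if "e \<in> set (edges g)" for e
  proof
    assume "kind e = Solid"
    then obtain k where k: "k < nedges g" "kind (edges g ! k) = Solid" using \<open>e \<in> set (edges g)\<close>
      by (auto simp: in_set_conv_nth)
    then show False
      using solid_end[of "(k, True)"] no_internal hvert_less[OF lg, of "(k, True)"] by simp
  qed
  then show "hairy g"
    using g iso no_internal by (auto simp: hairy_def plain_graphs_def isolated_def)
qed

lemma step_hairy:
  assumes "step n j g s t f h" "g \<in> plain_graphs"
  shows "hairy h \<longleftrightarrow> hairy g"
proof -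
  note b = step_bij[OF assms(1)] and tr = step_transport[OF assms(1)]
  have v: "verts h ! t v = verts g ! v" if "v < nverts g" for v
    using tr(1)[of v] that by simp
  have i: "isolated h (t v) \<longleftrightarrow> isolated g v" for v
    by (simp add: isolated_def step_valence[OF assms(1)])
  show ?thesis
    unfolding hairy_iff_isolated[OF assms(2)] hairy_iff_isolated[OF step_plain_graphs[OF assms]] b(3)
    using v i b by metis
qed

lemma hairy_graphs_eq: "hairy_graphs = {g \<in> plain_graphs. hairy g}"
  by (auto simp: hairy_graphs_def plain_graphs_def hairy_def)

section \<open>Contractions preserve the graph complexes\<close>

lemma hvert_contract:
  assumes "i < nedges g" "fst x < nedges g" "fst x \<noteq> i"
  shows "hvert (contract g i) (apfst (squeeze i) x) = merge (endp g i) (endq g i) (hvert g x)"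
  using assms by (cases x) (simp add: hvert_def edge_contract)

lemma kind_contract:
  assumes "i < nedges g" "k < nedges g" "k \<noteq> i"
  shows "kind (edges (contract g i) ! squeeze i k) = kind (edges g ! k)"
  using assms by (simp add: edge_contract)

lemma hvert_self: "hvert g (i, b) \<in> {endp g i, endq g i}" "{hvert g (i, b), hvert g (i, \<not> b)} = {endp g i, endq g i}"
  by (cases "src (edges g ! i) \<le> tgt (edges g ! i)";
      cases b; simp add: hvert_def endp_def endq_def min_def max_def doubleton_eq_iff)+

lemma halves_contract:
  assumes i: "contractible g i"
  shows "bij_betw (apfst (squeeze i)) {x. fst x < nedges g \<and> fst x \<noteq> i \<and>
      kind (edges g ! fst x) = k \<and> merge (endp g i) (endq g i) (hvert g x) = u} (halves (contract g i) k u)"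
proof (rule bij_betw_byWitness[where f' = "apfst (bump i)"])
  have iE: "i < nedges g" using i by (simp add: contractible_def)
  show "apfst (squeeze i) ` {x. fst x < nedges g \<and> fst x \<noteq> i \<and>
      kind (edges g ! fst x) = k \<and> merge (endp g i) (endq g i) (hvert g x) = u} \<subseteq> halves (contract g i) k u"
  proof (rule image_subsetI)
    fix x assume "x \<in> {x. fst x < nedges g \<and> fst x \<noteq> i \<and>
      kind (edges g ! fst x) = k \<and> merge (endp g i) (endq g i) (hvert g x) = u}"
    then show "apfst (squeeze i) x \<in> halves (contract g i) k u"
      using squeeze_less[OF iE, of "fst x"] hvert_contract[OF iE, of x]
      by (simp add: halves_def nedges_contract[OF i] kind_contract iE)
  qed
  show "apfst (bump i) ` halves (contract g i) k u \<subseteq> {x. fst x < nedges g \<and> fst x \<noteq> i \<and>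
      kind (edges g ! fst x) = k \<and> merge (endp g i) (endq g i) (hvert g x) = u}"
  proof (rule image_subsetI)
    fix x assume x: "x \<in> halves (contract g i) k u"
    have "apfst (squeeze i) (apfst (bump i) x) = x" by (cases x) simp
    then show "apfst (bump i) x \<in> {x. fst x < nedges g \<and> fst x \<noteq> i \<and>
      kind (edges g ! fst x) = k \<and> merge (endp g i) (endq g i) (hvert g x) = u}"
      using x hvert_contract[OF iE, of "apfst (bump i) x"] kind_contract[OF iE, of "bump i (fst x)"] iE
      by (simp add: halves_def nedges_contract[OF i])
  qed
qed (auto simp: apfst_def map_prod_def)

lemma valence_contract_other:
  assumes i: "contractible g i" and v: "v \<noteq> endp g i" "v \<noteq> endq g i"
  shows "valence (contract g i) k (merge (endp g i) (endq g i) v) = valence g k v"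
proof -
  have o: "endp g i < endq g i" using i by (simp add: contractible_def)
  have "fst x \<noteq> i" if "hvert g x = v" for x
    using that v hvert_self(1)[of g i "snd x"] by (cases x) auto
  then have "{x. fst x < nedges g \<and> fst x \<noteq> i \<and> kind (edges g ! fst x) = k \<and>
      merge (endp g i) (endq g i) (hvert g x) = merge (endp g i) (endq g i) v} = halves g k v"
    using v by (auto simp: halves_def merge_eq_iff[OF o])
  then show ?thesis
    using bij_betw_same_card[OF halves_contract[OF i, of k "merge (endp g i) (endq g i) v"]]
    by (simp add: valence_card)
qed

text \<open>The half-edges at the two endpoints are added up, and the two halves of \<open>i\<close>
  itself disappear.\<close>

lemma valence_contract_merged:
  assumes i: "contractible g i"
  shows "valence (contract g i) k (endp g i) + (if k = kind (edges g ! i) then 2 else 0) =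
    valence g k (endp g i) + valence g k (endq g i)"
proof -
  have o: "endp g i < endq g i" "i < nedges g" using i by (auto simp: contractible_def)
  let ?X = "{x. fst x < nedges g \<and> fst x \<noteq> i \<and> kind (edges g ! fst x) = k \<and>
      merge (endp g i) (endq g i) (hvert g x) = endp g i}"
  let ?Y = "if k = kind (edges g ! i) then {(i, True), (i, False)} else {}"
  have m: "merge (endp g i) (endq g i) v = endp g i \<longleftrightarrow> v = endp g i \<or> v = endq g i" for v
    using merge_eq_iff[OF o(1), of v "endq g i"] by (auto simp: merge_simps)
  have eq: "halves g k (endp g i) \<union> halves g k (endq g i) = ?X \<union> ?Y"
    unfolding set_eq_iff
  proof
    fix x :: "nat \<times> bool"
    obtain e b where x: "x = (e, b)" by fastforce
    show "x \<in> halves g k (endp g i) \<union> halves g k (endq g i) \<longleftrightarrow> x \<in> ?X \<union> ?Y"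
      unfolding m x using o hvert_self(1)[of g i b] by (cases "e = i"; cases b) (auto simp: halves_def)
  qed
  have f: "finite ?X" by (rule finite_subset[of _ "{..<nedges g} \<times> UNIV"]) auto
  have "halves g k (endp g i) \<inter> halves g k (endq g i) = {}" using o by (auto simp: halves_def)
  then have "card (halves g k (endp g i) \<union> halves g k (endq g i)) = valence g k (endp g i) + valence g k (endq g i)"
    using card_Un_disjoint[OF finite_halves finite_halves, of g k "endp g i" g k "endq g i"]
    by (simp add: valence_card)
  moreover have "card (?X \<union> ?Y) = card ?X + card ?Y"
    using f by (intro card_Un_disjoint) auto
  ultimately show ?thesis
    using bij_betw_same_card[OF halves_contract[OF i, of k "endp g i"]] eq
    by (auto simp: valence_card)
qed

lemma adj_sym:
  assumes "adj g u v"
  shows "adj g v u"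
proof -
  obtain x where x: "fst x < nedges g" "hvert g x = u" "hvert g (apsnd Not x) = v"
    using assms by (auto simp: adj_def)
  then show ?thesis unfolding adj_def by (intro exI[of _ "apsnd Not x"]) (cases x; simp)
qed

lemma obtain_hvert_endp:
  obtains b where "hvert g (i, b) = endp g i" "hvert g (i, \<not> b) = endq g i"
  using hvert_self(2)[of g i True] that[of True] that[of False] by (auto simp: doubleton_eq_iff)

lemma adj_endpoints: "i < nedges g \<Longrightarrow> adj g (endp g i) (endq g i)"
  unfolding adj_def by (rule obtain_hvert_endp[of g i]) (metis apsnd_conv fst_conv)

lemma adj_contract:
  assumes i: "i < nedges g" and a: "adj g u v"
  shows "(merge (endp g i) (endq g i) u, merge (endp g i) (endq g i) v) \<in> linked (contract g i)"
proof -
  obtain x where x: "fst x < nedges g" "hvert g x = u" "hvert g (apsnd Not x) = v"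
    using a by (auto simp: adj_def)
  show ?thesis
  proof (cases "fst x = i")
    case True
    then obtain b where "x = (i, b)" by (cases x) auto
    then have "{u, v} = {endp g i, endq g i}" using x hvert_self(2)[of g i b] by simp
    moreover have "merge (endp g i) (endq g i) (endp g i) = merge (endp g i) (endq g i) (endq g i)"
      using endp_le_endq[of g i] by (cases "endp g i = endq g i") (auto simp: merge_simps)
    ultimately show ?thesis by (auto simp: doubleton_eq_iff)
  next
    case False
    have "apfst (squeeze i) (apsnd Not x) = apsnd Not (apfst (squeeze i) x)" by (cases x) simp
    moreover have "squeeze i (fst x) < nedges (contract g i)"
      using squeeze_less[OF i x(1)] False i by (simp add: edges_contract)
    ultimately have "adj (contract g i) (merge (endp g i) (endq g i) u) (merge (endp g i) (endq g i) v)"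
      unfolding adj_def using hvert_contract[OF i, of x] hvert_contract[OF i, of "apsnd Not x"] x False
      by (intro exI[of _ "apfst (squeeze i) x"]) auto
    then show ?thesis by (rule adj_linked)
  qed
qed

text \<open>For the converse, edges of the contraction lift to edges between vertices of
  \<open>g\<close>, and each vertex is linked to the representative \<open>bump\<close> of its
  image, if necessary through \<open>i\<close> itself. The converse gives the connectedness of a
  pull-out, whose contraction is the given graph.\<close>

lemma connected_graph_contract:
  assumes i: "contractible g i"
  shows "connected_graph (contract g i) \<longleftrightarrow> connected_graph g"
proof -
  have o: "endp g i < endq g i" "endq g i < nverts g" "i < nedges g"
    using i by (auto simp: contractible_def)
  let ?m = "merge (endp g i) (endq g i)"
  have ne: "verts g \<noteq> []" "verts (contract g i) \<noteq> []"
    using o nverts_contract[OF i] by (auto simp flip: length_greater_0_conv)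
  have surj: "\<exists>v < nverts g. ?m v = u" if "u < nverts (contract g i)" for u
    using ex_merge_eq[OF o(1,2)] that by (simp add: nverts_contract[OF i])
  have "?m v < nverts (contract g i)" if "v < nverts g" for v
    using o that by (auto simp: merge_def squeeze_def nverts_contract[OF i])
  note less = this
  show ?thesis
  proof
    assume g: "connected_graph g"
    show "connected_graph (contract g i)"
      unfolding connected_graph_def
    proof (safe)
      fix u v assume uv: "u < nverts (contract g i)" "v < nverts (contract g i)"
      obtain u' v' where "u' < nverts g" "?m u' = u" "v' < nverts g" "?m v' = v"
        using surj[OF uv(1)] surj[OF uv(2)] by auto
      then show "(u, v) \<in> linked (contract g i)"
        using linked_map[of u' v' g ?m "contract g i"] adj_contract[OF o(3)] g
        by (auto simp: connected_graph_def)
    qed (use ne in simp)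
  next
    assume c: "connected_graph (contract g i)"
    have pq: "adj g (endp g i) (endq g i)" "adj g (endq g i) (endp g i)"
      using adj_endpoints[OF o(3)] adj_sym by blast+
    have b: "bump (endq g i) (?m v) = (if v = endq g i then endp g i else v)" for v
      by (rule bump_merge[OF o(1)])
    have rep: "(v, bump (endq g i) (?m v)) \<in> linked g" "(bump (endq g i) (?m v), v) \<in> linked g" for v
      unfolding b using pq by (auto intro: adj_linked)
    have "(bump (endq g i) u, bump (endq g i) v) \<in> linked g" if a: "adj (contract g i) u v" for u v
    proof -
      obtain y where y: "fst y < nedges (contract g i)" "hvert (contract g i) y = u"
        "hvert (contract g i) (apsnd Not y) = v"
        using a unfolding adj_def by blast
      define x where "x = apfst (bump i) y"
      have x: "fst x < nedges g" "fst x \<noteq> i" "y = apfst (squeeze i) x"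
        "apsnd Not y = apfst (squeeze i) (apsnd Not x)"
        using y(1) o by (cases y; auto simp: x_def nedges_contract[OF i])+
      have "u = ?m (hvert g x)" "v = ?m (hvert g (apsnd Not x))"
        using hvert_contract[OF o(3), of x] hvert_contract[OF o(3), of "apsnd Not x"] x y by auto
      moreover have "adj g (hvert g x) (hvert g (apsnd Not x))" using x(1) unfolding adj_def by blast
      ultimately show ?thesis using rep adj_linked linked_trans by metis
    qed
    note lift = this
    show "connected_graph g"
      unfolding connected_graph_def
    proof (safe)
      fix u v assume uv: "u < nverts g" "v < nverts g"
      have "(?m u, ?m v) \<in> linked (contract g i)"
        using c less[OF uv(1)] less[OF uv(2)] by (simp add: connected_graph_def)
      then have "(bump (endq g i) (?m u), bump (endq g i) (?m v)) \<in> linked g"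
        by (rule linked_map) (rule lift)
      then show "(u, v) \<in> linked g" using rep linked_trans by metis
    qed (use ne in simp)
  qed
qed

lemma contract_vertex_cases:
  assumes i: "contractible g i" and u: "u < nverts (contract g i)"
  obtains "u = endp g i" "verts (contract g i) ! u = join_kind (verts g ! endp g i) (verts g ! endq g i)"
  | v where "v < nverts g" "v \<noteq> endp g i" "v \<noteq> endq g i" "u = merge (endp g i) (endq g i) v"
     "verts (contract g i) ! u = verts g ! v" "\<And>k. valence (contract g i) k u = valence g k v"
proof -
  have o: "endp g i < endq g i" "endq g i < nverts g" using i by (auto simp: contractible_def)
  obtain v where v: "v < nverts g" "merge (endp g i) (endq g i) v = u"
    using ex_merge_eq[OF o] u nverts_contract[OF i] by auto
  show ?thesis
  proof (cases "v = endp g i \<or> v = endq g i")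
    case True
    then have "u = endp g i" using v o by (auto simp: merge_simps)
    then show ?thesis using that(1) vert_contract[OF i v(1)] True v by simp
  next
    case False
    then show ?thesis using that(2)[of v] vert_contract[OF i v(1)] v valence_contract_other[OF i]
      by auto
  qed
qed

lemma contractible_kinds:
  assumes g: "g \<in> plain_graphs" and i: "contractible g i"
  shows "kind (edges g ! i) = Solid \<Longrightarrow> verts g ! endp g i \<noteq> White \<and> verts g ! endq g i \<noteq> White"
    "kind (edges g ! i) = Dashed \<Longrightarrow> verts g ! endp g i \<noteq> Internal \<and> verts g ! endq g i = White"
proof -
  have iE: "i < nedges g" using i by (simp add: contractible_def)
  obtain b where b: "hvert g (i, b) = endp g i" "hvert g (i, \<not> b) = endq g i"
    by (rule obtain_hvert_endp)
  show "kind (edges g ! i) = Solid \<Longrightarrow> verts g ! endp g i \<noteq> White \<and> verts g ! endq g i \<noteq> White"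
    using good_halves(1)[OF g, of "(i, b)"] good_halves(1)[OF g, of "(i, \<not> b)"] b iE by auto
  show "kind (edges g ! i) = Dashed \<Longrightarrow> verts g ! endp g i \<noteq> Internal \<and> verts g ! endq g i = White"
    using good_halves(2)[OF g, of "(i, b)"] b iE i by (auto simp: contractible_def)
qed

text \<open>Two trivalent vertices of the same kind merge to valence at least 3 + 3 - 2. An external
  vertex that absorbs a white one has at least 1 + 3 - 2 dashed half-edges, and a solid contraction
  loses no dashed half-edge.\<close>

lemma plain_graphs_contract:
  assumes g: "g \<in> plain_graphs" and i: "contractible g i"
  shows "contract g i \<in> plain_graphs"
proof -
  have o: "endp g i < endq g i" "endq g i < nverts g" "i < nedges g" "endp g i < nverts g"
    using i by (auto simp: contractible_def)
  have lg: "labeled_graph g" using g by (simp add: plain_graphs_iff)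
  have pq: "good_vertex g (endp g i)" "good_vertex g (endq g i)" using g o by (auto simp: plain_graphs_iff)
  have "good_vertex (contract g i) u" if "u < nverts (contract g i)" for u
    using i that
  proof (cases rule: contract_vertex_cases)
    case 1
    show ?thesis
      using contractible_kinds[OF g i] pq valence_contract_merged[OF i, of Solid]
        valence_contract_merged[OF i, of Dashed]
      unfolding 1(1) good_vertex_def 1(2)[unfolded 1(1)]
      by (cases "kind (edges g ! i)"; cases "verts g ! endp g i"; cases "verts g ! endq g i")
        (simp_all add: join_kind_def)
  next
    case (2 v)
    have "good_vertex g v" using g 2(1) by (simp add: plain_graphs_iff)
    then show ?thesis unfolding good_vertex_def 2(5,6) .
  qed
  moreover obtain u where u: "u < nverts g" "verts g ! u = External" using g by (auto simp: plain_graphs_iff)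
  moreover have "merge (endp g i) (endq g i) u < nverts (contract g i)"
    using o u by (auto simp: merge_def squeeze_def nverts_contract[OF i])
  moreover have "verts (contract g i) ! merge (endp g i) (endq g i) u = External"
    using vert_contract[OF i u(1)] u by (auto simp: join_kind_def)
  ultimately show ?thesis
    using g labeled_graph_contract[OF lg i] connected_graph_contract[OF i] by (auto simp: plain_graphs_iff)
qed

text \<open>Absorbing a white or external vertex leaves an external vertex with at least two dashed
  half-edges; absorbing an internal one leaves a solid half-edge; and two internal vertices merge to
  an internal one. None of this occurs in a hairy graph. An edge between white vertices does not
  touch the external ones. In particular, the differential of a graph that is not hairy has no hairy
  terms.\<close>

lemma hairy_contract_iff:
  assumes g: "g \<in> plain_graphs" and i: "contractible g i"
  shows "hairy (contract g i) \<longleftrightarrow> hairy g \<and> verts g ! endp g i = White"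
proof -
  have o: "endp g i < endq g i" "endq g i < nverts g" "i < nedges g" "endp g i < nverts g"
    using i by (auto simp: contractible_def)
  have lg: "labeled_graph g" using g by (simp add: plain_graphs_iff)
  have pq: "good_vertex g (endp g i)" "good_vertex g (endq g i)" using g o by (auto simp: plain_graphs_iff)
  note ci = hairy_iff_isolated[OF plain_graphs_contract[OF g i]]
  note m = valence_contract_merged[OF i, of Solid] valence_contract_merged[OF i, of Dashed]
  show ?thesis
  proof
    assume h: "hairy (contract g i)"
    have p: "endp g i < nverts (contract g i)" using o by (simp add: nverts_contract[OF i])
    have vp: "verts (contract g i) ! endp g i = join_kind (verts g ! endp g i) (verts g ! endq g i)"
      using vert_contract[OF i o(4)] o by (simp add: merge_simps)
    have "join_kind (verts g ! endp g i) (verts g ! endq g i) = External \<Longrightarrow>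
       valence (contract g i) Dashed (endp g i) = 1 \<and> valence (contract g i) Solid (endp g i) = 0"
      using h p vp unfolding ci by (simp add: isolated_def)
    moreover have "verts (contract g i) ! endp g i \<noteq> Internal"
      using h p by (simp add: hairy_def)
    ultimately have pW: "verts g ! endp g i = White"
      using contractible_kinds[OF g i] pq m unfolding vp good_vertex_def
      by (cases "kind (edges g ! i)"; cases "verts g ! endp g i"; cases "verts g ! endq g i")
        (simp_all add: join_kind_def)
    then have qW: "verts g ! endq g i = White" using sorted_white[OF lg endp_le_endq o(2)] by simp
    have "isolated g v" if v: "v < nverts g" "verts g ! v = External" for v
    proof -
      have ne: "v \<noteq> endp g i" "v \<noteq> endq g i" using v pW qW by auto
      have "merge (endp g i) (endq g i) v < nverts (contract g i)"
        using o v by (auto simp: merge_def squeeze_def nverts_contract[OF i])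
      then show ?thesis
        using h vert_contract[OF i v(1)] ne v valence_contract_other[OF i ne]
        unfolding ci by (auto simp: isolated_def)
    qed
    then show "hairy g \<and> verts g ! endp g i = White" using pW hairy_iff_isolated[OF g] by simp
  next
    assume h: "hairy g \<and> verts g ! endp g i = White"
    then have qW: "verts g ! endq g i = White" using sorted_white[OF lg endp_le_endq o(2)] by simp
    show "hairy (contract g i)"
      unfolding ci
    proof safe
      fix u assume u: "u < nverts (contract g i)" "verts (contract g i) ! u = External"
      show "isolated (contract g i) u"
        using i u(1)
      proof (cases rule: contract_vertex_cases)
        case 1
        then show ?thesis using u h qW by (simp add: join_kind_def)
      next
        case (2 v)
        then show ?thesis using h u hairy_iff_isolated[OF g] by (simp add: isolated_def)
      qed
    qed
  qed
qed

lemma contractible_iff: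
  assumes g: "g \<in> plain_graphs" and i: "i < nedges g"
  shows "contractible g i \<longleftrightarrow> \<not> is_chord g (edges g ! i) \<and> \<not> is_loop g (edges g ! i)"
proof -
  have lg: "labeled_graph g" using g by (simp add: plain_graphs_iff)
  note q = endq_less[OF lg i]
  have w: "verts g ! endp g i = White \<Longrightarrow> verts g ! endq g i = White"
    using sorted_white[OF lg endp_le_endq q] .
  have s: "kind (edges g ! i) = Solid \<Longrightarrow> verts g ! endq g i \<noteq> White"
    using good_halves(1)[OF g, of "(i, True)"] good_halves(1)[OF g, of "(i, False)"] i
    by (auto simp: hvert_def endq_def max_def)
  have l: "is_loop g (edges g ! i) \<longleftrightarrow> \<not> endp g i < endq g i"
    by (auto simp: is_loop_def endp_def endq_def)
  have c: "is_chord g (edges g ! i) \<longleftrightarrow>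
    kind (edges g ! i) = Dashed \<and> verts g ! endp g i \<noteq> White \<and> verts g ! endq g i \<noteq> White"
    by (cases "src (edges g ! i) \<le> tgt (edges g ! i)")
      (auto simp: is_chord_def endp_def endq_def min_def max_def)
  show ?thesis
    unfolding contractible_def l c using i q w s by (cases "kind (edges g ! i)") auto
qed

lemma contractible_hairy_iff:
  assumes g: "g \<in> plain_graphs" "hairy g" and i: "i < nedges g"
  shows "contractible g i \<and> verts g ! endp g i = White \<longleftrightarrow>
    \<not> is_loop g (edges g ! i) \<and> \<not> is_hair g (edges g ! i)"
proof -
  have lg: "labeled_graph g" using g by (simp add: plain_graphs_iff)
  note q = endq_less[OF lg i]
  have d: "kind (edges g ! i) = Dashed" using g i by (cases "kind (edges g ! i)") (auto simp: hairy_def)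
  have ni: "verts g ! endp g i \<noteq> Internal" "verts g ! endq g i \<noteq> Internal"
    using g q endp_less[OF lg i] by (auto simp: hairy_def)
  have w: "verts g ! endp g i = White \<Longrightarrow> verts g ! endq g i = White"
    using sorted_white[OF lg endp_le_endq q] .
  have l: "is_loop g (edges g ! i) \<longleftrightarrow> \<not> endp g i < endq g i"
    by (auto simp: is_loop_def endp_def endq_def)
  have c: "is_hair g (edges g ! i) \<longleftrightarrow> verts g ! endp g i = External \<or> verts g ! endq g i = External"
    using d by (cases "src (edges g ! i) \<le> tgt (edges g ! i)")
      (auto simp: is_hair_def endp_def endq_def min_def max_def)
  show ?thesis
    unfolding contractible_def l c using i q w ni d
    by (cases "verts g ! endp g i"; cases "verts g ! endq g i") auto
qed

section \<open>Pulling out a dashed half-edge\<close>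

text \<open>Black vertices fill the positions below this number, so a new last black vertex is
  inserted exactly here.\<close>

definition nblack :: "lgraph \<Rightarrow> nat" where
  "nblack g = length (filter Not (map (\<lambda>v. v = White) (verts g)))"

definition insert_nth :: "nat \<Rightarrow> 'a \<Rightarrow> 'a list \<Rightarrow> 'a list" where
  "insert_nth m a xs = take m xs @ a # drop m xs"

lemma length_insert_nth [simp]: "length (insert_nth m a xs) = Suc (length xs)"
  by (simp add: insert_nth_def)

lemma nth_insert_nth_bump:
  "m \<le> length xs \<Longrightarrow> u < length xs \<Longrightarrow> insert_nth m a xs ! bump m u = xs ! u"
  by (auto simp: insert_nth_def bump_def nth_append min_def Suc_diff_le)

lemma nth_insert_nth_self: "m \<le> length xs \<Longrightarrow> insert_nth m a xs ! m = a"
  by (simp add: insert_nth_def nth_append)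

lemma obtain_bump:
  assumes "u < Suc N" "m \<le> N" "u \<noteq> m"
  obtains v where "v < N" "u = bump m v"
proof -
  have "squeeze m u < N" using assms by (cases "m < u") (auto simp: squeeze_def)
  then show ?thesis using that[of "squeeze m u"] assms(3) by simp
qed

lemma insert_nth_eqI:
  assumes "length ys = Suc (length xs)" "m \<le> length xs" "ys ! m = a"
    "\<And>u. u < length xs \<Longrightarrow> ys ! bump m u = xs ! u"
  shows "ys = insert_nth m a xs"
proof (rule nth_equalityI)
  fix u assume u: "u < length ys"
  show "ys ! u = insert_nth m a xs ! u"
  proof (cases "u = m")
    case True
    then show ?thesis using assms by (simp add: nth_insert_nth_self)
  next
    case False
    then obtain v where v: "v < length xs" "u = bump m v"
      using obtain_bump[of u "length xs" m] u assms by metis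
    then show ?thesis using assms nth_insert_nth_bump[of m xs v a] by simp
  qed
qed (use assms in simp)

lemma sorted_bool_nth:
  "sorted bs \<Longrightarrow> v < length bs \<Longrightarrow> bs ! v \<longleftrightarrow> length (filter Not bs) \<le> v"
proof (induction bs arbitrary: v)
  case (Cons b bs)
  show ?case
  proof (cases b)
    case True
    then have "\<forall>c \<in> set bs. c" using Cons.prems by auto
    then have "filter Not bs = []" "\<And>k. k < length bs \<Longrightarrow> bs ! k" by auto
    then show ?thesis using True Cons.prems by (cases v) auto
  next
    case False
    then show ?thesis using Cons by (cases v) auto
  qed
qed simp

lemma white_iff:
  assumes "labeled_graph g" "v < nverts g"
  shows "verts g ! v = White \<longleftrightarrow> nblack g \<le> v"
  using sorted_bool_nth[of "map (\<lambda>v. v = White) (verts g)" v] assms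
  by (simp add: labeled_graph_def nblack_def)

lemma nblack_le: "nblack g \<le> nverts g"
  unfolding nblack_def by (metis length_filter_le length_map)

lemma length_filter_remove_nth:
  assumes "q < length xs"
  shows "length (filter P xs) = length (filter P (remove_nth q xs)) + (if P (xs ! q) then 1 else 0)"
proof -
  have "filter P xs = filter P (take q xs @ xs ! q # drop (Suc q) xs)"
    using id_take_nth_drop[OF assms] by simp
  then show ?thesis by (simp add: remove_nth_def)
qed

lemma nblack_contract:
  assumes "labeled_graph g" "contractible g i"
  shows "nblack g = nblack (contract g i) + (if kind (edges g ! i) = Dashed then 0 else 1)"
  using assms length_filter_remove_nth[of "endq g i" "map (\<lambda>v. v = White) (verts g)" Not]
  by (simp add: nblack_def map_white_contract contractible_def split: if_splits)

lemma step_nblack: "step n j g s t f h \<Longrightarrow> nblack h = nblack g"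
  unfolding nblack_def using step_transport(4) by metis

section \<open>The pull-out and the contraction that undoes it\<close>

fun set_end :: "bool \<Rightarrow> nat \<Rightarrow> edge \<Rightarrow> edge" where
  "set_end b m (Edge t u v) = (if b then Edge t m v else Edge t u m)"

lemma kind_set_end [simp]: "kind (set_end b m e) = kind e"
  and src_set_end [simp]: "src (set_end b m e) = (if b then m else src e)"
  and tgt_set_end [simp]: "tgt (set_end b m e) = (if b then tgt e else m)"
  by (cases e; simp)+

lemma rename_set_end: "rename_edge r (set_end b m e) = set_end b (r m) (rename_edge r e)"
  and reverse_set_end: "reverse_edge (set_end b m e) = set_end (\<not> b) m (reverse_edge e)"
  by (cases e; simp)+

definition core_kind :: "lgraph \<Rightarrow> nat \<Rightarrow> vkind" where
  "core_kind g v = (if valence g Dashed v \<ge> 2 then External else Internal)"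

text \<open>The half-edge \<open>x\<close> is moved to a new external vertex, the last black one, which is joined by a
  solid edge to the former vertex of \<open>x\<close>. The latter becomes internal if \<open>x\<close> was its only
  dashed half-edge.\<close>

definition blow :: "lgraph \<Rightarrow> nat \<times> bool \<Rightarrow> lgraph" where
  "blow g x = LGraph
     (insert_nth (nblack g) External ((verts g)[hvert g x := core_kind g (hvert g x)]))
     (Edge Solid (hvert g x) (nblack g) #
      (map (rename_edge (bump (nblack g))) (edges g))
        [fst x := set_end (snd x) (nblack g) (rename_edge (bump (nblack g)) (edges g ! fst x))])"

definition hair_ends :: "lgraph \<Rightarrow> (nat \<times> bool) set" where
  "hair_ends g = {x. fst x < nedges g \<and> kind (edges g ! fst x) = Dashed \<and> verts g ! hvert g x = External}"

text \<open>The core loses a dashed half-edge and gains a solid one. It is admissible as an external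
  vertex if a dashed half-edge remains, and as an internal one if it then has three solid
  half-edges. These are the pull-outs that stay in the complex.\<close>

definition blowable :: "lgraph \<Rightarrow> (nat \<times> bool) set" where
  "blowable g = {x \<in> hair_ends g. valence g Dashed (hvert g x) \<ge> 2 \<or> valence g Solid (hvert g x) \<ge> 2}"

lemma nverts_blow [simp]: "nverts (blow g x) = Suc (nverts g)"
  and nedges_blow [simp]: "nedges (blow g x) = Suc (nedges g)"
  by (simp_all add: blow_def)

lemma edge_blow_0 [simp]: "edges (blow g x) ! 0 = Edge Solid (hvert g x) (nblack g)"
  by (simp add: blow_def)

lemma edge_blow_Suc:
  "k < nedges g \<Longrightarrow> edges (blow g x) ! Suc k =
    (if k = fst x then set_end (snd x) (nblack g) (rename_edge (bump (nblack g)) (edges g ! k))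
     else rename_edge (bump (nblack g)) (edges g ! k))"
  by (simp add: blow_def nth_list_update)

lemma vert_blow_new [simp]: "verts (blow g x) ! nblack g = External"
  using nblack_le[of g] by (simp add: blow_def nth_insert_nth_self)

lemma vert_blow_bump:
  "u < nverts g \<Longrightarrow> verts (blow g x) ! bump (nblack g) u =
    (if u = hvert g x then core_kind g u else verts g ! u)"
  using nblack_le[of g] by (simp add: blow_def nth_insert_nth_bump nth_list_update)

lemma kind_blow_Suc [simp]: "k < nedges g \<Longrightarrow> kind (edges (blow g x) ! Suc k) = kind (edges g ! k)"
  by (simp add: edge_blow_Suc)

lemma hvert_blow_Suc:
  "k < nedges g \<Longrightarrow> hvert (blow g x) (Suc k, b) =
    (if (k, b) = x then nblack g else bump (nblack g) (hvert g (k, b)))"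
  by (cases x) (auto simp: hvert_def edge_blow_Suc)

lemma hvert_blow_0: "hvert (blow g x) (0, b) = (if b then hvert g x else nblack g)"
  by (simp add: hvert_def)

lemma hair_end_less:
  assumes "labeled_graph g" "x \<in> hair_ends g"
  shows "hvert g x < nblack g" "hvert g x < nverts g"
  using assms white_iff[OF assms(1), of "hvert g x"] hvert_less[OF assms(1), of x]
  by (auto simp: hair_ends_def)

lemma bump_lt [simp]: "v < m \<Longrightarrow> bump m v = v"
  by (simp add: bump_def)

lemma white_blow:
  assumes g: "labeled_graph g" and x: "x \<in> hair_ends g" and v: "v < nverts (blow g x)"
  shows "verts (blow g x) ! v = White \<longleftrightarrow> nblack g < v"
proof (cases "v = nblack g")
  case False
  then obtain w where w: "w < nverts g" "v = bump (nblack g) w"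
    using obtain_bump[OF _ nblack_le[of g] False] v by auto
  have "verts g ! w = White \<longleftrightarrow> nblack g < v"
    using white_iff[OF g w(1)] unfolding w(2) by (auto simp: bump_def)
  then show ?thesis
    using vert_blow_bump[OF w(1), of x] x unfolding w(2)
    by (auto simp: core_kind_def hair_ends_def)
qed simp

lemma labeled_graph_blow:
  assumes g: "labeled_graph g" and x: "x \<in> hair_ends g"
  shows "labeled_graph (blow g x)"
proof -
  have "sorted (map (\<lambda>v. v = White) (verts (blow g x)))"
    unfolding sorted_iff_nth_mono
    using white_blow[OF g x] by auto
  moreover have "sorted (map (\<lambda>e. kind e = Dashed) (edges (blow g x)))"
  proof -
    have "map kind (edges (blow g x)) = Solid # map kind (edges g)"
      by (rule nth_equalityI) (auto simp: nth_Cons' gr0_conv_Suc)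
    moreover have d: "map (\<lambda>e. kind e = Dashed) es = map (\<lambda>t. t = Dashed) (map kind es)" for es
      by simp
    ultimately have "map (\<lambda>e. kind e = Dashed) (edges (blow g x)) =
        False # map (\<lambda>e. kind e = Dashed) (edges g)"
      unfolding d by simp
    then show ?thesis using g by (simp add: labeled_graph_def)
  qed
  moreover have "hvert (blow g x) y < Suc (nverts g)" if y: "fst y < Suc (nedges g)" for y
  proof -
    obtain k b where Pair: "y = (k, b)" by fastforce
    have "bump (nblack g) u < Suc (nverts g)" if "u < nverts g" for u
      using that by (simp add: bump_def)
    then show ?thesis
      using y Pair nblack_le[of g] hair_end_less[OF g x] hvert_less[OF g, of "(k - 1, b)"]
      by (cases k) (auto simp: hvert_blow_0 hvert_blow_Suc)
  qed
  from this[of "(_, True)"] this[of "(_, False)"]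
  have "\<forall>e \<in> set (edges (blow g x)). src e < Suc (nverts g) \<and> tgt e < Suc (nverts g)"
    by (simp add: hvert_def all_set_conv_all_nth)
  ultimately show ?thesis by (simp add: labeled_graph_def)
qed

lemma endp_endq_blow_0:
  assumes g: "labeled_graph g" and x: "x \<in> hair_ends g"
  shows "endp (blow g x) 0 = hvert g x" "endq (blow g x) 0 = nblack g"
  using hair_end_less[OF g x] by (simp_all add: endp_def endq_def)

lemma contractible_blow_0:
  assumes g: "labeled_graph g" and x: "x \<in> hair_ends g"
  shows "contractible (blow g x) 0"
  using hair_end_less[OF g x] nblack_le[of g] by (simp add: contractible_def endp_endq_blow_0[OF g x])

lemma merge_bump: "merge p q (bump q v) = v"
  by (simp add: merge_def)

text \<open>The deleted vertex is the new one, the larger endpoint of the new edge, so the old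
  numbering returns. The core, even if it became internal, merges with an external vertex and is
  external again.\<close>

lemma contract_blow_0:
  assumes g: "labeled_graph g" and x: "x \<in> hair_ends g"
  shows "contract (blow g x) 0 = g"
proof -
  note l = hair_end_less[OF g x] and c = contractible_blow_0[OF g x] and e = endp_endq_blow_0[OF g x]
  have "verts (contract (blow g x) 0) = verts g"
  proof (rule nth_equalityI)
    fix u assume "u < nverts (contract (blow g x) 0)"
    then have u: "u < nverts g" by (simp add: nverts_contract[OF c])
    have "bump (nblack g) u < nverts (blow g x)" using u nblack_le[of g] by (auto simp: bump_def)
    note v = vert_contract[OF c this]
    have b: "bump (nblack g) u = hvert g x \<longleftrightarrow> u = hvert g x"
      using l by (metis bump_lt bump_eq_iff)
    show "verts (contract (blow g x) 0) ! u = verts g ! u"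
      using v x u by (simp add: e merge_bump vert_blow_bump b join_kind_def hair_ends_def)
  qed (simp add: nverts_contract[OF c])
  moreover have "edges (contract (blow g x) 0) = edges g"
  proof (rule nth_equalityI)
    fix k assume "k < nedges (contract (blow g x) 0)"
    then have k: "k < nedges g" by (simp add: nedges_contract[OF c])
    have "edges (contract (blow g x) 0) ! k = rename_edge (merge (hvert g x) (nblack g)) (edges (blow g x) ! Suc k)"
      using edge_contract[of 0 "blow g x" "Suc k"] k by (simp add: e squeeze_def)
    also have "\<dots> = edges g ! k"
      using k by (cases "edges g ! k"; cases x)
        (auto simp: edge_blow_Suc rename_set_end rename_edge_comp comp_def merge_bump merge_simps hvert_def)
    finally show "edges (contract (blow g x) 0) ! k = edges g ! k" .
  qed (simp add: nedges_contract[OF c])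
  ultimately show ?thesis using lgraph.expand by blast
qed

lemma valence_blow_new:
  assumes g: "labeled_graph g" and x: "x \<in> hair_ends g"
  shows "valence (blow g x) k (nblack g) = 1"
proof -
  have "halves (blow g x) k (nblack g) = (case k of Solid \<Rightarrow> {(0, False)} | Dashed \<Rightarrow> {apfst Suc x})"
    unfolding set_eq_iff
  proof
    fix y :: "nat \<times> bool"
    obtain l b where y: "y = (l, b)" by fastforce
    obtain k' b' where x': "x = (k', b')" by fastforce
    show "y \<in> halves (blow g x) k (nblack g) \<longleftrightarrow>
        y \<in> (case k of Solid \<Rightarrow> {(0, False)} | Dashed \<Rightarrow> {apfst Suc x})"
      using hair_end_less[OF g x] x unfolding y
      by (cases l; cases k) (auto simp: halves_def hvert_blow_0 hvert_blow_Suc hair_ends_def x' split: if_splits)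
  qed
  then show ?thesis by (cases k) (simp_all add: valence_card)
qed

text \<open>Read off from the contraction of the new edge, which gives back \<open>g\<close>: the
  new vertex has one half-edge of each kind.\<close>

lemma valence_blow:
  assumes g: "labeled_graph g" and x: "x \<in> hair_ends g"
  shows "u \<noteq> hvert g x \<Longrightarrow> valence (blow g x) k (bump (nblack g) u) = valence g k u"
    "valence (blow g x) Dashed (hvert g x) + 1 = valence g Dashed (hvert g x)"
    "valence (blow g x) Solid (hvert g x) = valence g Solid (hvert g x) + 1"
proof -
  note c = contractible_blow_0[OF g x] and e = endp_endq_blow_0[OF g x]
  note l = hair_end_less[OF g x]
  show "valence (blow g x) k (bump (nblack g) u) = valence g k u" if "u \<noteq> hvert g x"
  proof -
    have "bump (nblack g) u \<noteq> hvert g x" using that l by (auto simp: bump_def split: if_splits)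
    then show ?thesis
      using valence_contract_other[OF c, of "bump (nblack g) u" k]
      by (simp add: e merge_bump contract_blow_0[OF g x])
  qed
  show "valence (blow g x) Dashed (hvert g x) + 1 = valence g Dashed (hvert g x)"
    "valence (blow g x) Solid (hvert g x) = valence g Solid (hvert g x) + 1"
    using valence_contract_merged[OF c, of Dashed] valence_contract_merged[OF c, of Solid]
      valence_blow_new[OF g x]
    by (simp_all add: e contract_blow_0[OF g x])
qed

text \<open>Only the core and the new vertex need checking. Connectedness is reflected by the
  contraction of the new edge, and that edge, being solid, rules out a hairy graph.\<close>

lemma blow_plain_graphs:
  assumes g: "g \<in> plain_graphs" and x: "x \<in> blowable g"
  shows "blow g x \<in> plain_graphs" "\<not> hairy (blow g x)"
proof -
  have lg: "labeled_graph g" using g by (simp add: plain_graphs_iff)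
  have hx: "x \<in> hair_ends g" using x by (simp add: blowable_def)
  note l = hair_end_less[OF lg hx]
  note val = valence_blow[OF lg hx]
  have good: "good_vertex g u" if "u < nverts g" for u using g that by (simp add: plain_graphs_iff)
  have "good_vertex (blow g x) u" if u: "u < nverts (blow g x)" for u
  proof (cases "u = nblack g")
    case True
    then show ?thesis using valence_blow_new[OF lg hx] by (simp add: good_vertex_def)
  next
    case False
    then obtain v where v: "v < nverts g" "u = bump (nblack g) v"
      using obtain_bump[OF _ nblack_le[of g] False] u by auto
    show ?thesis
    proof (cases "v = hvert g x")
      case True
      have "verts (blow g x) ! hvert g x = core_kind g (hvert g x)"
        using vert_blow_bump[OF l(2), of x] l by simp
      moreover have "u = hvert g x" using v True l by simp
      moreover have "valence g Dashed (hvert g x) \<ge> 2 \<or> valence g Solid (hvert g x) \<ge> 2"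
        using x by (simp add: blowable_def)
      ultimately show ?thesis using val(2,3) by (auto simp: good_vertex_def core_kind_def)
    next
      case False
      show ?thesis
        using good[OF v(1)] unfolding good_vertex_def v(2) val(1)[OF False] vert_blow_bump[OF v(1)]
        using False by simp
    qed
  qed
  moreover have "connected_graph (blow g x)"
    using connected_graph_contract[OF contractible_blow_0[OF lg hx]] g
    by (simp add: contract_blow_0[OF lg hx] plain_graphs_iff)
  moreover have "\<exists>u < nverts (blow g x). verts (blow g x) ! u = External"
    using nblack_le[of g] by (intro exI[of _ "nblack g"]) simp
  ultimately show "blow g x \<in> plain_graphs"
    using labeled_graph_blow[OF lg hx] by (simp add: plain_graphs_iff)
  have "Edge Solid (hvert g x) (nblack g) \<in> set (edges (blow g x))" by (simp add: blow_def)
  then show "\<not> hairy (blow g x)" by (force simp: hairy_def)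
qed

text \<open>The exponent of the sign of contracting the new edge, written in terms of
  \<open>g\<close>. The product \<open>j * n\<close> comes from moving the new black vertex past the
  white ones, and \<open>j - 1\<close> from moving the new edge past the old ones. The edge points
  to the new vertex, so \<open>eta\<close> is 1. The value depends neither on \<open>x\<close> nor
  on the labeling within its class, so it can serve as the sign of the homotopy.\<close>

definition blow_exp :: "int \<Rightarrow> int \<Rightarrow> lgraph \<Rightarrow> int" where
  "blow_exp n j g = degree n j g + sum_list (vert_degs n j g) +
     j * n * (int (nverts g) - int (nblack g)) + (j - 1) * sum_list (edge_degs n j g)"

lemma degree_blow:
  assumes g: "labeled_graph g" and x: "x \<in> hair_ends g"
  shows "degree n j (blow g x) = degree n j g - 1"
  using degree_contract[OF labeled_graph_blow[OF g x] contractible_blow_0[OF g x], of n j]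
  by (simp add: contract_blow_0[OF g x])

lemma contr_sign_blow_0:
  assumes g: "labeled_graph g" and x: "x \<in> hair_ends g"
  shows "contr_sign n j (blow g x) 0 = sgn_pow (blow_exp n j g)"
proof -
  note l = hair_end_less[OF g x] and e = endp_endq_blow_0[OF g x]
  have vm: "vert_degs n j (blow g x) ! nblack g = - j"
    using nblack_le[of g] by (simp add: vert_degs_nth)
  have ts: "tail_sum (vert_degs n j (blow g x)) (nblack g) = - n * (int (nverts g) - int (nblack g))"
  proof -
    have w: "verts (blow g x) ! v = White" if "v < Suc (nverts g)" "nblack g < v" for v
      using white_blow[OF g x] that by simp
    have "drop (Suc (nblack g)) (vert_degs n j (blow g x)) = replicate (nverts g - nblack g) (- n)"
      using w nblack_le[of g] by (intro nth_equalityI) (simp_all add: vert_degs_nth)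
    then show ?thesis using nblack_le[of g] by (simp add: tail_sum_def sum_list_replicate algebra_simps)
  qed
  have ed: "edge_degs n j (blow g x) = (j - 1) # edge_degs n j g"
    by (rule nth_equalityI) (auto simp: nth_Cons' edge_degs_nth gr0_conv_Suc)
  have "contr_exp n j (blow g x) 0 = blow_exp n j g"
    unfolding contr_exp_def e contract_blow_0[OF g x] degree_blow[OF g x] vm ts ed
    by (simp add: blow_exp_def tail_sum_def)
  then show ?thesis by (simp add: contr_sign_exp)
qed

section \<open>Pulling out in a relabeled graph\<close>

lemma step_sums:
  assumes "step n j g s t f h"
  shows "sum_list (vert_degs n j h) = sum_list (vert_degs n j g)"
    "edge_degs n j h = edge_degs n j g" "degree n j h = degree n j g"
proof -
  have v: "map (vert_deg n j) (verts g) = map (\<lambda>b. if b then - n else - j) (map (\<lambda>v. v = White) (verts g))" for g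
  proof -
    have "vert_deg n j a = (if a = White then - n else - j)" for a by (cases a) auto
    then show ?thesis by simp
  qed
  have "vert_degs n j h = vert_degs n j g"
    unfolding vert_degs_def v step_transport(4)[OF assms] ..
  moreover show "edge_degs n j h = edge_degs n j g"
    unfolding edge_degs_alt step_transport(5)[OF assms] ..
  ultimately show "sum_list (vert_degs n j h) = sum_list (vert_degs n j g)" "degree n j h = degree n j g"
    by (simp_all add: degree_def)
qed

lemma step_blow_exp: "step n j g s t f h \<Longrightarrow> blow_exp n j h = blow_exp n j g"
  by (simp add: blow_exp_def step_sums step_nblack step_bij(3))

lemma step_valence_hvert:
  assumes "step n j g s t f h" "fst x < nedges g"
  shows "hvert h (f x) = t (hvert g x)" "valence h k (hvert h (f x)) = valence g k (hvert g x)"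
  using step_transport(3)[OF assms] step_valence[OF assms(1)] by simp_all

lemma step_hair_ends:
  assumes "step n j g s t f h" "labeled_graph g" "x \<in> hair_ends g"
  shows "f x \<in> hair_ends h"
  using assms step_bij(4,6)[OF assms(1)] step_transport(1,2,3)[OF assms(1)] hair_end_less[OF assms(2,3)]
  by (auto simp: hair_ends_def)

lemma flip_bump_same:
  assumes "Suc e < m \<or> m \<le> e"
  shows "flip (bump m e) (bump m u) = bump m (flip e u)" "flip (bump m e) m = m"
proof -
  have "m \<noteq> Suc (bump m e)" using assms by (auto simp: bump_def)
  then show "flip (bump m e) (bump m u) = bump m (flip e u)" "flip (bump m e) m = m"
    using flip_bump[of m "bump m e" u] by (simp_all add: flip_def)
qed

text \<open>The sign is that of the given relabeling, because the new vertex and the new edge have fixed places in the orderings.\<close>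

lemma step_blow:
  assumes st: "step n j g s t f h" and g: "labeled_graph g" and x: "x \<in> hair_ends g"
  shows "\<exists>t' f'. step n j (blow g x) s t' f' (blow h (f x))"
  using st g x
proof (induction rule: step.induct)
  case (refl g)
  then show ?case by (auto intro: step.refl)
next
  case (swap_edges e g)
  let ?h = "LGraph (verts g) (swap_adjacent e (edges g))"
  have st: "step n j g (sgn_pow (edge_degs n j g ! e * edge_degs n j g ! Suc e)) id (apfst (flip e)) ?h"
    using swap_edges by (intro step.swap_edges)
  have xl: "fst x < nedges g" using swap_edges by (simp add: hair_ends_def)
  have nb: "nblack ?h = nblack g" by (simp add: nblack_def)
  have hv: "hvert ?h (apfst (flip e) x) = hvert g x" using step_valence_hvert(1)[OF st xl] by simp
  have ck: "core_kind ?h v = core_kind g v" for v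
    using step_valence[OF st, of _ v] by (simp add: core_kind_def)
  have "edges (blow ?h (apfst (flip e) x)) = swap_adjacent (Suc e) (edges (blow g x))"
  proof (rule nth_equalityI)
    fix k assume "k < nedges (blow ?h (apfst (flip e) x))"
    then have k: "k < Suc (nedges g)" by simp
    show "edges (blow ?h (apfst (flip e) x)) ! k = swap_adjacent (Suc e) (edges (blow g x)) ! k"
    proof (cases k)
      case 0
      then show ?thesis using swap_edges by (simp add: nth_swap_adjacent hv nb) (simp add: flip_def hv)
    next
      case (Suc l)
      have f: "flip (Suc e) (Suc l) = Suc (flip e l)" by (auto simp: flip_def)
      have "l = flip e (fst x) \<longleftrightarrow> flip e l = fst x" by (metis flip_flip)
      then show ?thesis using Suc k swap_edges by (simp add: nth_swap_adjacent f edge_blow_Suc nb)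
    qed
  qed simp
  moreover have "verts (blow ?h (apfst (flip e) x)) = verts (blow g x)"
    by (simp add: blow_def nb hv ck)
  ultimately have b: "blow ?h (apfst (flip e) x) = LGraph (verts (blow g x)) (swap_adjacent (Suc e) (edges (blow g x)))"
    by (metis lgraph.collapse)
  have "sgn_pow (edge_degs n j g ! e * edge_degs n j g ! Suc e) =
    sgn_pow (edge_degs n j (blow g x) ! Suc e * edge_degs n j (blow g x) ! Suc (Suc e))"
    using swap_edges by (simp add: edge_degs_nth)
  then show ?case
    unfolding b using swap_edges step.swap_edges[of "Suc e" "blow g x" n j] by (metis Suc_lessD Suc_mono kind_blow_Suc nedges_blow)
next
  case (swap_verts e g)
  let ?h = "LGraph (swap_adjacent e (verts g)) (map (rename_edge (flip e)) (edges g))"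
  let ?m = "nblack g"
  let ?e = "bump ?m e"
  have st: "step n j g (sgn_pow (vert_degs n j g ! e * vert_degs n j g ! Suc e)) (flip e) id ?h"
    using swap_verts by (intro step.swap_verts)
  have xl: "fst x < nedges g" using swap_verts by (simp add: hair_ends_def)
  have lh: "labeled_graph ?h" using step_labeled_graph[OF st] swap_verts by simp
  have xh: "x \<in> hair_ends ?h" using step_hair_ends[OF st] swap_verts by simp
  have nb: "nblack ?h = ?m" using step_nblack[OF st] .
  have hv: "hvert ?h x = flip e (hvert g x)" using step_valence_hvert(1)[OF st xl] by simp
  have ck: "core_kind ?h (flip e v) = core_kind g v" for v
    using step_valence[OF st, of _ v] by (simp add: core_kind_def)
  note l = hair_end_less[OF swap_verts(3,4)] and lh' = hair_end_less[OF lh xh]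
  have ml: "?m \<le> nverts g" by (rule nblack_le)
  \<comment> \<open>The swapped vertices have the same colour, so the place of the new vertex, at
    the border between black and white, is not between them and they stay neighbours.\<close>
  have c: "Suc e < ?m \<or> ?m \<le> e"
    using white_iff[OF swap_verts(3), of e] white_iff[OF swap_verts(3), of "Suc e"] swap_verts by auto
  note fb = flip_bump_same[OF c]
  have e': "Suc ?e = bump ?m (Suc e)" using c by (auto simp: bump_def)
  have el: "Suc ?e < Suc (nverts g)" unfolding e' using swap_verts by (auto simp: bump_def)
  have "verts (blow ?h x) = swap_adjacent ?e (verts (blow g x))"
  proof (rule nth_equalityI)
    fix u assume u: "u < nverts (blow ?h x)"
    show "verts (blow ?h x) ! u = swap_adjacent ?e (verts (blow g x)) ! u"
    proof (cases "u = ?m")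
      case True
      then show ?thesis using el nb vert_blow_new[of ?h x] by (simp add: nth_swap_adjacent fb)
    next
      case False
      then obtain w where w: "w < nverts g" "u = bump ?m w"
        using obtain_bump[OF _ ml False] u by auto
      have "flip e w < nverts g" using w swap_verts by simp
      then show ?thesis
        using w el vert_blow_bump[of w ?h x] swap_verts ck[of "hvert g x"] vert_blow_bump[of "flip e w" g x]
        by (simp add: nth_swap_adjacent fb nb hv) (metis flip_flip)
    qed
  qed simp
  moreover have "edges (blow ?h x) = map (rename_edge (flip ?e)) (edges (blow g x))"
  proof (rule nth_equalityI)
    fix k assume "k < nedges (blow ?h x)"
    then have k: "k < Suc (nedges g)" by simp
    show "edges (blow ?h x) ! k = map (rename_edge (flip ?e)) (edges (blow g x)) ! k"
    proof (cases k)
      case 0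
      have "flip ?e (hvert g x) = flip e (hvert g x)"
        using fb(1)[of "hvert g x"] l lh' nb hv by simp
      then show ?thesis using 0 by (simp add: hv nb fb)
    next
      case (Suc l)
      then show ?thesis using k
        by (simp add: edge_blow_Suc nb rename_set_end rename_edge_comp comp_def fb)
    qed
  qed simp
  ultimately have b: "blow ?h (id x) = LGraph (swap_adjacent ?e (verts (blow g x)))
      (map (rename_edge (flip ?e)) (edges (blow g x)))"
    by (metis id_apply lgraph.collapse)
  have w: "verts (blow g x) ! bump ?m u = White \<longleftrightarrow> verts g ! u = White" if "u < nverts g" for u
    using vert_blow_bump[OF that, of x] swap_verts(4) by (auto simp: core_kind_def hair_ends_def)
  \<comment> \<open>The core may turn from external to internal, but both black kinds have degree
    \<open>- j\<close>.\<close>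
  have "vert_degs n j (blow g x) ! bump ?m u = vert_degs n j g ! u" if "u < nverts g" for u
    using that w[OF that] ml vert_deg_White[of "verts (blow g x) ! bump ?m u" "verts g ! u"]
    by (simp add: vert_degs_nth bump_def)
  then have "sgn_pow (vert_degs n j g ! e * vert_degs n j g ! Suc e) =
    sgn_pow (vert_degs n j (blow g x) ! ?e * vert_degs n j (blow g x) ! Suc ?e)"
    unfolding e' using swap_verts by simp
  moreover have "(verts (blow g x) ! ?e = White) = (verts (blow g x) ! Suc ?e = White)"
    unfolding e' using w swap_verts by simp
  moreover have "Suc ?e < nverts (blow g x)" using el by simp
  ultimately show ?case
    unfolding b using step.swap_verts[of ?e "blow g x" n j] by metis
next
  case (reverse e g)
  let ?h = "LGraph (verts g) ((edges g)[e := reverse_edge (edges g ! e)])"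
  define f where "f = (\<lambda>(k, b). (k, b \<noteq> (k = e)))"
  have st: "step n j g (sgn_pow (edge_degs n j g ! e + 1)) id f ?h"
    unfolding f_def using reverse by (intro step.reverse)
  have xl: "fst x < nedges g" using reverse by (simp add: hair_ends_def)
  have nb: "nblack ?h = nblack g" by (simp add: nblack_def)
  have hv: "hvert ?h (f x) = hvert g x" using step_valence_hvert(1)[OF st xl] by simp
  have ck: "core_kind ?h v = core_kind g v" for v
    using step_valence[OF st, of _ v] by (simp add: core_kind_def)
  have fx: "fst (f x) = fst x" "snd (f x) = (snd x \<noteq> (fst x = e))" by (cases x; simp add: f_def)+
  have "edges (blow ?h (f x)) = (edges (blow g x))[Suc e := reverse_edge (edges (blow g x) ! Suc e)]"
  proof (rule nth_equalityI)
    fix k assume "k < nedges (blow ?h (f x))"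
    then have k: "k < Suc (nedges g)" by simp
    show "edges (blow ?h (f x)) ! k = (edges (blow g x))[Suc e := reverse_edge (edges (blow g x) ! Suc e)] ! k"
    proof (cases k)
      case 0
      then show ?thesis by (simp add: nb hv)
    next
      case (Suc l)
      then show ?thesis using k reverse
        by (cases "l = e"; cases "l = fst x")
          (simp_all add: edge_blow_Suc nb fx reverse_set_end rename_edge_reverse)
    qed
  qed simp
  moreover have "verts (blow ?h (f x)) = verts (blow g x)"
    by (simp add: blow_def nb hv ck)
  ultimately have b: "blow ?h (f x) =
      LGraph (verts (blow g x)) ((edges (blow g x))[Suc e := reverse_edge (edges (blow g x) ! Suc e)])"
    by (metis lgraph.collapse)
  have "sgn_pow (edge_degs n j g ! e + 1) = sgn_pow (edge_degs n j (blow g x) ! Suc e + 1)"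
    using reverse by (simp add: edge_degs_nth)
  then show ?case
    unfolding b[unfolded f_def] using reverse step.reverse[of "Suc e" "blow g x" n j] by (metis Suc_mono nedges_blow)
qed

section \<open>Pulling out commutes with contracting solid edges\<close>

text \<open>\<open>m\<close> is the place of a new vertex. The deletion of \<open>q\<close> in front
  of it moves this place down to \<open>m - 1\<close>.\<close>

lemma merge_bump_commute: "p < q \<Longrightarrow> q < m \<Longrightarrow> merge p q (bump m v) = bump (m - 1) (merge p q v)"
  unfolding merge_def squeeze_def bump_def by (cases "v < m"; cases "v = q"; cases "q < v") auto

lemma remove_nth_insert_nth:
  assumes "q < m" "m \<le> length xs"
  shows "remove_nth q (insert_nth m a xs) = insert_nth (m - 1) a (remove_nth q xs)"
proof -
  obtain k where m: "m = Suc k" "q \<le> k" using assms by (cases m) auto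
  then have k: "k < length xs" using assms by simp
  show ?thesis
  proof (rule insert_nth_eqI)
    have "remove_nth q (insert_nth m a xs) ! k = insert_nth m a xs ! bump q k"
      using assms m k by (subst nth_remove_nth) auto
    moreover have "bump q k = m" using m by (simp add: bump_def)
    ultimately show "remove_nth q (insert_nth m a xs) ! (m - 1) = a"
      using assms m by (simp add: nth_insert_nth_self)
  next
    fix u assume "u < length (remove_nth q xs)"
    then have u: "u < length xs - 1" using assms by simp
    have "bump k u < length xs" using u k by auto
    then have "remove_nth q (insert_nth m a xs) ! bump k u = insert_nth m a xs ! bump q (bump k u)"
      using assms by (subst nth_remove_nth) auto
    also have "bump q (bump k u) = bump m (bump q u)" using bump_commute[of q m u] m by simp
    also have "insert_nth m a xs ! bump m (bump q u) = xs ! bump q u"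
      using assms u by (intro nth_insert_nth_bump) auto
    also have "\<dots> = remove_nth q xs ! u" using assms u by (subst nth_remove_nth) auto
    finally show "remove_nth q (insert_nth m a xs) ! bump (m - 1) u = remove_nth q xs ! u" using m by simp
  qed (use assms in auto)
qed

lemma insert_nth_update:
  "p < m \<Longrightarrow> m \<le> length xs \<Longrightarrow> (insert_nth m a xs)[p := w] = insert_nth m a (xs[p := w])"
  by (simp add: insert_nth_def list_update_append take_update_swap)

lemma nth_insert_nth_less: "p < m \<Longrightarrow> m \<le> length xs \<Longrightarrow> insert_nth m a xs ! p = xs ! p"
  by (simp add: insert_nth_def nth_append)

lemma squeeze_eq_iff: "v \<noteq> q \<Longrightarrow> squeeze q v = u \<longleftrightarrow> v = bump q u"
  by auto

lemma remove_nth_update: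
  "v \<noteq> q \<Longrightarrow> q < length xs \<Longrightarrow> v < length xs \<Longrightarrow>
   remove_nth q (xs[v := a]) = (remove_nth q xs)[squeeze q v := a]"
  by (rule nth_equalityI) (simp_all add: nth_remove_nth nth_list_update squeeze_eq_iff)

lemma remove_nth_update_self: "remove_nth q (xs[q := a]) = remove_nth q xs"
  by (simp add: remove_nth_def)

text \<open>Solid contractions are those that commute with pulling out: the deleted vertex is black,
  so the place of the new vertex just moves down by one, and all dashed half-edges at external
  vertices survive. The contraction of a dashed edge at an external vertex, in contrast, creates new
  ones from those of the white vertex.\<close>

locale solid_contraction =
  fixes g :: lgraph and i :: nat
  assumes g: "g \<in> plain_graphs" and i: "contractible g i" and solid: "kind (edges g ! i) = Solid"
begin

lemma lg: "labeled_graph g" using g by (simp add: plain_graphs_iff)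

lemma ends: "endp g i < endq g i" "endq g i < nverts g" "i < nedges g" "endp g i < nverts g"
  using i by (auto simp: contractible_def)

lemma endq_black: "endq g i < nblack g"
  using white_iff[OF lg ends(2)] contractible_kinds(1)[OF g i solid] by simp

lemma nblack': "nblack (contract g i) = nblack g - 1"
  using nblack_contract[OF lg i] solid by simp

lemma hair_end_neq: "x \<in> hair_ends g \<Longrightarrow> fst x \<noteq> i"
  using solid by (auto simp: hair_ends_def)

lemma hvert': "fst x < nedges g \<Longrightarrow> fst x \<noteq> i \<Longrightarrow>
   hvert (contract g i) (apfst (squeeze i) x) = merge (endp g i) (endq g i) (hvert g x)"
  by (rule hvert_contract[OF ends(3)])

lemma merged_kind:
  assumes v: "v < nverts g"
  shows "verts (contract g i) ! merge (endp g i) (endq g i) v =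
    (if v = endp g i \<or> v = endq g i then join_kind (verts g ! endp g i) (verts g ! endq g i) else verts g ! v)"
  using vert_contract[OF i v] .

text \<open>The merged vertex is external as soon as one end of \<open>i\<close> is. A dashed
  half-edge at it still comes from an external end, because internal vertices carry no dashed
  half-edges.\<close>

lemma hair_ends_contract: "bij_betw (apfst (squeeze i)) (hair_ends g) (hair_ends (contract g i))"
proof (rule bij_betw_byWitness[where f' = "apfst (bump i)"])
  show "\<forall>x\<in>hair_ends g. apfst (bump i) (apfst (squeeze i) x) = x"
    using hair_end_neq by (auto simp: apfst_def map_prod_def)
  show "\<forall>y\<in>hair_ends (contract g i). apfst (squeeze i) (apfst (bump i) y) = y"
    by (auto simp: apfst_def map_prod_def)
  show "apfst (squeeze i) ` hair_ends g \<subseteq> hair_ends (contract g i)"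
  proof (rule image_subsetI)
    fix x assume x: "x \<in> hair_ends g"
    then have x': "fst x < nedges g" "fst x \<noteq> i" "hvert g x < nverts g"
      using hair_end_neq hair_end_less[OF lg] by (auto simp: hair_ends_def)
    then show "apfst (squeeze i) x \<in> hair_ends (contract g i)"
      using x squeeze_less[OF ends(3) x'(1)] merged_kind[OF x'(3)] hvert'[OF x'(1,2)]
        kind_contract[OF ends(3) x'(1,2)]
      by (auto simp: hair_ends_def nedges_contract[OF i] join_kind_def)
  qed
  show "apfst (bump i) ` hair_ends (contract g i) \<subseteq> hair_ends g"
  proof (rule image_subsetI)
    fix y assume y: "y \<in> hair_ends (contract g i)"
    define x where "x = apfst (bump i) y"
    have x: "fst x < nedges g" "fst x \<noteq> i" "apfst (squeeze i) x = y"
      using y ends by (cases y; auto simp: x_def hair_ends_def nedges_contract[OF i])+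
    have k: "kind (edges g ! fst x) = Dashed"
      using y kind_contract[OF ends(3) x(1,2)] by (auto simp: hair_ends_def x(3)[symmetric])
    have v: "hvert g x < nverts g" using hvert_less[OF lg x(1)] .
    have e: "(if hvert g x = endp g i \<or> hvert g x = endq g i
        then join_kind (verts g ! endp g i) (verts g ! endq g i) else verts g ! hvert g x) = External"
      using y merged_kind[OF v] hvert'[OF x(1,2)] by (simp add: hair_ends_def x(3))
    have "verts g ! hvert g x \<noteq> Internal" using good_halves(2)[OF g x(1)] k by auto
    then have "verts g ! hvert g x = External"
      using e contractible_kinds(1)[OF g i solid] by (cases "verts g ! hvert g x") (auto split: if_splits)
    then show "apfst (bump i) y \<in> hair_ends g" using x(1) k by (simp add: hair_ends_def x_def)
  qed
qed

lemma good_ends: "good_vertex g (endp g i)" "good_vertex g (endq g i)"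
  using g ends by (auto simp: plain_graphs_iff)

lemma solid_valence_ends: "valence g Solid (endp g i) \<ge> 1" "valence g Solid (endq g i) \<ge> 1"
proof -
  obtain b where "hvert g (i, b) = endp g i" "hvert g (i, \<not> b) = endq g i" by (rule obtain_hvert_endp)
  then have "(i, b) \<in> halves g Solid (endp g i)" "(i, \<not> b) \<in> halves g Solid (endq g i)"
    using solid ends by (auto simp: halves_def)
  then have "halves g Solid (endp g i) \<noteq> {}" "halves g Solid (endq g i) \<noteq> {}" by auto
  then have "valence g Solid (endp g i) \<noteq> 0" "valence g Solid (endq g i) \<noteq> 0"
    by (simp_all add: valence_card)
  then show "valence g Solid (endp g i) \<ge> 1" "valence g Solid (endq g i) \<ge> 1" by simp_all
qed

text \<open>At the merged vertex every dashed half-edge can be pulled out: an external partner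
  brings a second dashed half-edge, and an internal one leaves at least 1 + 3 - 2 solid
  ones.\<close>

lemma blowable_contract_iff:
  assumes x: "x \<in> hair_ends g"
  shows "apfst (squeeze i) x \<in> blowable (contract g i) \<longleftrightarrow>
    x \<in> blowable g \<or> hvert g x = endp g i \<or> hvert g x = endq g i"
proof -
  have x': "fst x < nedges g" "fst x \<noteq> i" "verts g ! hvert g x = External"
    using x hair_end_neq by (auto simp: hair_ends_def)
  have h: "apfst (squeeze i) x \<in> hair_ends (contract g i)"
    using hair_ends_contract x by (auto simp: bij_betw_def)
  show ?thesis
  proof (cases "hvert g x = endp g i \<or> hvert g x = endq g i")
    case True
    have "hvert (contract g i) (apfst (squeeze i) x) = endp g i"
      using True ends by (auto simp: hvert'[OF x'(1,2)] merge_simps)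
    moreover have "valence (contract g i) Dashed (endp g i) \<ge> 2 \<or> valence (contract g i) Solid (endp g i) \<ge> 2"
      using True x'(3) valence_contract_merged[OF i, of Dashed] valence_contract_merged[OF i, of Solid]
        good_ends solid_valence_ends contractible_kinds(1)[OF g i solid]
      unfolding good_vertex_def solid
      by (cases "verts g ! endp g i"; cases "verts g ! endq g i") auto
    ultimately show ?thesis using True h by (simp add: blowable_def)
  next
    case False
    then show ?thesis
      using h x valence_contract_other[OF i, of "hvert g x"] by (simp add: blowable_def hvert'[OF x'(1,2)])
  qed
qed

text \<open>The core of the merged vertex keeps a dashed half-edge if the core of \<open>v\<close>
  does or if the other end of \<open>i\<close> is external. This is the rule of
  \<open>join_kind\<close>.\<close>

lemma core_kind_contract:
  assumes v: "v < nverts g" "verts g ! v = External"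
  shows "core_kind (contract g i) (merge (endp g i) (endq g i) v) =
    (if v = endp g i then join_kind (core_kind g v) (verts g ! endq g i)
     else if v = endq g i then join_kind (verts g ! endp g i) (core_kind g v)
     else core_kind g v)"
proof (cases "v = endp g i \<or> v = endq g i")
  case True
  then have m: "merge (endp g i) (endq g i) v = endp g i" using ends by (auto simp: merge_simps)
  show ?thesis
    using True v(2) ends(1) valence_contract_merged[OF i, of Dashed] good_ends
      contractible_kinds(1)[OF g i solid]
    unfolding m good_vertex_def solid
    by (cases "verts g ! endp g i"; cases "verts g ! endq g i") (auto simp: core_kind_def join_kind_def)
next
  case False
  then show ?thesis using valence_contract_other[OF i, of v] by (simp add: core_kind_def)
qed

text \<open>The new edge is the first one and shifts \<open>i\<close> to \<open>Suc i\<close>.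
  Merging and changing the core commute by \<open>core_kind_contract\<close>, and the inserted
  vertex keeps its role as the last black one.\<close>

lemma blow_contract:
  assumes x: "x \<in> hair_ends g"
  shows "contract (blow g x) (Suc i) = blow (contract g i) (apfst (squeeze i) x)"
    and "contractible (blow g x) (Suc i)"
proof -
  let ?m = "nblack g" and ?p = "endp g i" and ?q = "endq g i" and ?v = "hvert g x"
  let ?x = "apfst (squeeze i) x" and ?r = "merge (endp g i) (endq g i)"
  have x': "fst x < nedges g" "fst x \<noteq> i" "verts g ! ?v = External"
    using x hair_end_neq by (auto simp: hair_ends_def)
  note l = hair_end_less[OF lg x]
  have ml: "?m \<le> nverts g" by (rule nblack_le)
  have pm: "?p < ?m" "?q < ?m" using ends endq_black by auto
  have ei: "edges (blow g x) ! Suc i = rename_edge (bump ?m) (edges g ! i)"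
    using edge_blow_Suc[OF ends(3), of x] x' by simp
  have ends_lt: "src (edges g ! i) < ?m" "tgt (edges g ! i) < ?m"
    using pm src_eq_endp_or_endq[of g i] tgt_eq_endp_or_endq[of g i] by auto
  have e: "endp (blow g x) (Suc i) = ?p" "endq (blow g x) (Suc i) = ?q"
    using ends_lt by (simp_all add: endp_def endq_def ei)
  have bq: "verts (blow g x) ! ?q \<noteq> White"
    using white_blow[OF lg x, of ?q] pm ends by simp
  show c: "contractible (blow g x) (Suc i)"
    using ends solid bq by (simp add: contractible_def e)
  have hv: "hvert (contract g i) ?x = ?r ?v" by (rule hvert'[OF x'(1,2)])
  define K where "K = core_kind g ?v"
  define vs where "vs = (verts g)[?v := K]"
  have "remove_nth ?q (vs[?p := join_kind (vs ! ?p) (vs ! ?q)]) =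
     (verts (contract g i))[?r ?v := core_kind (contract g i) (?r ?v)]"
  proof (cases "?v = ?q")
    case True
    then have "?r ?v = ?p" by (simp add: merge_simps)
    then show ?thesis
      using core_kind_contract[OF l(2) x'(3)] True ends
        remove_nth_update_self[of ?q "(verts g)[?p := join_kind (verts g ! ?p) K]" K]
        remove_nth_update[of ?p ?q "verts g"]
      by (simp add: vs_def verts_contract K_def list_update_swap squeeze_def)
  next
    case False
    then have r: "?r ?v = squeeze ?q ?v" by (simp add: merge_def)
    show ?thesis
    proof (cases "?v = ?p")
      case True
      then show ?thesis
        using core_kind_contract[OF l(2) x'(3)] False ends r
          remove_nth_update[of ?p ?q "verts g"] remove_nth_update[of ?p ?q "verts g"]
        by (simp add: vs_def verts_contract K_def squeeze_def)
    next
      case vp: False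
      then show ?thesis
        using core_kind_contract[OF l(2) x'(3)] False ends r l
          remove_nth_update[of ?v ?q "(verts g)[?p := join_kind (verts g ! ?p) (verts g ! ?q)]" K]
        by (simp add: vs_def verts_contract K_def list_update_swap)
    qed
  qed
  moreover have "verts (blow g x) = insert_nth ?m External vs"
    by (simp add: blow_def vs_def K_def)
  moreover have "verts (blow (contract g i) ?x) = insert_nth (?m - 1) External
     ((verts (contract g i))[?r ?v := core_kind (contract g i) (?r ?v)])"
    by (simp add: blow_def hv nblack')
  moreover have "?m \<le> length vs" using ml by (simp add: vs_def)
  ultimately have "verts (contract (blow g x) (Suc i)) = verts (blow (contract g i) ?x)"
    unfolding verts_contract[of "blow g x"] e
    using pm ml remove_nth_insert_nth[of ?q ?m "vs[?p := join_kind (vs ! ?p) (vs ! ?q)]" External]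
    by (simp add: insert_nth_update nth_insert_nth_less)
  moreover have "edges (contract (blow g x) (Suc i)) = edges (blow (contract g i) ?x)"
  proof (rule nth_equalityI)
    show "nedges (contract (blow g x) (Suc i)) = nedges (blow (contract g i) ?x)"
      using ends by (simp add: nedges_contract[OF c] nedges_contract[OF i])
    fix k assume "k < nedges (contract (blow g x) (Suc i))"
    then have k: "k < nedges g" by (simp add: nedges_contract[OF c])
    have rm: "?r ?m = ?m - 1" using pm by (simp add: merge_def squeeze_def)
    show "edges (contract (blow g x) (Suc i)) ! k = edges (blow (contract g i) ?x) ! k"
    proof (cases k)
      case 0
      then show ?thesis
        using edge_contract[of "Suc i" "blow g x" 0] ends by (simp add: e squeeze_def rm hv nblack')
    next
      case (Suc u)
      define w where "w = bump i u"
      have w: "w < nedges g" "w \<noteq> i" "squeeze i w = u" "squeeze (Suc i) (Suc w) = Suc u"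
        using k Suc ends by (auto simp: w_def squeeze_def bump_def)
      have u: "u < nedges (contract g i)" using k Suc ends by (simp add: nedges_contract[OF i])
      have "u = squeeze i (fst x) \<longleftrightarrow> w = fst x" using w x' by (metis bump_squeeze)
      moreover have "edges (contract (blow g x) (Suc i)) ! k = rename_edge ?r (edges (blow g x) ! Suc w)"
        using edge_contract[of "Suc i" "blow g x" "Suc w"] w ends Suc by (simp add: e)
      moreover have "edges (contract g i) ! u = rename_edge ?r (edges g ! w)"
        using edge_contract[OF ends(3) w(1)] w by simp
      ultimately show ?thesis
        using Suc edge_blow_Suc[OF u, of ?x] edge_blow_Suc[OF w(1), of x]
        by (simp add: nblack' rename_set_end rename_edge_comp comp_def rm merge_bump_commute[OF ends(1) endq_black])
    qed
  qed
  ultimately show "contract (blow g x) (Suc i) = blow (contract g i) ?x" using lgraph.expand by blast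
qed

end

section \<open>Antennas\<close>

text \<open>These are the half-edges that are already pulled out.\<close>

definition antenna :: "lgraph \<Rightarrow> nat \<times> bool \<Rightarrow> nat \<Rightarrow> bool" where
  "antenna g x i \<longleftrightarrow> x \<in> hair_ends g \<and> valence g Dashed (hvert g x) = 1 \<and> valence g Solid (hvert g x) = 1 \<and>
     contractible g i \<and> kind (edges g ! i) = Solid \<and> (hvert g x = endp g i \<or> hvert g x = endq g i)"

abbreviation "relations n j \<equiv> orientation_relations n j plain_graphs"

lemma step_relations:
  assumes st: "step n j g s t f h" and g: "g \<in> X" "degree n j g = k"
  shows "Poly_Mapping.single h 1 - Poly_Mapping.single g s \<in> orientation_relations n j X k"
proof -
  from step_imp_relabel[OF st] consider "relabel n j g s h" | "s = 1" "h = g" by blast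
  then show ?thesis
  proof cases
    case 1
    then show ?thesis using g unfolding orientation_relations_def by (intro qfree.span_base) blast
  next
    case 2
    then show ?thesis by (simp add: orientation_relations_def qfree.span_zero)
  qed
qed

lemma qscale_single: "qscale c (Poly_Mapping.single g a) = Poly_Mapping.single g (c * a)"
  by (rule poly_mapping_eqI) (simp add: lookup_single when_def)

lemma relations_scale: "x \<in> orientation_relations n j X k \<Longrightarrow> qscale c x \<in> orientation_relations n j X k"
  and relations_add: "x \<in> orientation_relations n j X k \<Longrightarrow> y \<in> orientation_relations n j X k \<Longrightarrow>
    x + y \<in> orientation_relations n j X k"
  and relations_diff: "x \<in> orientation_relations n j X k \<Longrightarrow> y \<in> orientation_relations n j X k \<Longrightarrow>
    x - y \<in> orientation_relations n j X k"
  and relations_zero: "0 \<in> orientation_relations n j X k"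
  and relations_neg: "x \<in> orientation_relations n j X k \<Longrightarrow> - x \<in> orientation_relations n j X k"
  unfolding orientation_relations_def
  by (simp_all add: qfree.span_scale qfree.span_add qfree.span_diff qfree.span_zero qfree.span_neg)

lemma relations_sum: "(\<And>a. a \<in> A \<Longrightarrow> f a \<in> orientation_relations n j X k) \<Longrightarrow>
   sum f A \<in> orientation_relations n j X k"
  unfolding orientation_relations_def by (rule qfree.span_sum)

lemma edge_eqI:
  assumes "kind (edges g ! k) = kind (edges h ! l)" "\<And>b. hvert g (k, b) = hvert h (l, b)"
  shows "edges g ! k = edges h ! l"
  using assms(1) assms(2)[of True] assms(2)[of False]
  by (cases "edges g ! k"; cases "edges h ! l") (simp add: hvert_def)

lemma unique_half:
  assumes "valence g k v = 1" "x \<in> halves g k v" "y \<in> halves g k v"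
  shows "x = y"
  using assms by (metis valence_card card_1_singletonE singletonD)

text \<open>The hypotheses put the external vertex and its solid edge in the places where
  \<open>blow\<close> creates them: last black vertex, first edge, directed towards the new
  vertex.\<close>

lemma antenna_normal:
  assumes g: "g \<in> plain_graphs" and a: "antenna g x 0"
    and v: "hvert g x = nblack g - 1" and src: "src (edges g ! 0) \<noteq> hvert g x"
  shows "blow (contract g 0) (apfst (squeeze 0) x) = g"
proof -
  interpret solid_contraction g 0
    using g a by unfold_locales (auto simp: antenna_def)
  let ?p = "endp g 0" and ?q = "endq g 0" and ?h = "contract g 0" and ?x = "apfst (squeeze 0) x"
  have x: "x \<in> hair_ends g" using a by (simp add: antenna_def)
  have q: "hvert g x = ?q"
    using a v ends endq_black by (auto simp: antenna_def)
  have sq: "src (edges g ! 0) = ?p" using src q src_eq_endp_or_endq[of g 0] by auto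
  have tq: "tgt (edges g ! 0) = ?q" using sq ends
    by (cases "src (edges g ! 0) \<le> tgt (edges g ! 0)") (simp_all add: endp_def endq_def)
  have x': "fst x < nedges g" "fst x \<noteq> 0" "kind (edges g ! fst x) = Dashed" "verts g ! ?q = External"
    using x hair_end_neq q by (auto simp: hair_ends_def)
  have hv: "hvert ?h ?x = ?p" using hvert'[OF x'(1,2)] q by (simp add: merge_simps)
  have m: "nblack ?h = ?q" using nblack' v q by simp
  have mp: "merge ?p ?q ?p = ?p" using ends by (simp add: merge_simps)
  \<comment> \<open>Besides \<open>x\<close> the merged vertex carries the dashed half-edges of
    \<open>?p\<close>, so it has at least two exactly if \<open>?p\<close> is external.\<close>
  have ck: "core_kind ?h ?p = verts g ! ?p"
    using valence_contract_merged[OF i, of Dashed] a good_ends(1) contractible_kinds(1)[OF g i solid]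
    by (cases "verts g ! ?p") (auto simp: core_kind_def good_vertex_def antenna_def q solid)
  have only: "y = x" if "fst y < nedges g" "fst y \<noteq> 0" "hvert g y = ?q" for y
  proof (cases "kind (edges g ! fst y)")
    case Dashed
    then have "y \<in> halves g Dashed ?q" "x \<in> halves g Dashed ?q"
      using that x' q by (simp_all add: halves_def)
    moreover have "valence g Dashed ?q = 1" using a q by (simp add: antenna_def)
    ultimately show ?thesis by (metis unique_half)
  next
    case Solid
    have "(0, False) \<in> halves g Solid ?q" using ends solid tq by (simp add: halves_def hvert_def)
    moreover have "y \<in> halves g Solid ?q" using that Solid by (simp add: halves_def)
    moreover have "valence g Solid ?q = 1" using a q by (simp add: antenna_def)
    ultimately have "y = (0, False)" by (metis unique_half)
    then show ?thesis using that by simp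
  qed
  have "verts (blow ?h ?x) = verts g"
  proof (rule nth_equalityI)
    show "nverts (blow ?h ?x) = nverts g" using ends by (simp add: nverts_contract[OF i])
    fix u assume "u < nverts (blow ?h ?x)"
    then have u: "u < nverts g" using ends by (simp add: nverts_contract[OF i])
    show "verts (blow ?h ?x) ! u = verts g ! u"
    proof (cases "u = ?q")
      case True
      then show ?thesis using vert_blow_new[of ?h ?x] x' m by simp
    next
      case False
      then obtain w where w: "w < nverts g - 1" "u = bump ?q w"
        using u ends False by (elim obtain_bump[of u "nverts g - 1" ?q, rotated 3]) auto
      have wl: "w < nverts ?h" using w by (simp add: nverts_contract[OF i])
      have mw: "merge ?p ?q u = w" using w by (simp add: merge_bump)
      have pw: "w = ?p \<longleftrightarrow> u = ?p" using mw merge_eq_iff[OF ends(1), of u ?p] False mp by auto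
      show ?thesis
        using vert_blow_bump[OF wl, of ?x] merged_kind[OF u] False pw
        unfolding m w(2)[symmetric] hv mw by (auto simp: ck)
    qed
  qed
  moreover have "edges (blow ?h ?x) = edges g"
  proof (rule nth_equalityI)
    show "nedges (blow ?h ?x) = nedges g" using ends by (simp add: nedges_contract[OF i])
    fix k assume "k < nedges (blow ?h ?x)"
    then have k: "k < nedges g" using ends by (simp add: nedges_contract[OF i])
    show "edges (blow ?h ?x) ! k = edges g ! k"
    proof (cases k)
      case 0
      then show ?thesis using hv m sq tq solid by (cases "edges g ! 0") simp
    next
      case (Suc l)
      have s: "squeeze 0 k = l" using Suc by (simp add: squeeze_def)
      have l: "l < nedges ?h" using Suc k by (simp add: nedges_contract[OF i])
      have "hvert (blow ?h ?x) (k, b) = hvert g (k, b)" for b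
      proof -
        have h: "hvert ?h (l, b) = merge ?p ?q (hvert g (k, b))"
          using hvert'[of "(k, b)"] k Suc s by simp
        have "(l, b) = ?x \<longleftrightarrow> (k, b) = x"
          using Suc x'(2) by (cases x) (auto simp: squeeze_def)
        moreover have "(k, b) \<noteq> x \<Longrightarrow> hvert g (k, b) \<noteq> ?q" using only[of "(k, b)"] k Suc by auto
        ultimately show ?thesis
          using Suc hvert_blow_Suc[OF l, of ?x b] bump_merge[OF ends(1), of "hvert g (k, b)"] q
          by (auto simp: m h)
      qed
      moreover have "kind (edges (blow ?h ?x) ! k) = kind (edges g ! k)"
        using kind_blow_Suc[OF l, of ?x] kind_contract[of 0 g k] Suc k ends s by simp
      ultimately show ?thesis by (intro edge_eqI)
    qed
  qed
  ultimately show ?thesis using lgraph.expand by blast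
qed

text \<open>Compares \<open>g\<close> with the term, up to the factor 1/N, of the homotopy after the
  solid differential in which the edge of the antenna is contracted and \<open>x\<close> is pulled
  out again.\<close>

definition antenna_rel :: "int \<Rightarrow> int \<Rightarrow> lgraph \<Rightarrow> nat \<times> bool \<Rightarrow> nat \<Rightarrow> bool" where
  "antenna_rel n j g x i \<longleftrightarrow>
     Poly_Mapping.single (blow (contract g i) (apfst (squeeze i) x))
         (contr_sign n j g i * sgn_pow (blow_exp n j (contract g i))) - Poly_Mapping.single g 1
       \<in> relations n j (degree n j g)"

lemma step_antenna:
  assumes st: "step n j g s t f h" and g: "g \<in> plain_graphs" and a: "antenna g x i"
  shows "antenna h (f x) (fst (f (i, True)))"
proof -
  have lg: "labeled_graph g" using g by (simp add: plain_graphs_iff)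
  have x: "x \<in> hair_ends g" "fst x < nedges g" and i: "contractible g i" "i < nedges g"
    using a by (auto simp: antenna_def hair_ends_def contractible_def)
  have "t (hvert g x) \<in> t ` {endp g i, endq g i}" using a by (auto simp: antenna_def)
  then have "t (hvert g x) = endp h (fst (f (i, True))) \<or> t (hvert g x) = endq h (fst (f (i, True)))"
    unfolding step_endpoints[OF st i(2), symmetric] by simp
  then show ?thesis
    using a step_hair_ends[OF st lg x(1)] step_valence_hvert[OF st x(2)] step_contractible[OF st lg i(1)]
      step_transport(2)[OF st, of "(i, True)"] i
    by (simp add: antenna_def step_valence[OF st])
qed

lemma contr_sign_sq: "i < nedges g \<Longrightarrow> contr_sign n j g i * contr_sign n j g i = 1"
  by (simp add: contr_sign_exp)

text \<open>A relabeling of \<open>g\<close> induces one of the contractions and then one of their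
  pull-outs, with matching signs. So the relation may be checked after any relabeling.\<close>

lemma antenna_rel_step:
  assumes st: "step n j g s t f h" and g: "g \<in> plain_graphs" and a: "antenna g x i"
    and rel: "antenna_rel n j h (f x) (fst (f (i, True)))"
  shows "antenna_rel n j g x i"
proof -
  let ?i = "fst (f (i, True))" and ?k = "degree n j g"
  have lg: "labeled_graph g" using g by (simp add: plain_graphs_iff)
  interpret solid_contraction g i using g a by unfold_locales (auto simp: antenna_def)
  have x: "x \<in> hair_ends g" "fst x < nedges g" "fst x \<noteq> i"
    using a hair_end_neq by (auto simp: antenna_def hair_ends_def)
  obtain t' f' where st': "step n j (contract g i) (s * contr_sign n j g i * contr_sign n j h ?i) t' f' (contract h ?i)"
    and f': "\<And>k b. k < nedges g \<Longrightarrow> k \<noteq> i \<Longrightarrow> f' (squeeze i k, b) = apfst (squeeze ?i) (f (k, b))"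
    by (rule step_contract[OF st lg i]) blast
  have fx: "f' (apfst (squeeze i) x) = apfst (squeeze ?i) (f x)" using f'[OF x(2,3), of "snd x"] by (cases x) simp
  have lc: "labeled_graph (contract g i)" using plain_graphs_contract[OF g i] by (simp add: plain_graphs_iff)
  have xc: "apfst (squeeze i) x \<in> hair_ends (contract g i)"
    using hair_ends_contract x by (auto simp: bij_betw_def)
  have xb: "apfst (squeeze i) x \<in> blowable (contract g i)"
    using blowable_contract_iff[OF x(1)] a by (simp add: antenna_def)
  let ?b = "blow (contract g i) (apfst (squeeze i) x)" and ?b' = "blow (contract h ?i) (apfst (squeeze ?i) (f x))"
  obtain t'' f'' where sb: "step n j ?b (s * contr_sign n j g i * contr_sign n j h ?i) t'' f'' ?b'"
    using step_blow[OF st' lc xc] fx by auto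
  have db: "degree n j ?b = ?k"
    using degree_blow[OF lc xc] degree_contract[OF lg i, of n j] by simp
  have iE: "i < nedges g" "?i < nedges h" using ends step_bij(4,6)[OF st] by auto
  define c c' e where "c = contr_sign n j g i" "c' = contr_sign n j h ?i" "e = sgn_pow (blow_exp n j (contract g i))"
  note ce = this
  have sq: "c * c = 1" "c' * c' = 1" "e * e = 1" "s * s = 1"
    using iE step_bij(8)[OF st] by (simp_all add: ce contr_sign_sq)
  have eq: "sgn_pow (blow_exp n j (contract h ?i)) = e" using step_blow_exp[OF st'] by (simp add: ce)
  have r1: "Poly_Mapping.single ?b' 1 - Poly_Mapping.single ?b (s * c * c') \<in> relations n j ?k"
    using step_relations[OF sb blow_plain_graphs(1)[OF plain_graphs_contract[OF g i] xb] db] by (simp add: ce)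
  have r2: "Poly_Mapping.single h 1 - Poly_Mapping.single g s \<in> relations n j ?k"
    by (rule step_relations[OF st g HOL.refl])
  have r3: "Poly_Mapping.single ?b' (c' * e) - Poly_Mapping.single h 1 \<in> relations n j ?k"
    using rel step_sums(3)[OF st] unfolding antenna_rel_def eq by (simp add: ce)
  \<comment> \<open>From \<open>g\<close> to \<open>h\<close> by the relabeling, from
    \<open>h\<close> to its pull-out by hypothesis, and back to the pull-out of \<open>g\<close> by
    the induced relabeling.\<close>
  have "Poly_Mapping.single ?b (c * e) - Poly_Mapping.single g 1 =
    qscale s (Poly_Mapping.single ?b' (c' * e) - Poly_Mapping.single h 1) +
    qscale s (Poly_Mapping.single h 1 - Poly_Mapping.single g s) -
    qscale (s * c' * e) (Poly_Mapping.single ?b' 1 - Poly_Mapping.single ?b (s * c * c'))"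
  proof -
    have "s * (c' * (e * (s * (c * c')))) = (s * s) * (c' * c') * (c * e)" by (simp only: ac_simps)
    then have 1: "s * (c' * (e * (s * (c * c')))) = c * e" by (simp add: sq)
    show ?thesis
      by (simp add: qfree.scale_right_diff_distrib qscale_single 1 sq mult.assoc)
  qed
  also have "\<dots> \<in> relations n j ?k"
    by (intro relations_add relations_diff relations_scale r1 r2 r3)
  finally show ?thesis unfolding antenna_rel_def ce .
qed

text \<open>Relabelings bring an antenna into the position in which \<open>antenna_normal\<close> applies.\<close>

lemma antenna_rel:
  assumes "g \<in> plain_graphs" "antenna g x i"
  shows "antenna_rel n j g x i"
  using assms
\<comment> \<open>The three summands measure how far the vertex is from the last black place, the
  edge from the first place, and whether the edge points away from the vertex. One relabeling
  decreases one of them and leaves the others.\<close>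
proof (induction "(nblack g - hvert g x) + i + (if src (edges g ! i) = hvert g x then 1 else 0)"
    arbitrary: g x i rule: less_induct)
  case less
  note g = less.prems(1) and a = less.prems(2)
  interpret solid_contraction g i using g a by unfold_locales (auto simp: antenna_def)
  have x: "x \<in> hair_ends g" "fst x < nedges g" "fst x \<noteq> i"
    using a hair_end_neq by (auto simp: antenna_def hair_ends_def)
  note l = hair_end_less[OF lg x(1)]
  have by_step: "antenna_rel n j g x i"
    if st: "step n j g s t f h"
      and m: "(nblack h - hvert h (f x)) + fst (f (i, True)) +
          (if src (edges h ! fst (f (i, True))) = hvert h (f x) then 1 else 0) <
        (nblack g - hvert g x) + i + (if src (edges g ! i) = hvert g x then 1 else 0)" for s t f h
    by (rule antenna_rel_step[OF st g a]) (rule less.hyps[OF m step_plain_graphs[OF st g] step_antenna[OF st g a]])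
  consider "0 < i" | "i = 0" "Suc (hvert g x) < nblack g" | "i = 0" "hvert g x = nblack g - 1" "src (edges g ! 0) = hvert g x"
    | "i = 0" "hvert g x = nblack g - 1" "src (edges g ! 0) \<noteq> hvert g x"
    using l by linarith
  then show ?case
  proof cases
    case 1
    then obtain e where e: "i = Suc e" by (cases i) auto
    have "map (\<lambda>e. kind e = Dashed) (edges g) ! e \<le> map (\<lambda>e. kind e = Dashed) (edges g) ! i"
      using lg ends e by (intro sorted_nth_mono) (auto simp: labeled_graph_def)
    then have k: "kind (edges g ! e) = Solid" using ends e solid by (cases "kind (edges g ! e)") auto
    have st: "step n j g (sgn_pow (edge_degs n j g ! e * edge_degs n j g ! Suc e)) id (apfst (flip e))
       (LGraph (verts g) (swap_adjacent e (edges g)))"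
      using ends e k solid by (intro step.swap_edges) auto
    have f: "flip e (Suc e) = e" "flip e e = Suc e" by (simp_all add: flip_def)
    show ?thesis
      by (rule by_step[OF st])
        (use step_valence_hvert(1)[OF st x(2)] step_nblack[OF st] ends in \<open>simp add: f nth_swap_adjacent e\<close>)
  next
    case 2
    let ?v = "hvert g x"
    have st: "step n j g (sgn_pow (vert_degs n j g ! ?v * vert_degs n j g ! Suc ?v)) (flip ?v) id
       (LGraph (swap_adjacent ?v (verts g)) (map (rename_edge (flip ?v)) (edges g)))"
      using 2 nblack_le[of g] white_iff[OF lg, of ?v] white_iff[OF lg, of "Suc ?v"]
      by (intro step.swap_verts) auto
    have f: "flip ?v ?v = Suc ?v" by (simp add: flip_def)
    have f2: "flip ?v u = Suc ?v \<longleftrightarrow> u = ?v" for u by (auto simp: flip_def)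
    show ?thesis
      by (rule by_step[OF st])
        (use step_valence_hvert(1)[OF st x(2)] step_nblack[OF st] ends 2 in \<open>simp add: f f2\<close>)
  next
    case 3
    let ?f = "\<lambda>(k, b). (k, b \<noteq> (k = (0 :: nat)))"
    have st: "step n j g (sgn_pow (edge_degs n j g ! 0 + 1)) id ?f
       (LGraph (verts g) ((edges g)[0 := reverse_edge (edges g ! 0)]))"
      using ends 3 by (intro step.reverse) simp
    have f: "?f x = x" "?f (0, True) = (0, False)" using x(3) 3 by (cases x; auto)+
    have "src (edges g ! 0) \<noteq> tgt (edges g ! 0)"
      using ends(1) 3 by (auto simp: endp_def endq_def)
    then show ?thesis
      using step_valence_hvert(1)[OF st x(2)] step_nblack[OF st] ends 3
      by (intro by_step[OF st]) (simp add: f del: split_paired_All split: prod.splits)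
  next
    case 4
    then have b: "blow (contract g 0) (apfst (squeeze 0) x) = g"
      using antenna_normal[OF g] a by simp
    have xc: "apfst (squeeze i) x \<in> hair_ends (contract g i)"
      using hair_ends_contract x by (auto simp: bij_betw_def)
    have lc: "labeled_graph (contract g i)" using plain_graphs_contract[OF g i] by (simp add: plain_graphs_iff)
    \<comment> \<open>As \<open>g\<close> is itself the pull-out, the second factor is again the
      sign of contracting its edge 0, and the product is a square.\<close>
    have "contr_sign n j g 0 * sgn_pow (blow_exp n j (contract g 0)) = 1"
      using contr_sign_blow_0[OF lc xc, of n j] contr_sign_sq[of 0 g n j] ends 4 b by simp
    then show ?thesis unfolding antenna_rel_def 4(1) b by (simp add: relations_zero)
  qed
qed

section \<open>Linear extensions\<close>

lemma extend_linearly_superset: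
  "finite A \<Longrightarrow> Poly_Mapping.keys x \<subseteq> A \<Longrightarrow>
   extend_linearly f x = (\<Sum>a\<in>A. qscale (Poly_Mapping.lookup x a) (f a))"
  unfolding extend_linearly_def
  by (rule sum.mono_neutral_left) (auto simp: in_keys_iff)

lemma extend_linearly_add: "extend_linearly f (x + y) = extend_linearly f x + extend_linearly f y"
proof -
  let ?A = "Poly_Mapping.keys x \<union> Poly_Mapping.keys y"
  have "Poly_Mapping.keys (x + y) \<subseteq> ?A" by (rule Poly_Mapping.keys_add)
  then show ?thesis
    by (simp add: extend_linearly_superset[of ?A] lookup_add qfree.scale_left_distrib sum.distrib)
qed

lemma keys_qscale: "Poly_Mapping.keys (qscale c x) \<subseteq> Poly_Mapping.keys x"
  by (auto simp: in_keys_iff)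

lemma extend_linearly_scale: "extend_linearly f (qscale c x) = qscale c (extend_linearly f x)"
  using keys_qscale[of c x]
  by (simp add: extend_linearly_superset[of "Poly_Mapping.keys x"] qfree.scale_sum_right)

lemma extend_linearly_zero [simp]: "extend_linearly f 0 = 0"
  by (simp add: extend_linearly_def)

lemma extend_linearly_diff: "extend_linearly f (x - y) = extend_linearly f x - extend_linearly f y"
  using extend_linearly_add[of f "x - y" y] by simp

lemma extend_linearly_sum: "extend_linearly f (sum F A) = (\<Sum>a\<in>A. extend_linearly f (F a))"
  by (induction A rule: infinite_finite_induct) (simp_all add: extend_linearly_add)

lemma extend_linearly_single: "extend_linearly f (Poly_Mapping.single a c) = qscale c (f a)"
  by (subst extend_linearly_superset[of "{a}"]) auto

lemma extend_linearly_comp: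
  "extend_linearly f (extend_linearly g x) = extend_linearly (\<lambda>a. extend_linearly f (g a)) x"
  by (simp add: extend_linearly_def[of g] extend_linearly_sum extend_linearly_scale
      extend_linearly_def[of "\<lambda>a. extend_linearly f (g a)"])

lemma extend_linearly_cong:
  "(\<And>a. a \<in> Poly_Mapping.keys x \<Longrightarrow> f a = g a) \<Longrightarrow> extend_linearly f x = extend_linearly g x"
  by (simp add: extend_linearly_def)

lemma extend_linearly_fun_add:
  "extend_linearly (\<lambda>a. f a + g a) x = extend_linearly f x + extend_linearly g x"
  by (simp add: extend_linearly_def qfree.scale_right_distrib sum.distrib)

lemma extend_linearly_id: "extend_linearly (\<lambda>a. Poly_Mapping.single a 1) x = x"
proof (rule poly_mapping_eqI)
  fix a
  have "Poly_Mapping.lookup (extend_linearly (\<lambda>a. Poly_Mapping.single a 1) x) a =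
      (\<Sum>b\<in>Poly_Mapping.keys x. Poly_Mapping.lookup x b * (1 when b = a))"
    by (simp add: extend_linearly_def lookup_sum lookup_single)
  also have "\<dots> = (\<Sum>b\<in>Poly_Mapping.keys x. if b = a then Poly_Mapping.lookup x b else 0)"
    by (rule sum.cong) (auto simp: when_def)
  also have "\<dots> = Poly_Mapping.lookup x a" by (simp add: in_keys_iff)
  finally show "Poly_Mapping.lookup (extend_linearly (\<lambda>a. Poly_Mapping.single a 1) x) a = Poly_Mapping.lookup x a" .
qed

lemma keys_extend_linearly:
  fixes f :: "'a \<Rightarrow> ('b \<Rightarrow>\<^sub>0 rat)"
  shows "Poly_Mapping.keys (extend_linearly f x) \<subseteq> (\<Union>a\<in>Poly_Mapping.keys x. Poly_Mapping.keys (f a))"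
proof -
  have "Poly_Mapping.keys (sum F A) \<subseteq> (\<Union>a\<in>A. Poly_Mapping.keys (F a))" if "finite A" for F :: "'a \<Rightarrow> ('b \<Rightarrow>\<^sub>0 rat)" and A
    using that
  proof induction
    case (insert a A)
    then show ?case using Poly_Mapping.keys_add[of "F a" "sum F A"] by auto
  qed simp
  note sum = this
  have "Poly_Mapping.keys (extend_linearly f x) \<subseteq>
      (\<Union>a\<in>Poly_Mapping.keys x. Poly_Mapping.keys (qscale (Poly_Mapping.lookup x a) (f a)))"
    unfolding extend_linearly_def by (rule sum) simp
  also have "\<dots> \<subseteq> (\<Union>a\<in>Poly_Mapping.keys x. Poly_Mapping.keys (f a))"
    by (intro UN_mono keys_qscale order_refl)
  finally show ?thesis .
qed

lemma extend_linearly_relations: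
  "(\<And>a. a \<in> Poly_Mapping.keys x \<Longrightarrow> f a \<in> orientation_relations n j X k) \<Longrightarrow>
   extend_linearly f x \<in> orientation_relations n j X k"
  unfolding extend_linearly_def by (intro relations_sum relations_scale)

text \<open>A generator relates \<open>h\<close> to \<open>s\<close> times \<open>g\<close> for one
  elementary change, so a map on labeled graphs passes to the quotients if it respects such a change
  up to relations.\<close>

lemma extend_linearly_on_relations:
  assumes "r \<in> orientation_relations n j X k"
    and "\<And>g s t f h. g \<in> X \<Longrightarrow> degree n j g = k \<Longrightarrow> step n j g s t f h \<Longrightarrow>
      F h - qscale s (F g) \<in> orientation_relations n j Y l"
  shows "extend_linearly F r \<in> orientation_relations n j Y l"
  using assms(1) unfolding orientation_relations_def[of n j X k]
proof (induction rule: qfree.span_induct_alt)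
  case base
  then show ?case by (simp add: relations_zero)
next
  case (step c x y)
  then obtain g s h where x: "x = Poly_Mapping.single h 1 - Poly_Mapping.single g s"
    "g \<in> X" "degree n j g = k" "relabel n j g s h" by blast
  obtain t f where "step n j g s t f h" using relabel_imp_step[OF x(4)] by blast
  then have "F h - qscale s (F g) \<in> orientation_relations n j Y l" using assms(2) x by blast
  then show ?case
    using step.IH by (simp add: x extend_linearly_add extend_linearly_scale extend_linearly_diff
        extend_linearly_single relations_add relations_scale)
qed

lemma keys_relations:
  assumes "r \<in> relations n j k" "a \<in> Poly_Mapping.keys r"
  shows "a \<in> plain_graphs \<and> degree n j a = k"
proof -
  have "Poly_Mapping.keys r \<subseteq> {g \<in> plain_graphs. degree n j g = k}"
    using assms(1) unfolding orientation_relations_def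
  proof (induction rule: qfree.span_induct_alt)
    case (step c x y)
    then obtain g s h where x: "x = Poly_Mapping.single h 1 - Poly_Mapping.single g s"
      "g \<in> plain_graphs" "degree n j g = k" "relabel n j g s h" by blast
    obtain t f where st: "step n j g s t f h" using relabel_imp_step[OF x(4)] by blast
    have "h \<in> plain_graphs" "degree n j h = k" using step_plain_graphs[OF st] step_sums[OF st] x by auto
    moreover have "Poly_Mapping.keys x \<subseteq> {g, h}"
      unfolding x using keys_diff[of "Poly_Mapping.single h (1::rat)" "Poly_Mapping.single g s"]
      by (auto split: if_splits)
    ultimately show ?case
      using step.IH x Poly_Mapping.keys_add[of "qscale c x" y] keys_qscale[of c x] by blast
  qed simp
  then show ?thesis using assms(2) by blast
qed

section \<open>The differential\<close>

definition csum :: "int \<Rightarrow> int \<Rightarrow> lgraph \<Rightarrow> nat set \<Rightarrow> (lgraph \<Rightarrow>\<^sub>0 rat)" where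
  "csum n j g I = (\<Sum>i\<in>I. Poly_Mapping.single (contract g i) (contr_sign n j g i))"

abbreviation "edges_of_kind g k \<equiv> {i. contractible g i \<and> kind (edges g ! i) = k}"

definition dfull :: "int \<Rightarrow> int \<Rightarrow> lgraph \<Rightarrow> (lgraph \<Rightarrow>\<^sub>0 rat)" where
  "dfull n j g = csum n j g {i. contractible g i}"

lemma finite_contractible [simp]: "finite {i. contractible g i}" "finite {i. contractible g i \<and> P i}"
  by (rule finite_subset[of _ "{..<nedges g}"]; auto simp: contractible_def)+

lemma dfull_split: "dfull n j g = csum n j g (edges_of_kind g Solid) + csum n j g (edges_of_kind g Dashed)"
proof -
  have "{i. contractible g i} = edges_of_kind g Solid \<union> edges_of_kind g Dashed"
    using ekind.exhaust by auto
  then show ?thesis unfolding dfull_def csum_def by (simp add: sum.union_disjoint[symmetric] disjoint_iff)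
qed

lemma step_involution:
  assumes "step n j g s t f h"
  shows "fst (f (fst (f (i, True)), True)) = i"
  using step_bij(2,7)[OF assms] by (metis fst_conv)

text \<open>The terms correspond under the induced bijection of edges. The sign from
  \<open>step_contract\<close> contains the contraction sign in \<open>h\<close>, which squares to 1
  when multiplied out.\<close>

lemma dfull_step:
  assumes st: "step n j g s t f h" and g: "g \<in> plain_graphs"
  shows "dfull n j h - qscale s (dfull n j g) \<in> relations n j (degree n j g + 1)"
proof -
  let ?\<phi> = "\<lambda>i. fst (f (i, True))"
  have lg: "labeled_graph g" using g by (simp add: plain_graphs_iff)
  have "bij_betw ?\<phi> {i. contractible g i} {i. contractible h i}"
  proof (rule bij_betw_byWitness[where f' = ?\<phi>])
    show "?\<phi> ` {i. contractible g i} \<subseteq> {i. contractible h i}"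
      using step_contractible[OF st lg] by auto
    show "?\<phi> ` {i. contractible h i} \<subseteq> {i. contractible g i}"
    proof (rule image_subsetI, simp)
      fix i assume i: "contractible h i"
      then have "?\<phi> i < nedges g" using step_bij(4,6)[OF st] by (simp add: contractible_def)
      then show "contractible g (?\<phi> i)"
        using step_contractible_iff[OF st lg, of "?\<phi> i"] i step_involution[OF st] by simp
    qed
  qed (use step_involution[OF st] in auto)
  then have "dfull n j h = (\<Sum>i | contractible g i. Poly_Mapping.single (contract h (?\<phi> i)) (contr_sign n j h (?\<phi> i)))"
    unfolding dfull_def csum_def by (rule sum.reindex_bij_betw[symmetric])
  then have "dfull n j h - qscale s (dfull n j g) = (\<Sum>i | contractible g i.
      Poly_Mapping.single (contract h (?\<phi> i)) (contr_sign n j h (?\<phi> i)) -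
      Poly_Mapping.single (contract g i) (s * contr_sign n j g i))"
    unfolding dfull_def csum_def by (simp add: qfree.scale_sum_right sum_subtractf qscale_single)
  also have "\<dots> \<in> relations n j (degree n j g + 1)"
  proof (rule relations_sum)
    fix i assume "i \<in> {i. contractible g i}"
    then have i: "contractible g i" by simp
    obtain t' f' where st': "step n j (contract g i) (s * contr_sign n j g i * contr_sign n j h (?\<phi> i)) t' f' (contract h (?\<phi> i))"
      by (rule step_contract[OF st lg i])
    have l: "?\<phi> i < nedges h" using i step_bij(4,6)[OF st] by (simp add: contractible_def)
    define c where "c = contr_sign n j h (?\<phi> i)"
    have c: "c * (s * contr_sign n j g i * c) = s * contr_sign n j g i"
      using contr_sign_sq[OF l, of n j] by (simp add: c_def mult.assoc mult.commute mult.left_commute)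
    have "Poly_Mapping.single (contract h (?\<phi> i)) (contr_sign n j h (?\<phi> i)) -
      Poly_Mapping.single (contract g i) (s * contr_sign n j g i) =
      qscale c (Poly_Mapping.single (contract h (?\<phi> i)) 1 -
        Poly_Mapping.single (contract g i) (s * contr_sign n j g i * c))"
      by (simp add: qfree.scale_right_diff_distrib qscale_single c) (simp add: c_def)
    moreover have "\<dots> \<in> relations n j (degree n j g + 1)"
      using step_relations[OF st'[folded c_def] plain_graphs_contract[OF g i] degree_contract[OF lg i]]
      by (rule relations_scale)
    ultimately show "Poly_Mapping.single (contract h (?\<phi> i)) (contr_sign n j h (?\<phi> i)) -
      Poly_Mapping.single (contract g i) (s * contr_sign n j g i) \<in> relations n j (degree n j g + 1)"
      by simp
  qed
  finally show ?thesis .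
qed

text \<open>Contractions never remove obstructions: a loop edge stays a loop edge, and since black
  vertices stay black, a chord stays a chord or becomes a loop edge.\<close>

lemma contractible_contractD:
  assumes g: "g \<in> plain_graphs" and i: "contractible g i" and k: "k < nedges g" "k \<noteq> i"
    and c: "contractible (contract g i) (squeeze i k)"
  shows "contractible g k"
proof -
  have lg: "labeled_graph g" using g by (simp add: plain_graphs_iff)
  have iE: "i < nedges g" using i by (simp add: contractible_def)
  let ?e = "edges (contract g i) ! squeeze i k" and ?m = "merge (endp g i) (endq g i)"
  have e: "?e = rename_edge ?m (edges g ! k)" using edge_contract[OF iE k(1)] k by simp
  have sk: "squeeze i k < nedges (contract g i)" using c by (simp add: contractible_def)
  have nc: "\<not> is_chord (contract g i) ?e" "\<not> is_loop (contract g i) ?e"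
    using contractible_iff[OF plain_graphs_contract[OF g i] sk] c by auto
  have w: "verts (contract g i) ! ?m v = White \<Longrightarrow> verts g ! v = White" if v: "v < nverts g" for v
  proof -
    assume a: "verts (contract g i) ! ?m v = White"
    have "verts g ! endp g i = White \<Longrightarrow> verts g ! endq g i = White"
      using i sorted_white[OF lg endp_le_endq] by (simp add: contractible_def)
    then show ?thesis
      using a vert_contract[OF i v] by (auto simp: join_kind_def split: if_splits)
  qed
  have "src (edges g ! k) < nverts g" "tgt (edges g ! k) < nverts g"
    using lg k by (auto simp: labeled_graph_def)
  then have "\<not> is_chord g (edges g ! k)" "\<not> is_loop g (edges g ! k)"
    using nc w unfolding is_chord_def is_loop_def e by auto
  then show ?thesis using contractible_iff[OF g k(1)] by simp
qed

text \<open>Exchanging the entries of the pairs shows that the sum is its own negative, and the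
  coefficients are rational.\<close>

lemma antisymmetric_sum_eq_0:
  fixes F :: "'a \<times> 'a \<Rightarrow> ('b \<Rightarrow>\<^sub>0 rat)"
  assumes "\<And>a b. (a, b) \<in> P \<Longrightarrow> (b, a) \<in> P \<and> F (a, b) = - F (b, a)"
  shows "sum F P = 0"
proof -
  have "bij_betw prod.swap P P"
    by (rule bij_betw_byWitness[where f' = prod.swap]) (use assms in auto)
  then have "sum F P = (\<Sum>x\<in>P. F (prod.swap x))" by (rule sum.reindex_bij_betw[symmetric])
  also have "\<dots> = - sum F P"
    unfolding sum_negf[symmetric]
  proof (rule sum.cong[OF HOL.refl])
    fix x assume "x \<in> P"
    then show "F (prod.swap x) = - F x" using assms[of "fst x" "snd x"] by (cases x) simp
  qed
  finally have eq: "sum F P = - sum F P" .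
  show ?thesis
  proof (rule poly_mapping_eqI)
    fix a
    have "Poly_Mapping.lookup (sum F P) a = Poly_Mapping.lookup (- sum F P) a"
      by (rule arg_cong[OF eq])
    then show "Poly_Mapping.lookup (sum F P) a = Poly_Mapping.lookup 0 a" by simp
  qed
qed

text \<open>The two orders of contracting a pair of edges give the same labeled graph with opposite
  signs, so the square vanishes already before passing to the quotient.\<close>

lemma dfull_dfull:
  assumes g: "g \<in> plain_graphs"
  shows "extend_linearly (dfull n j) (dfull n j g) = 0"
proof -
  have lg: "labeled_graph g" using g by (simp add: plain_graphs_iff)
  \<comment> \<open>The second edge is named by its position in \<open>g\<close>, not in the
    contraction, so that the pairs can be exchanged.\<close>
  define K where "K i = {k. k < nedges g \<and> k \<noteq> i \<and> contractible (contract g i) (squeeze i k)}" for i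
  define P where "P = Sigma {i. contractible g i} K"
  define F where "F = (\<lambda>(i, k). Poly_Mapping.single (contract (contract g i) (squeeze i k))
      (contr_sign n j g i * contr_sign n j (contract g i) (squeeze i k)))"
  have fin: "finite (K i)" for i by (simp add: K_def)
  have "extend_linearly (dfull n j) (dfull n j g) =
    (\<Sum>i | contractible g i. qscale (contr_sign n j g i) (dfull n j (contract g i)))"
    by (simp add: dfull_def[of n j g] csum_def extend_linearly_sum extend_linearly_single)
  also have "\<dots> = (\<Sum>i | contractible g i. \<Sum>k\<in>K i. F (i, k))"
  proof (rule sum.cong[OF HOL.refl])
    fix i assume "i \<in> {i. contractible g i}"
    then have i: "contractible g i" "i < nedges g" by (auto simp: contractible_def)
    have "bij_betw (squeeze i) (K i) {k. contractible (contract g i) k}"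
    proof (rule bij_betw_byWitness[where f' = "bump i"])
      show "bump i ` {k. contractible (contract g i) k} \<subseteq> K i"
        using i(2) nedges_contract[OF i(1)] by (auto simp: K_def contractible_def[of "contract g i"])
    qed (auto simp: K_def)
    then have "dfull n j (contract g i) = (\<Sum>k\<in>K i. Poly_Mapping.single (contract (contract g i) (squeeze i k))
        (contr_sign n j (contract g i) (squeeze i k)))"
      unfolding dfull_def csum_def by (rule sum.reindex_bij_betw[symmetric])
    then show "qscale (contr_sign n j g i) (dfull n j (contract g i)) = (\<Sum>k\<in>K i. F (i, k))"
      by (simp add: qfree.scale_sum_right qscale_single F_def)
  qed
  also have "\<dots> = sum F P" unfolding P_def using fin by (simp add: sum.Sigma)
  also have "\<dots> = 0"
  proof (rule antisymmetric_sum_eq_0)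
    fix i k assume "(i, k) \<in> P"
    then have i: "contractible g i" and k: "k < nedges g" "k \<noteq> i" "contractible (contract g i) (squeeze i k)"
      by (auto simp: P_def K_def)
    have ck: "contractible g k" by (rule contractible_contractD[OF g i k])
    note cc = contract_commute[OF lg i ck k(2)[symmetric] k(3)]
    have "i < nedges g" using i by (simp add: contractible_def)
    then have "(k, i) \<in> P" using ck k(2) cc(2) by (simp add: P_def K_def)
    moreover have "F (i, k) = - F (k, i)"
      by (simp add: F_def cc(1) cc(3) single_uminus[symmetric])
    ultimately show "(k, i) \<in> P \<and> F (i, k) = - F (k, i)" by simp
  qed
  finally show ?thesis .
qed

section \<open>The homotopy\<close>

definition active :: "lgraph \<Rightarrow> (nat \<times> bool) set" where
  "active g = {x \<in> hair_ends g. \<not> isolated g (hvert g x)}"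

text \<open>The sign is that of contracting the new edge, so each contraction that undoes a pull-out
  contributes the graph with coefficient 1/N. On a hairy plain graph the sum is empty and the value
  is 0.\<close>

definition homotopy :: "int \<Rightarrow> int \<Rightarrow> lgraph \<Rightarrow> (lgraph \<Rightarrow>\<^sub>0 rat)" where
  "homotopy n j g = qscale (sgn_pow (blow_exp n j g) / of_nat (card (active g)))
     (\<Sum>x\<in>blowable g. Poly_Mapping.single (blow g x) 1)"

abbreviation "dsolid n j g \<equiv> csum n j g (edges_of_kind g Solid)"
abbreviation "ddashed n j g \<equiv> csum n j g (edges_of_kind g Dashed)"

lemma finite_hair_ends [simp]: "finite (hair_ends g)" "finite (blowable g)" "finite (active g)"
proof -
  show "finite (hair_ends g)"
    by (rule finite_subset[of _ "{..<nedges g} \<times> UNIV"]) (auto simp: hair_ends_def)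
  then show "finite (blowable g)" "finite (active g)" by (auto simp: blowable_def active_def)
qed

lemma step_hair_ends_iff:
  assumes st: "step n j g s t f h" and g: "labeled_graph g"
  shows "f x \<in> hair_ends h \<longleftrightarrow> x \<in> hair_ends g"
proof (cases "fst x < nedges g")
  case True
  then show ?thesis
    using step_bij(4,6)[OF st] step_transport(2,3)[OF st True] step_transport(1)[OF st hvert_less[OF g True]]
    by (simp add: hair_ends_def)
next
  case False
  then show ?thesis using step_bij(4,6)[OF st] by (simp add: hair_ends_def)
qed

lemma step_bij_betw:
  assumes st: "step n j g s t f h" and g: "labeled_graph g"
  shows "bij_betw f (blowable g) (blowable h)" "bij_betw f (active g) (active h)"
proof -
  have *: "bij_betw f A B" if "\<And>x. f x \<in> B \<longleftrightarrow> x \<in> A" for A B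
    using that step_bij(2)[OF st] by (intro bij_betw_byWitness[where f' = f]) (auto, metis)
  have val: "valence h k (hvert h (f x)) = valence g k (hvert g x)" if "x \<in> hair_ends g" for x k
    using step_valence_hvert(2)[OF st] that by (simp add: hair_ends_def)
  show "bij_betw f (blowable g) (blowable h)" "bij_betw f (active g) (active h)"
    by (rule *; use step_hair_ends_iff[OF st g] val in \<open>auto simp: blowable_def active_def isolated_def\<close>)+
qed

text \<open>The scalar is invariant under relabelings, and the summands correspond under
  \<open>f\<close>, so \<open>step_blow\<close> settles each of them.\<close>

lemma homotopy_step:
  assumes st: "step n j g s t f h" and g: "g \<in> plain_graphs"
  shows "homotopy n j h - qscale s (homotopy n j g) \<in> relations n j (degree n j g - 1)"
proof -
  have lg: "labeled_graph g" using g by (simp add: plain_graphs_iff)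
  note b = step_bij_betw[OF st lg]
  have "(\<Sum>x\<in>blowable h. Poly_Mapping.single (blow h x) (1::rat)) = (\<Sum>x\<in>blowable g. Poly_Mapping.single (blow h (f x)) 1)"
    by (rule sum.reindex_bij_betw[OF b(1), symmetric])
  then have "homotopy n j h - qscale s (homotopy n j g) =
    qscale (sgn_pow (blow_exp n j g) / of_nat (card (active g)))
     (\<Sum>x\<in>blowable g. Poly_Mapping.single (blow h (f x)) 1 - Poly_Mapping.single (blow g x) s)"
    unfolding homotopy_def step_blow_exp[OF st] bij_betw_same_card[OF b(2)]
    by (simp add: qfree.scale_sum_right sum_subtractf qfree.scale_right_diff_distrib qscale_single mult.commute)
  also have "\<dots> \<in> relations n j (degree n j g - 1)"
  proof (intro relations_scale relations_sum)
    fix x assume x: "x \<in> blowable g"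
    then have hx: "x \<in> hair_ends g" by (simp add: blowable_def)
    obtain t' f' where "step n j (blow g x) s t' f' (blow h (f x))" using step_blow[OF st lg hx] by blast
    then show "Poly_Mapping.single (blow h (f x)) 1 - Poly_Mapping.single (blow g x) s \<in> relations n j (degree n j g - 1)"
      by (rule step_relations[OF _ blow_plain_graphs(1)[OF g x] degree_blow[OF lg hx]])
  qed
  finally show ?thesis .
qed

lemma solid_contractible_blow:
  assumes g: "g \<in> plain_graphs" and x: "x \<in> blowable g"
  shows "edges_of_kind (blow g x) Solid = insert 0 (Suc ` edges_of_kind g Solid)"
proof -
  have hx: "x \<in> hair_ends g" and lg: "labeled_graph g" using g x by (auto simp: blowable_def plain_graphs_iff)
  have "contractible (blow g x) (Suc i) \<longleftrightarrow> contractible g i"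
    if i: "i < nedges g" "kind (edges g ! i) = Solid" for i
  proof -
    have ix: "i \<noteq> fst x" using i hx by (auto simp: hair_ends_def)
    have si: "Suc i < nedges (blow g x)" using i by simp
    show ?thesis
      unfolding contractible_iff[OF g i(1)] contractible_iff[OF blow_plain_graphs(1)[OF g x] si]
      using i ix by (simp add: is_chord_def is_loop_def edge_blow_Suc)
  qed
  then have "Suc i \<in> edges_of_kind (blow g x) Solid \<longleftrightarrow> i \<in> edges_of_kind g Solid" for i
    by (cases "i < nedges g") (auto simp: contractible_def[of "blow g x"] contractible_def[of g])
  moreover have "0 \<in> edges_of_kind (blow g x) Solid" using contractible_blow_0[OF lg hx] by simp
  ultimately have "k \<in> edges_of_kind (blow g x) Solid \<longleftrightarrow> k \<in> insert 0 (Suc ` edges_of_kind g Solid)" for k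
    by (cases k) auto
  then show ?thesis by blast
qed

text \<open>If an active half-edge cannot be pulled out, its vertex has exactly one dashed and one
  solid half-edge. The solid edge is not a loop edge, which would contribute two halves, so it can
  be contracted, and it is determined by the vertex.\<close>

lemma active_decomposition:
  assumes g: "g \<in> plain_graphs"
  shows "card (active g) = card (blowable g) + (\<Sum>i\<in>edges_of_kind g Solid. card {x. antenna g x i})"
proof -
  let ?I = "edges_of_kind g Solid" and ?A = "\<lambda>i. {x. antenna g x i}"
  have fin: "finite (?A i)" for i
    by (rule finite_subset[OF _ finite_hair_ends(1)[of g]]) (auto simp: antenna_def)
  have half: "\<exists>b. (i, b) \<in> halves g Solid (hvert g x)" if "antenna g x i" for x i
  proof -
    obtain b where "hvert g (i, b) = endp g i" "hvert g (i, \<not> b) = endq g i" by (rule obtain_hvert_endp)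
    then show ?thesis using that by (auto simp: antenna_def contractible_def halves_def)
  qed
  have unique: "i = k" if a: "antenna g x i" "antenna g x k" for x i k
  proof -
    obtain b c where "(i, b) \<in> halves g Solid (hvert g x)" "(k, c) \<in> halves g Solid (hvert g x)"
      using half a by blast
    then show ?thesis using unique_half[of g Solid "hvert g x"] a(1) by (auto simp: antenna_def)
  qed
  have "blowable g \<inter> (\<Union>i\<in>?I. ?A i) = {}" by (auto simp: blowable_def antenna_def)
  moreover have "active g = blowable g \<union> (\<Union>i\<in>?I. ?A i)"
  proof
    show "blowable g \<union> (\<Union>i\<in>?I. ?A i) \<subseteq> active g"
      by (auto simp: active_def isolated_def blowable_def antenna_def)
    show "active g \<subseteq> blowable g \<union> (\<Union>i\<in>?I. ?A i)"
    proof
      fix x assume x: "x \<in> active g"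
      then have hx: "x \<in> hair_ends g" "fst x < nedges g" by (auto simp: active_def hair_ends_def)
      show "x \<in> blowable g \<union> (\<Union>i\<in>?I. ?A i)"
      proof (cases "x \<in> blowable g")
        case False
        let ?v = "hvert g x"
        have "good_vertex g ?v" using g hvert_less[OF _ hx(2)] by (simp add: plain_graphs_iff)
        then have "valence g Dashed ?v \<ge> 1" using hx by (simp add: good_vertex_def hair_ends_def)
        then have v: "valence g Dashed ?v = 1" "valence g Solid ?v = 1"
          using False hx x by (auto simp: blowable_def active_def isolated_def)
        then obtain y where y: "halves g Solid ?v = {y}" by (auto simp: valence_card card_1_singleton_iff)
        obtain i b where i: "y = (i, b)" by fastforce
        have ib: "i < nedges g" "kind (edges g ! i) = Solid" "hvert g (i, b) = ?v"
          using y[THEN equalityD2] i by (simp_all add: halves_def)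
        have "(i, \<not> b) \<notin> halves g Solid ?v" using y i by auto
        then have "hvert g (i, \<not> b) \<noteq> ?v" using ib by (simp add: halves_def)
        then have "\<not> is_loop g (edges g ! i)" using ib(3) by (auto simp: is_loop_def hvert_def split: if_splits)
        then have "contractible g i" using contractible_iff[OF g ib(1)] ib(2) by (simp add: is_chord_def)
        moreover have "?v = endp g i \<or> ?v = endq g i" using hvert_self(1)[of g i b] ib(3) by auto
        ultimately have "antenna g x i" using v hx ib by (simp add: antenna_def)
        then show ?thesis by (auto simp: antenna_def)
      qed simp
    qed
  qed
  ultimately have "card (active g) = card (blowable g) + card (\<Union>i\<in>?I. ?A i)"
    using fin by (simp add: card_Un_disjoint)
  also have "card (\<Union>i\<in>?I. ?A i) = (\<Sum>i\<in>?I. card (?A i))"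
    using fin unique by (intro card_UN_disjoint) auto
  finally show ?thesis .
qed

lemma (in solid_contraction) image: "apfst (squeeze i) ` hair_ends g = hair_ends (contract g i)"
  using hair_ends_contract by (simp add: bij_betw_def)

text \<open>An end of \<open>i\<close> has a solid half-edge. If \<open>x\<close> sits there and
  cannot be pulled out, its vertex has exactly one half-edge of each kind, and \<open>x\<close> is
  an antenna of \<open>i\<close>; the contraction makes it possible to pull it out.\<close>

lemma (in solid_contraction) blowable_contract:
  "bij_betw (apfst (squeeze i)) (blowable g \<union> {x. antenna g x i}) (blowable (contract g i))"
proof -
  have "x \<in> blowable g \<union> {x. antenna g x i} \<longleftrightarrow> apfst (squeeze i) x \<in> blowable (contract g i)"
    if x: "x \<in> hair_ends g" for x
  proof -
    have "x \<in> blowable g \<or> antenna g x i" if e: "hvert g x = endp g i \<or> hvert g x = endq g i"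
    proof -
      have "verts g ! hvert g x = External" using x by (simp add: hair_ends_def)
      then have "valence g Dashed (hvert g x) \<ge> 1" "valence g Solid (hvert g x) \<ge> 1"
        using good_ends solid_valence_ends e by (auto simp: good_vertex_def)
      then show ?thesis using x i solid e by (auto simp: blowable_def antenna_def)
    qed
    then show ?thesis
      using blowable_contract_iff[OF x] by (auto simp: antenna_def)
  qed
  note iff = this
  have sub: "blowable g \<union> {x. antenna g x i} \<subseteq> hair_ends g" by (auto simp: blowable_def antenna_def)
  have "apfst (squeeze i) ` (blowable g \<union> {x. antenna g x i}) = blowable (contract g i)"
  proof (intro equalityI image_subsetI subsetI)
    fix y assume y: "y \<in> blowable (contract g i)"
    then have "y \<in> apfst (squeeze i) ` hair_ends g" unfolding image by (simp add: blowable_def)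
    then obtain x where "x \<in> hair_ends g" "y = apfst (squeeze i) x" by blast
    then show "y \<in> apfst (squeeze i) ` (blowable g \<union> {x. antenna g x i})" using iff y by blast
  qed (use iff sub in blast)
  then show ?thesis
    using hair_ends_contract sub by (auto simp: bij_betw_def intro: inj_on_subset)
qed

text \<open>The half-edges at the ends of \<open>i\<close> are active because of \<open>i\<close>
  itself, and after the contraction because they can be pulled out; other vertices keep their
  valences. So the same denominator occurs on both sides of the homotopy formula.\<close>

lemma (in solid_contraction) card_active_contract: "card (active (contract g i)) = card (active g)"
proof -
  have iff: "apfst (squeeze i) x \<in> active (contract g i) \<longleftrightarrow> x \<in> active g" if x: "x \<in> hair_ends g" for x
  proof -
    have x': "fst x < nedges g" "fst x \<noteq> i" using x hair_end_neq by (auto simp: hair_ends_def)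
    have h: "apfst (squeeze i) x \<in> hair_ends (contract g i)"
      using hair_ends_contract x by (auto simp: bij_betw_def)
    show ?thesis
    proof (cases "hvert g x = endp g i \<or> hvert g x = endq g i")
      case True
      then have "apfst (squeeze i) x \<in> blowable (contract g i)" using blowable_contract_iff[OF x] by simp
      moreover have "valence g Solid (hvert g x) \<noteq> 0" using True solid_valence_ends by auto
      ultimately show ?thesis using x h by (auto simp: active_def blowable_def isolated_def)
    next
      case False
      then show ?thesis using x h valence_contract_other[OF i, of "hvert g x"]
        by (simp add: active_def isolated_def hvert'[OF x'])
    qed
  qed
  have "apfst (squeeze i) ` active g = active (contract g i)"
  proof (intro equalityI image_subsetI subsetI)
    fix y assume y: "y \<in> active (contract g i)"
    then have "y \<in> apfst (squeeze i) ` hair_ends g" unfolding image by (simp add: active_def)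
    then obtain x where "x \<in> hair_ends g" "y = apfst (squeeze i) x" by blast
    then show "y \<in> apfst (squeeze i) ` active g" using iff y by blast
  qed (use iff in \<open>auto simp: active_def\<close>)
  moreover have "inj_on (apfst (squeeze i)) (active g)"
    using hair_ends_contract by (auto simp: bij_betw_def active_def intro: inj_on_subset)
  ultimately show ?thesis by (metis card_image)
qed

text \<open>The anticommutation of contractions, applied to the edges 0 and \<open>Suc i\<close> of
  the pull-out.\<close>

lemma (in solid_contraction) blow_signs:
  assumes x: "x \<in> hair_ends g"
  shows "contr_sign n j g i * sgn_pow (blow_exp n j (contract g i)) =
    - (sgn_pow (blow_exp n j g) * contr_sign n j (blow g x) (Suc i))"
proof -
  let ?b = "blow g x"
  have lb: "labeled_graph ?b" by (rule labeled_graph_blow[OF lg x])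
  have c0: "contractible ?b 0" by (rule contractible_blow_0[OF lg x])
  note cb = blow_contract[OF x]
  have b0: "contract ?b 0 = g" by (rule contract_blow_0[OF lg x])
  have sq: "squeeze 0 (Suc i) = i" "squeeze (Suc i) 0 = 0" by (simp_all add: squeeze_def)
  have "contractible (contract ?b 0) (squeeze 0 (Suc i))" unfolding b0 sq by (rule i)
  note cc = contract_commute(3)[OF lb c0 cb(2) _ this, of n j, unfolded b0 sq cb(1)]
  have xc: "apfst (squeeze i) x \<in> hair_ends (contract g i)"
    using hair_ends_contract x by (auto simp: bij_betw_def)
  have lc: "labeled_graph (contract g i)" using plain_graphs_contract[OF g i] by (simp add: plain_graphs_iff)
  have "sgn_pow (blow_exp n j g) * contr_sign n j g i =
      - (contr_sign n j ?b (Suc i) * sgn_pow (blow_exp n j (contract g i)))"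
    using cc contr_sign_blow_0[OF lg x, of n j] contr_sign_blow_0[OF lc xc, of n j] by simp
  moreover have "i < nedges g" "Suc i < nedges ?b" using ends by simp_all
  ultimately show ?thesis by (simp add: contr_sign_exp sgn_pow_parity split: if_splits)
qed

text \<open>Let \<open>T i x\<close> be the term that contracts \<open>i\<close> and pulls out
  \<open>x\<close>. Pulling out first gives \<open>g\<close> once for each blowable
  \<open>x\<close>, minus all \<open>T i x\<close> with \<open>x\<close> blowable. Contracting first
  gives these \<open>T i x\<close> with plus, and further those of the antennas. The former cancel,
  each of the latter is \<open>g\<close> up to relations, and by \<open>active_decomposition\<close>
  the graph is counted N times.\<close>

lemma homotopy_identity:
  assumes g: "g \<in> plain_graphs" and h: "\<not> hairy g"
  shows "extend_linearly (dsolid n j) (homotopy n j g) + extend_linearly (homotopy n j) (dsolid n j g)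
    - Poly_Mapping.single g 1 \<in> relations n j (degree n j g)"
proof -
  let ?I = "edges_of_kind g Solid" and ?A = "\<lambda>i. {x. antenna g x i}" and ?B = "blowable g"
  have lg: "labeled_graph g" using g by (simp add: plain_graphs_iff)
  define N where "N = (of_nat (card (active g)) :: rat)"
  define C where "C = sgn_pow (blow_exp n j g)"
  define s where "s i = contr_sign n j g i * sgn_pow (blow_exp n j (contract g i))" for i
  define T where "T i x = Poly_Mapping.single (blow (contract g i) (apfst (squeeze i) x)) (s i)" for i x
  define G where "G = Poly_Mapping.single g (1::rat)"
  have finA: "finite (?A i)" for i
    by (rule finite_subset[OF _ finite_hair_ends(1)[of g]]) (auto simp: antenna_def)
  have N0: "N \<noteq> 0"
  proof -
    obtain v where v: "v < nverts g" "verts g ! v = External" "\<not> isolated g v"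
      using h hairy_iff_isolated[OF g] by blast
    then have "good_vertex g v" using g by (simp add: plain_graphs_iff)
    then have "valence g Dashed v \<noteq> 0" using v by (simp add: good_vertex_def)
    then have "halves g Dashed v \<noteq> {}" by (auto simp: valence_card)
    then obtain x where "x \<in> halves g Dashed v" by blast
    then have "x \<in> active g" using v by (auto simp: active_def hair_ends_def halves_def)
    then have "card (active g) \<noteq> 0" by auto
    then show ?thesis by (simp add: N_def)
  qed
  have sc: "solid_contraction g i" if "i \<in> ?I" for i
    using g that by unfold_locales auto
  have CC: "C * C = 1" by (simp add: C_def)
  \<comment> \<open>The new edge returns \<open>g\<close> with sign \<open>C\<close>. Each other
    solid edge commutes with pulling out at the cost of one sign.\<close>
  have "dsolid n j (blow g x) = qscale C (G - (\<Sum>i\<in>?I. T i x))" if x: "x \<in> ?B" for x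
  proof -
    have hx: "x \<in> hair_ends g" using x by (simp add: blowable_def)
    have "dsolid n j (blow g x) = Poly_Mapping.single g C +
      (\<Sum>i\<in>?I. Poly_Mapping.single (contract (blow g x) (Suc i)) (contr_sign n j (blow g x) (Suc i)))"
      unfolding solid_contractible_blow[OF g x] csum_def
      by (simp add: sum.reindex contract_blow_0[OF lg hx] contr_sign_blow_0[OF lg hx] C_def)
    also have "(\<Sum>i\<in>?I. Poly_Mapping.single (contract (blow g x) (Suc i)) (contr_sign n j (blow g x) (Suc i))) =
      (\<Sum>i\<in>?I. qscale (- C) (T i x))"
    proof (rule sum.cong[OF HOL.refl])
      fix i assume i: "i \<in> ?I"
      interpret solid_contraction g i by (rule sc[OF i])
      have "- C * s i = contr_sign n j (blow g x) (Suc i)"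
        unfolding s_def blow_signs[OF hx] using CC by (simp add: C_def)
      then show "Poly_Mapping.single (contract (blow g x) (Suc i)) (contr_sign n j (blow g x) (Suc i)) = qscale (- C) (T i x)"
        unfolding T_def qscale_single blow_contract(1)[OF hx] by simp
    qed
    finally show ?thesis
      by (simp add: G_def qfree.scale_right_diff_distrib qscale_single qfree.scale_sum_right[symmetric] sum_negf)
  qed
  then have "extend_linearly (dsolid n j) (homotopy n j g) =
      qscale (C / N) (\<Sum>x\<in>?B. qscale C (G - (\<Sum>i\<in>?I. T i x)))"
    by (simp add: homotopy_def extend_linearly_scale extend_linearly_sum extend_linearly_single C_def N_def)
  also have "\<dots> = qscale (1 / N) (\<Sum>x\<in>?B. G - (\<Sum>i\<in>?I. T i x))"
    using CC by (simp add: qfree.scale_sum_right[symmetric] mult.commute)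
  finally have 1: "extend_linearly (dsolid n j) (homotopy n j g) =
      qscale (1 / N) ((\<Sum>x\<in>?B. G) - (\<Sum>i\<in>?I. \<Sum>x\<in>?B. T i x))"
    by (simp add: sum_subtractf sum.swap[of _ ?I ?B])
  have "extend_linearly (homotopy n j) (dsolid n j g) = (\<Sum>i\<in>?I. qscale (contr_sign n j g i) (homotopy n j (contract g i)))"
    by (simp add: csum_def extend_linearly_sum extend_linearly_single)
  also have "\<dots> = (\<Sum>i\<in>?I. qscale (1 / N) ((\<Sum>x\<in>?B. T i x) + (\<Sum>x\<in>?A i. T i x)))"
  proof (rule sum.cong[OF HOL.refl])
    fix i assume i: "i \<in> ?I"
    interpret solid_contraction g i by (rule sc[OF i])
    have "?B \<inter> ?A i = {}" by (auto simp: blowable_def antenna_def)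
    then have "(\<Sum>x\<in>?B. T i x) + (\<Sum>x\<in>?A i. T i x) = (\<Sum>x\<in>?B \<union> ?A i. T i x)"
      using finA by (simp add: sum.union_disjoint)
    also have "\<dots> = (\<Sum>y\<in>blowable (contract g i). Poly_Mapping.single (blow (contract g i) y) (s i))"
      unfolding T_def by (rule sum.reindex_bij_betw[OF blowable_contract])
    finally show "qscale (contr_sign n j g i) (homotopy n j (contract g i)) =
        qscale (1 / N) ((\<Sum>x\<in>?B. T i x) + (\<Sum>x\<in>?A i. T i x))"
      by (simp add: homotopy_def card_active_contract N_def s_def qfree.scale_sum_right qscale_single)
  qed
  finally have 2: "extend_linearly (homotopy n j) (dsolid n j g) =
      qscale (1 / N) ((\<Sum>i\<in>?I. \<Sum>x\<in>?B. T i x) + (\<Sum>i\<in>?I. \<Sum>x\<in>?A i. T i x))"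
    by (simp add: qfree.scale_sum_right sum.distrib qfree.scale_right_distrib)
  have count: "qscale N G = (\<Sum>x\<in>?B. G) + (\<Sum>i\<in>?I. \<Sum>x\<in>?A i. G)"
  proof -
    have c: "(\<Sum>x\<in>A. G) = qscale (of_nat (card A)) G" for A :: "(nat \<times> bool) set"
      by (simp add: G_def qscale_single sum_constant poly_mapping_eqI lookup_sum)
        (rule poly_mapping_eqI, simp add: lookup_sum lookup_single when_def)
    show ?thesis
      unfolding c N_def active_decomposition[OF g]
      by (simp add: qfree.scale_left_distrib qfree.scale_sum_left)
  qed
  have "G = qscale (1 / N) (qscale N G)" using N0 by simp
  then have 3: "G = qscale (1 / N) ((\<Sum>x\<in>?B. G) + (\<Sum>i\<in>?I. \<Sum>x\<in>?A i. G))" unfolding count .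
  have "extend_linearly (dsolid n j) (homotopy n j g) + extend_linearly (homotopy n j) (dsolid n j g) - G =
    qscale (1 / N) (\<Sum>i\<in>?I. \<Sum>x\<in>?A i. T i x - G)"
    unfolding 1 2 by (subst 3) (simp add: qfree.scale_right_distrib[symmetric] qfree.scale_right_diff_distrib[symmetric] sum_subtractf)
  also have "\<dots> \<in> relations n j (degree n j g)"
  proof (intro relations_scale relations_sum)
    fix i x assume "x \<in> ?A i"
    then show "T i x - G \<in> relations n j (degree n j g)"
      using antenna_rel[OF g, of x i n j] by (simp add: antenna_rel_def T_def G_def s_def)
  qed
  finally show ?thesis by (simp add: G_def)
qed

section \<open>Acyclicity of the non-hairy part\<close>

definition nwhite :: "lgraph \<Rightarrow> nat" where
  "nwhite g = nverts g - nblack g"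

definition plain_chains :: "int \<Rightarrow> int \<Rightarrow> int \<Rightarrow> (lgraph \<Rightarrow>\<^sub>0 rat) set" where
  "plain_chains n j k = {x. Poly_Mapping.keys x \<subseteq> {g \<in> plain_graphs. degree n j g = k}}"

definition nonhairy_chains :: "int \<Rightarrow> int \<Rightarrow> int \<Rightarrow> (lgraph \<Rightarrow>\<^sub>0 rat) set" where
  "nonhairy_chains n j k = {x. Poly_Mapping.keys x \<subseteq> {g \<in> plain_graphs. \<not> hairy g \<and> degree n j g = k}}"

lemma nonhairy_chains_subset: "nonhairy_chains n j k \<subseteq> plain_chains n j k"
  by (auto simp: nonhairy_chains_def plain_chains_def)

lemma nonhairy_chains_add:
  "x \<in> nonhairy_chains n j k \<Longrightarrow> y \<in> nonhairy_chains n j k \<Longrightarrow> x + y \<in> nonhairy_chains n j k"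
  using Poly_Mapping.keys_add[of x y] by (auto simp: nonhairy_chains_def)

lemma keys_csum:
  "finite I \<Longrightarrow> Poly_Mapping.keys (csum n j g I) \<subseteq> contract g ` I"
proof (induction I rule: finite_induct)
  case (insert i I)
  then show ?case
    using Poly_Mapping.keys_add[of "Poly_Mapping.single (contract g i) (contr_sign n j g i)" "csum n j g I"]
    by (auto simp: csum_def split: if_splits)
qed (simp add: csum_def)

lemma keys_dfull:
  assumes g: "g \<in> plain_graphs" and h: "h \<in> Poly_Mapping.keys (dfull n j g)"
  shows "h \<in> plain_graphs" "degree n j h = degree n j g + 1" "\<not> hairy g \<Longrightarrow> \<not> hairy h"
proof -
  obtain i where i: "contractible g i" "h = contract g i"
    using h keys_csum[of "{i. contractible g i}" n j g] by (auto simp: dfull_def)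
  then show "h \<in> plain_graphs" "degree n j h = degree n j g + 1" "\<not> hairy g \<Longrightarrow> \<not> hairy h"
    using g plain_graphs_contract[OF g i(1)] degree_contract[OF _ i(1)] hairy_contract_iff[OF g i(1)]
    by (auto simp: plain_graphs_iff)
qed

lemma keys_ddashed:
  assumes g: "g \<in> plain_graphs" and h: "h \<in> Poly_Mapping.keys (ddashed n j g)"
  shows "h \<in> plain_graphs" "degree n j h = degree n j g + 1" "\<not> hairy g \<Longrightarrow> \<not> hairy h" "nwhite h < nwhite g"
proof -
  obtain i where i: "contractible g i" "kind (edges g ! i) = Dashed" "h = contract g i"
    using h keys_csum[of "edges_of_kind g Dashed" n j g] by auto
  have lg: "labeled_graph g" using g by (simp add: plain_graphs_iff)
  show "h \<in> plain_graphs" "degree n j h = degree n j g + 1" "\<not> hairy g \<Longrightarrow> \<not> hairy h"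
    using i plain_graphs_contract[OF g i(1)] degree_contract[OF lg i(1)] hairy_contract_iff[OF g i(1)]
    by auto
  have "nblack g \<le> endq g i" "endq g i < nverts g"
    using i white_iff[OF lg, of "endq g i"] by (auto simp: contractible_def)
  then show "nwhite h < nwhite g"
    using nblack_contract[OF lg i(1)] nverts_contract[OF i(1)] i by (simp add: nwhite_def)
qed

lemma keys_homotopy:
  assumes g: "g \<in> plain_graphs" and h: "h \<in> Poly_Mapping.keys (homotopy n j g)"
  shows "h \<in> plain_graphs" "degree n j h = degree n j g - 1" "\<not> hairy h" "nwhite h = nwhite g"
proof -
  have lg: "labeled_graph g" using g by (simp add: plain_graphs_iff)
  have "Poly_Mapping.keys (\<Sum>x\<in>A. Poly_Mapping.single (blow g x) (1::rat)) \<subseteq> blow g ` A" if "finite A" for A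
    using that
  proof induction
    case (insert x A)
    then show ?case
      using Poly_Mapping.keys_add[of "Poly_Mapping.single (blow g x) (1::rat)" "\<Sum>x\<in>A. Poly_Mapping.single (blow g x) 1"]
      by auto
  qed simp
  from this[of "blowable g"] obtain x where x: "x \<in> blowable g" "h = blow g x"
    using h keys_qscale unfolding homotopy_def by fastforce
  have hx: "x \<in> hair_ends g" using x by (simp add: blowable_def)
  show "h \<in> plain_graphs" "degree n j h = degree n j g - 1" "\<not> hairy h"
    using x blow_plain_graphs[OF g x(1)] degree_blow[OF lg hx] by auto
  have "nblack (blow g x) = Suc (nblack g)"
    using nblack_contract[OF labeled_graph_blow[OF lg hx] contractible_blow_0[OF lg hx]]
    by (simp add: contract_blow_0[OF lg hx])
  then show "nwhite h = nwhite g" using x by (simp add: nwhite_def)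
qed

lemma keys_extend_linearlyE:
  assumes "h \<in> Poly_Mapping.keys (extend_linearly f x)"
  obtains a where "a \<in> Poly_Mapping.keys x" "h \<in> Poly_Mapping.keys (f a)"
  using assms keys_extend_linearly[of f x] by blast

lemma dfull_chains: "x \<in> plain_chains n j k \<Longrightarrow> extend_linearly (dfull n j) x \<in> plain_chains n j (k + 1)"
proof (unfold plain_chains_def, safe)
  assume x: "Poly_Mapping.keys x \<subseteq> {g \<in> plain_graphs. degree n j g = k}"
  fix h assume "h \<in> Poly_Mapping.keys (extend_linearly (dfull n j) x)"
  then obtain a where "a \<in> Poly_Mapping.keys x" "h \<in> Poly_Mapping.keys (dfull n j a)"
    by (rule keys_extend_linearlyE)
  then show "h \<in> plain_graphs" "degree n j h = k + 1" using x keys_dfull(1,2)[of a h n j] by auto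
qed

lemma dfull_relations: "r \<in> relations n j k \<Longrightarrow> extend_linearly (dfull n j) r \<in> relations n j (k + 1)"
  by (rule extend_linearly_on_relations) (use dfull_step in auto)

lemma homotopy_relations: "r \<in> relations n j k \<Longrightarrow> extend_linearly (homotopy n j) r \<in> relations n j (k - 1)"
  by (rule extend_linearly_on_relations) (use homotopy_step in auto)

lemma dfull_dfull_chain:
  "x \<in> plain_chains n j k \<Longrightarrow> extend_linearly (dfull n j) (extend_linearly (dfull n j) x) = 0"
proof -
  assume "x \<in> plain_chains n j k"
  then have "extend_linearly (\<lambda>a. extend_linearly (dfull n j) (dfull n j a)) x = extend_linearly (\<lambda>a. 0) x"
    by (intro extend_linearly_cong dfull_dfull) (auto simp: plain_chains_def)
  then show ?thesis by (simp add: extend_linearly_comp extend_linearly_def[of "\<lambda>a. 0"])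
qed

text \<open>What the dashed part adds to the homotopy formula. Pulling out preserves the number of
  white vertices and dashed contractions lower it.\<close>

definition correction :: "int \<Rightarrow> int \<Rightarrow> lgraph \<Rightarrow> (lgraph \<Rightarrow>\<^sub>0 rat)" where
  "correction n j g = extend_linearly (ddashed n j) (homotopy n j g) + extend_linearly (homotopy n j) (ddashed n j g)"

lemma keys_correction:
  assumes g: "g \<in> plain_graphs" "\<not> hairy g" and h: "h \<in> Poly_Mapping.keys (correction n j g)"
  shows "h \<in> plain_graphs" "degree n j h = degree n j g" "\<not> hairy h" "nwhite h < nwhite g"
proof -
  have "h \<in> Poly_Mapping.keys (extend_linearly (ddashed n j) (homotopy n j g)) \<union>
    Poly_Mapping.keys (extend_linearly (homotopy n j) (ddashed n j g))"
    using h unfolding correction_def by (rule subsetD[OF Poly_Mapping.keys_add])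
  then have "h \<in> Poly_Mapping.keys (extend_linearly (ddashed n j) (homotopy n j g)) \<or>
    h \<in> Poly_Mapping.keys (extend_linearly (homotopy n j) (ddashed n j g))" by blast
  then have "h \<in> plain_graphs \<and> degree n j h = degree n j g \<and> \<not> hairy h \<and> nwhite h < nwhite g"
  proof
    assume "h \<in> Poly_Mapping.keys (extend_linearly (ddashed n j) (homotopy n j g))"
    then obtain a where "a \<in> Poly_Mapping.keys (homotopy n j g)" "h \<in> Poly_Mapping.keys (ddashed n j a)"
      by (rule keys_extend_linearlyE)
    then show ?thesis using keys_homotopy[OF g(1), of a n j] keys_ddashed[of a h n j] by auto
  next
    assume "h \<in> Poly_Mapping.keys (extend_linearly (homotopy n j) (ddashed n j g))"
    then obtain a where "a \<in> Poly_Mapping.keys (ddashed n j g)" "h \<in> Poly_Mapping.keys (homotopy n j a)"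
      by (rule keys_extend_linearlyE)
    then show ?thesis using keys_ddashed[OF g(1), of a n j] keys_homotopy[of a h n j] by auto
  qed
  then show "h \<in> plain_graphs" "degree n j h = degree n j g" "\<not> hairy h" "nwhite h < nwhite g" by auto
qed

lemma homotopy_correction:
  assumes g: "g \<in> plain_graphs" "\<not> hairy g"
  shows "extend_linearly (dfull n j) (homotopy n j g) + extend_linearly (homotopy n j) (dfull n j g)
    - Poly_Mapping.single g 1 - correction n j g \<in> relations n j (degree n j g)"
  using homotopy_identity[OF g, of n j]
  by (simp add: correction_def dfull_split[abs_def] extend_linearly_fun_add extend_linearly_add algebra_simps)

lemma homotopy_correction_chain:
  assumes z: "z \<in> nonhairy_chains n j k"
  shows "extend_linearly (dfull n j) (extend_linearly (homotopy n j) z) +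
    extend_linearly (homotopy n j) (extend_linearly (dfull n j) z) - z -
    extend_linearly (correction n j) z \<in> relations n j k"
proof -
  let ?f = "\<lambda>g. extend_linearly (dfull n j) (homotopy n j g) + extend_linearly (homotopy n j) (dfull n j g)
    - Poly_Mapping.single g 1 - correction n j g"
  have "extend_linearly ?f z \<in> relations n j k"
    using z homotopy_correction unfolding nonhairy_chains_def by (intro extend_linearly_relations) fastforce
  moreover have "extend_linearly (\<lambda>a. f a - g a) z = extend_linearly f z - extend_linearly g z"
    for f g :: "lgraph \<Rightarrow> (lgraph \<Rightarrow>\<^sub>0 rat)"
    using extend_linearly_fun_add[of "\<lambda>a. f a - g a" g z] by (simp add: algebra_simps)
  ultimately show ?thesis
    by (simp add: extend_linearly_comp extend_linearly_fun_add extend_linearly_id)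
qed

text \<open>The homotopy inverts the differential up to a correction that lowers the number of white
  vertices, hence is nilpotent.\<close>

lemma nonhairy_exact:
  assumes "z \<in> nonhairy_chains n j k"
    and "extend_linearly (dfull n j) z \<in> relations n j (k + 1)"
  shows "\<exists>y \<in> nonhairy_chains n j (k - 1). z - extend_linearly (dfull n j) y \<in> relations n j k"
proof -
  let ?d = "extend_linearly (dfull n j)" and ?h = "extend_linearly (homotopy n j)"
  have "\<exists>w. \<forall>g \<in> Poly_Mapping.keys z. nwhite g < w"
    by (metis finite_keys finite_imageI finite_nat_set_iff_bounded imageI)
  then obtain w where "\<forall>g \<in> Poly_Mapping.keys z. nwhite g < w" ..
  with assms show ?thesis
  \<comment> \<open>\<open>w\<close> is a strict bound for the numbers of white vertices of the
    finitely many graphs in \<open>z\<close>; for \<open>w = 0\<close> there are none.\<close>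
  proof (induction w arbitrary: z)
    case 0
    then have "Poly_Mapping.keys z = {}" by auto
    then have "z = 0" by simp
    then show ?case by (intro bexI[of _ 0]) (simp_all add: nonhairy_chains_def relations_zero)
  next
    case (Suc w)
    \<comment> \<open>Modulo relations, \<open>z\<close> is \<open>?d (?h z)\<close> plus
      \<open>u\<close>, because \<open>?h (?d z)\<close> is a relation. The remainder
      \<open>u\<close> is again closed up to relations and has a smaller bound, so by induction it
      is exact.\<close>
    define u where "u = - extend_linearly (correction n j) z"
    define r where "r = ?d (?h z) + ?h (?d z) - z + u"
    have r: "r \<in> relations n j k"
      using homotopy_correction_chain[OF Suc.prems(1)] by (simp add: r_def u_def)
    have hz: "?h z \<in> nonhairy_chains n j (k - 1)"
      using Suc.prems(1) keys_homotopy unfolding nonhairy_chains_def by (auto elim!: keys_extend_linearlyE)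
    have hd: "?h (?d z) \<in> relations n j k"
      using homotopy_relations[OF Suc.prems(2)] by simp
    have keys_u: "g \<in> plain_graphs \<and> \<not> hairy g \<and> degree n j g = k \<and> nwhite g < w"
      if "g \<in> Poly_Mapping.keys u" for g
    proof -
      have "g \<in> Poly_Mapping.keys (extend_linearly (correction n j) z)" using that by (simp add: u_def)
      then obtain a where a: "a \<in> Poly_Mapping.keys z" "g \<in> Poly_Mapping.keys (correction n j a)"
        by (rule keys_extend_linearlyE)
      then have "a \<in> plain_graphs" "\<not> hairy a" "degree n j a = k" "nwhite a < Suc w"
        using Suc.prems by (auto simp: nonhairy_chains_def)
      then show ?thesis using keys_correction[OF _ _ a(2)] by auto
    qed
    have "?d u = ?d r - ?d (?d (?h z)) - ?d (?h (?d z)) + ?d z"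
      unfolding r_def by (simp add: extend_linearly_add extend_linearly_diff)
    also have "\<dots> \<in> relations n j (k + 1)"
      using dfull_dfull_chain[OF subsetD[OF nonhairy_chains_subset hz]] dfull_relations[OF r] dfull_relations[OF hd] Suc.prems(2)
      by (simp add: relations_add relations_diff)
    finally have du: "?d u \<in> relations n j (k + 1)" .
    have "u \<in> nonhairy_chains n j k" using keys_u by (auto simp: nonhairy_chains_def)
    then obtain y where y: "y \<in> nonhairy_chains n j (k - 1)" "u - ?d y \<in> relations n j k"
      using Suc.IH[of u] du keys_u by blast
    have "z - ?d (?h z + y) = (u - ?d y) + ?h (?d z) - r"
      by (simp add: r_def extend_linearly_add)
    also have "\<dots> \<in> relations n j k" by (rule relations_diff[OF relations_add[OF y(2) hd] r])
    finally show ?case using nonhairy_chains_add[OF hz y(1)] by blast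
  qed
qed

section \<open>The projection\<close>

definition hproj :: "lgraph \<Rightarrow> (lgraph \<Rightarrow>\<^sub>0 rat)" where
  "hproj g = (if hairy g then Poly_Mapping.single g 1 else 0)"

definition dhairy :: "int \<Rightarrow> int \<Rightarrow> lgraph \<Rightarrow> (lgraph \<Rightarrow>\<^sub>0 rat)" where
  "dhairy n j g = csum n j g {i. contractible g i \<and> verts g ! endp g i = White}"

text \<open>By \<open>hairy_contract_iff\<close> a contraction is hairy only if the graph is and
  both endpoints are white. So the projection intertwines the two differentials on labeled
  chains.\<close>

lemma hproj_dfull:
  assumes g: "g \<in> plain_graphs"
  shows "extend_linearly hproj (dfull n j g) = (if hairy g then dhairy n j g else 0)"
proof -
  have "extend_linearly hproj (dfull n j g) = (\<Sum>i | contractible g i. qscale (contr_sign n j g i) (hproj (contract g i)))"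
    by (simp add: dfull_def csum_def extend_linearly_sum extend_linearly_single)
  also have "\<dots> = (\<Sum>i | contractible g i. if hairy g \<and> verts g ! endp g i = White
      then Poly_Mapping.single (contract g i) (contr_sign n j g i) else 0)"
    by (rule sum.cong) (auto simp: hproj_def hairy_contract_iff[OF g] qscale_single)
  also have "\<dots> = (if hairy g then dhairy n j g else 0)"
    by (auto simp: dhairy_def csum_def sum.inter_filter[symmetric] intro!: sum.cong)
  finally show ?thesis .
qed

lemma hproj_relations: "r \<in> relations n j k \<Longrightarrow> extend_linearly hproj r \<in> orientation_relations n j hairy_graphs k"
proof (rule extend_linearly_on_relations)
  fix g s t f h assume g: "g \<in> plain_graphs" "degree n j g = k" and st: "step n j g s t f h"
  show "hproj h - qscale s (hproj g) \<in> orientation_relations n j hairy_graphs k"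
    using step_relations[OF st, of hairy_graphs k] step_hairy[OF st g(1)] g
    by (auto simp: hproj_def qscale_single relations_zero hairy_graphs_eq)
qed

lemma hairy_relations_subset: "orientation_relations n j hairy_graphs k \<subseteq> relations n j k"
  unfolding orientation_relations_def by (rule qfree.span_mono) (auto simp: hairy_graphs_eq)

lemma hproj_id: "Poly_Mapping.keys x \<subseteq> hairy_graphs \<Longrightarrow> extend_linearly hproj x = x"
  by (subst (2) extend_linearly_id[symmetric], rule extend_linearly_cong)
    (auto simp: hproj_def hairy_graphs_eq)

lemma hproj_dfull_chain:
  assumes "x \<in> plain_chains n j k"
  shows "extend_linearly hproj (extend_linearly (dfull n j) x) = extend_linearly (dhairy n j) (extend_linearly hproj x)"
  unfolding extend_linearly_comp
  by (rule extend_linearly_cong)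
    (use assms in \<open>auto simp: plain_chains_def hproj_dfull hproj_def extend_linearly_single subset_iff\<close>)

lemma keys_hproj: "Poly_Mapping.keys (extend_linearly hproj x) = {g \<in> Poly_Mapping.keys x. hairy g}"
proof -
  have "Poly_Mapping.lookup (extend_linearly hproj x) a = (if hairy a then Poly_Mapping.lookup x a else 0)" for a
  proof -
    have "Poly_Mapping.lookup (extend_linearly hproj x) a =
        (\<Sum>b\<in>Poly_Mapping.keys x. if b = a then (if hairy a then Poly_Mapping.lookup x a else 0) else 0)"
      unfolding extend_linearly_def lookup_sum
      by (rule sum.cong) (auto simp: hproj_def lookup_single when_def)
    also have "\<dots> = (if hairy a then Poly_Mapping.lookup x a else 0)" by (simp add: in_keys_iff)
    finally show ?thesis .
  qed
  then show ?thesis by (auto simp: in_keys_iff split: if_splits)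
qed

lemma contraction_sum_plain:
  assumes "g \<in> plain_graphs"
  shows "contraction_sum n j (\<lambda>g e. \<not> is_chord g e \<and> \<not> is_loop g e) g = dfull n j g"
proof -
  have "{i. i < nedges g \<and> \<not> is_chord g (edges g ! i) \<and> \<not> is_loop g (edges g ! i)} = {i. contractible g i}"
    using contractible_iff[OF assms] by (auto simp: contractible_def)
  then show ?thesis by (simp add: contraction_sum_def dfull_def csum_def)
qed

lemma contraction_sum_hairy:
  assumes "g \<in> hairy_graphs"
  shows "contraction_sum n j (\<lambda>g e. \<not> is_loop g e \<and> \<not> is_hair g e) g = dhairy n j g"
proof -
  have g: "g \<in> plain_graphs" "hairy g" using assms by (auto simp: hairy_graphs_eq)
  have "{i. i < nedges g \<and> \<not> is_loop g (edges g ! i) \<and> \<not> is_hair g (edges g ! i)} =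
     {i. contractible g i \<and> verts g ! endp g i = White}"
    using contractible_hairy_iff[OF g] by (auto simp: contractible_def)
  then show ?thesis by (simp add: contraction_sum_def dhairy_def csum_def)
qed

section \<open>Quasi-isomorphisms of cochain complexes\<close>

lemma coset_map_r_coset:
  assumes G: "comm_group G" and H: "comm_group H" and B: "subgroup B G" and C: "subgroup C H"
    and f: "f \<in> hom G H" "f ` B \<subseteq> C" and z: "z \<in> carrier G"
  shows "coset_map H C f (B #>\<^bsub>G\<^esub> z) = C #>\<^bsub>H\<^esub> f z"
proof -
  interpret G: comm_group G by (rule G)
  interpret H: comm_group H by (rule H)
  interpret B: subgroup B G by (rule B)
  interpret C: subgroup C H by (rule C)
  have fz: "f z \<in> carrier H" using f z by (auto simp: hom_def)
  show ?thesis
  proof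
    show "coset_map H C f (B #>\<^bsub>G\<^esub> z) \<subseteq> C #>\<^bsub>H\<^esub> f z"
    proof
      fix y assume "y \<in> coset_map H C f (B #>\<^bsub>G\<^esub> z)"
      then obtain c b where cb: "c \<in> C" "b \<in> B" "y = c \<otimes>\<^bsub>H\<^esub> f (b \<otimes>\<^bsub>G\<^esub> z)"
        by (auto simp: coset_map_def set_mult_def r_coset_def)
      have "f (b \<otimes>\<^bsub>G\<^esub> z) = f b \<otimes>\<^bsub>H\<^esub> f z" using f z cb by (auto simp: hom_def)
      moreover have "f b \<in> C" using f cb by auto
      ultimately have "y = (c \<otimes>\<^bsub>H\<^esub> f b) \<otimes>\<^bsub>H\<^esub> f z" "c \<otimes>\<^bsub>H\<^esub> f b \<in> C"
        using cb fz by (simp_all add: H.m_assoc)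
      then show "y \<in> C #>\<^bsub>H\<^esub> f z" by (auto simp: r_coset_def)
    qed
    show "C #>\<^bsub>H\<^esub> f z \<subseteq> coset_map H C f (B #>\<^bsub>G\<^esub> z)"
    proof
      fix y assume "y \<in> C #>\<^bsub>H\<^esub> f z"
      then obtain c where c: "c \<in> C" "y = c \<otimes>\<^bsub>H\<^esub> f z" by (auto simp: r_coset_def)
      have "z \<in> B #>\<^bsub>G\<^esub> z" by (rule G.rcos_self[OF z B])
      then show "y \<in> coset_map H C f (B #>\<^bsub>G\<^esub> z)"
        using c unfolding coset_map_def set_mult_def by blast
    qed
  qed
qed

lemma r_coset_eq_iff:
  assumes G: "comm_group G" and B: "subgroup B G" and x: "x \<in> carrier G" and y: "y \<in> carrier G"
  shows "B #>\<^bsub>G\<^esub> x = B #>\<^bsub>G\<^esub> y \<longleftrightarrow> x \<otimes>\<^bsub>G\<^esub> inv\<^bsub>G\<^esub> y \<in> B"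
proof -
  interpret G: comm_group G by (rule G)
  have "x \<in> B #>\<^bsub>G\<^esub> y \<longleftrightarrow> x \<otimes>\<^bsub>G\<^esub> inv\<^bsub>G\<^esub> y \<in> B"
    using subgroup.rcos_module[OF B G.is_group y x] by simp
  moreover have "B #>\<^bsub>G\<^esub> x = B #>\<^bsub>G\<^esub> y \<longleftrightarrow> x \<in> B #>\<^bsub>G\<^esub> y"
    using G.rcos_self[OF x B] G.repr_independence[OF _ y B] by blast
  ultimately show ?thesis by simp
qed

text \<open>Bijectivity on the quotients is stated for representatives: the kernel is
  \<open>B\<close>, and every element of \<open>W\<close> is a value of \<open>f\<close> up to
  \<open>C\<close>.\<close>

lemma quotient_iso:
  assumes G: "comm_group G" and H: "comm_group H"
    and Z: "subgroup Z G" and B: "subgroup B G" "B \<subseteq> Z"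
    and W: "subgroup W H" and C: "subgroup C H" "C \<subseteq> W"
    and f: "f \<in> hom G H" "f ` Z \<subseteq> W" "f ` B \<subseteq> C"
    and inj: "\<And>z. z \<in> Z \<Longrightarrow> f z \<in> C \<Longrightarrow> z \<in> B"
    and surj: "\<And>w. w \<in> W \<Longrightarrow> \<exists>z\<in>Z. \<exists>c\<in>C. w = c \<otimes>\<^bsub>H\<^esub> f z"
  shows "coset_map H C f \<in> iso (G\<lparr>carrier := Z\<rparr> Mod B) (H\<lparr>carrier := W\<rparr> Mod C)"
proof -
  interpret G: comm_group G by (rule G)
  interpret H: comm_group H by (rule H)
  interpret BG: normal B G by (rule G.subgroup_imp_normal[OF B(1)])
  interpret CH: normal C H by (rule H.subgroup_imp_normal[OF C(1)])
  interpret fh: group_hom G H f by unfold_locales (rule f(1))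
  have sub: "Z \<subseteq> carrier G" "W \<subseteq> carrier H" using Z W by (auto simp: subgroup_def)
  have carG: "carrier (G\<lparr>carrier := Z\<rparr> Mod B) = (\<lambda>z. B #>\<^bsub>G\<^esub> z) ` Z"
    by (simp add: carrier_FactGroup r_coset_def)
  have carH: "carrier (H\<lparr>carrier := W\<rparr> Mod C) = (\<lambda>z. C #>\<^bsub>H\<^esub> z) ` W"
    by (simp add: carrier_FactGroup r_coset_def)
  have F: "coset_map H C f (B #>\<^bsub>G\<^esub> z) = C #>\<^bsub>H\<^esub> f z" if "z \<in> Z" for z
    using coset_map_r_coset[OF G H B(1) C(1) f(1,3)] that sub by blast
  have "coset_map H C f \<in> hom (G\<lparr>carrier := Z\<rparr> Mod B) (H\<lparr>carrier := W\<rparr> Mod C)"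
  proof (rule homI)
    fix X assume "X \<in> carrier (G\<lparr>carrier := Z\<rparr> Mod B)"
    then show "coset_map H C f X \<in> carrier (H\<lparr>carrier := W\<rparr> Mod C)"
      unfolding carG carH using F f(2) by auto
  next
    fix X Y assume "X \<in> carrier (G\<lparr>carrier := Z\<rparr> Mod B)" "Y \<in> carrier (G\<lparr>carrier := Z\<rparr> Mod B)"
    then obtain x y where xy: "x \<in> Z" "y \<in> Z" "X = B #>\<^bsub>G\<^esub> x" "Y = B #>\<^bsub>G\<^esub> y"
      unfolding carG by blast
    have c: "x \<in> carrier G" "y \<in> carrier G" using xy sub by auto
    have xyZ: "x \<otimes>\<^bsub>G\<^esub> y \<in> Z" using Z xy by (simp add: subgroup.m_closed)
    have m: "A \<otimes>\<^bsub>K\<lparr>carrier := V\<rparr> Mod N\<^esub> A' = A <#>\<^bsub>K\<^esub> A'" for K :: "'c monoid" and V N A A'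
      by (simp add: set_mult_def)
    have m': "A \<otimes>\<^bsub>K\<lparr>carrier := V\<rparr> Mod N\<^esub> A' = A <#>\<^bsub>K\<^esub> A'" for K :: "'d monoid" and V N A A'
      by (simp add: set_mult_def)
    have "coset_map H C f (X <#>\<^bsub>G\<^esub> Y) = C #>\<^bsub>H\<^esub> f (x \<otimes>\<^bsub>G\<^esub> y)"
      unfolding xy BG.rcos_sum[OF c] by (rule F[OF xyZ])
    also have "\<dots> = (C #>\<^bsub>H\<^esub> f x) <#>\<^bsub>H\<^esub> (C #>\<^bsub>H\<^esub> f y)"
      using c by (simp add: CH.rcos_sum)
    also have "\<dots> = coset_map H C f X <#>\<^bsub>H\<^esub> coset_map H C f Y" using xy F by simp
    finally show "coset_map H C f (X \<otimes>\<^bsub>G\<lparr>carrier := Z\<rparr> Mod B\<^esub> Y) =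
        coset_map H C f X \<otimes>\<^bsub>H\<lparr>carrier := W\<rparr> Mod C\<^esub> coset_map H C f Y"
      by (simp add: set_mult_def)
  qed
  moreover have "inj_on (coset_map H C f) (carrier (G\<lparr>carrier := Z\<rparr> Mod B))"
    unfolding carG
  proof (rule inj_onI, clarify)
    fix x y assume xy: "x \<in> Z" "y \<in> Z" and eq: "coset_map H C f (B #>\<^bsub>G\<^esub> x) = coset_map H C f (B #>\<^bsub>G\<^esub> y)"
    have c: "x \<in> carrier G" "y \<in> carrier G" using xy sub by auto
    have "f x \<otimes>\<^bsub>H\<^esub> inv\<^bsub>H\<^esub> f y \<in> C"
      using eq xy F r_coset_eq_iff[OF H C(1), of "f x" "f y"] c by simp
    then have "f (x \<otimes>\<^bsub>G\<^esub> inv\<^bsub>G\<^esub> y) \<in> C" using c by simp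
    moreover have "x \<otimes>\<^bsub>G\<^esub> inv\<^bsub>G\<^esub> y \<in> Z"
      using Z xy by (simp add: subgroup.m_closed subgroup.m_inv_closed)
    ultimately show "B #>\<^bsub>G\<^esub> x = B #>\<^bsub>G\<^esub> y"
      using inj r_coset_eq_iff[OF G B(1) c] by blast
  qed
  moreover have "coset_map H C f ` carrier (G\<lparr>carrier := Z\<rparr> Mod B) = carrier (H\<lparr>carrier := W\<rparr> Mod C)"
  proof
    show "coset_map H C f ` carrier (G\<lparr>carrier := Z\<rparr> Mod B) \<subseteq> carrier (H\<lparr>carrier := W\<rparr> Mod C)"
      unfolding carG carH using F f(2) by auto
    show "carrier (H\<lparr>carrier := W\<rparr> Mod C) \<subseteq> coset_map H C f ` carrier (G\<lparr>carrier := Z\<rparr> Mod B)"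
      unfolding carG carH
    proof (rule image_subsetI)
      fix w assume w: "w \<in> W"
      then obtain z c where zc: "z \<in> Z" "c \<in> C" "w = c \<otimes>\<^bsub>H\<^esub> f z" using surj by blast
      have "f z \<in> carrier H" using zc sub by auto
      then have "C #>\<^bsub>H\<^esub> w = C #>\<^bsub>H\<^esub> f z"
        using r_coset_eq_iff[OF H C(1), of w "f z"] zc w sub by (auto simp: H.m_assoc)
      then show "C #>\<^bsub>H\<^esub> w \<in> coset_map H C f ` (\<lambda>z. B #>\<^bsub>G\<^esub> z) ` Z"
        using F[OF zc(1)] zc(1) by (metis imageI)
    qed
  qed
  ultimately show ?thesis by (simp add: iso_def bij_betw_def)
qed

lemma quasi_isomorphismI:
  assumes C: "cochain_complex C" and D: "cochain_complex D" and f: "cochain_map C D f"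
    and inj: "\<And>k x. x \<in> cocycles C k \<Longrightarrow> f k x \<in> coboundaries D k \<Longrightarrow> x \<in> coboundaries C k"
    and surj: "\<And>k y. y \<in> cocycles D k \<Longrightarrow>
      \<exists>x \<in> cocycles C k. \<exists>b \<in> coboundaries D k. y = b \<otimes>\<^bsub>obj D k\<^esub> f k x"
  shows "quasi_isomorphism C D f"
proof -
  have sub: "subgroup (cocycles C k) (obj C k) \<and> subgroup (coboundaries C k) (obj C k) \<and> coboundaries C k \<subseteq> cocycles C k"
    if C: "cochain_complex C" for C :: "'c cochain_data" and k
  proof -
    have hom: "group_hom (obj C k) (obj C (k + 1)) (diff C k)" for k
      using C by (simp add: cochain_complex_def group_hom_def group_hom_axioms_def comm_group_def)
    have "subgroup (coboundaries C k) (obj C k)"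
      using group_hom.img_is_subgroup[OF hom[of "k - 1"]] by (simp add: coboundaries_def)
    moreover have "coboundaries C k \<subseteq> cocycles C k"
    proof
      fix y assume "y \<in> coboundaries C k"
      then obtain x where x: "x \<in> carrier (obj C (k - 1))" "y = diff C (k - 1) x"
        by (auto simp: coboundaries_def)
      have "diff C (k - 1) x \<in> carrier (obj C k)"
        using group_hom.hom_closed[OF hom[of "k - 1"] x(1)] by simp
      moreover have "diff C k (diff C (k - 1) x) = \<one>\<^bsub>obj C (k + 1)\<^esub>"
      proof -
        have "diff C (k - 1 + 1) (diff C (k - 1) x) = \<one>\<^bsub>obj C (k - 1 + 2)\<^esub>"
          using C x(1) unfolding cochain_complex_def by blast
        then show ?thesis by (simp add: algebra_simps)
      qed
      ultimately show "y \<in> cocycles C k" using x by (simp add: cocycles_def kernel_def)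
    qed
    ultimately show ?thesis
      using group_hom.subgroup_kernel[OF hom] by (simp add: cocycles_def)
  qed
  have "cohomology_map D f k \<in> iso (cohomology C k) (cohomology D k)" for k
    unfolding cohomology_map_def cohomology_def
  proof (rule quotient_iso)
    show "comm_group (obj C k)" "comm_group (obj D k)" using C D by (auto simp: cochain_complex_def)
    show "f k \<in> hom (obj C k) (obj D k)" using f by (simp add: cochain_map_def)
    have fd: "f (k + 1) (diff C k x) = diff D k (f k x)" if "x \<in> carrier (obj C k)" for x k
      using f that by (simp add: cochain_map_def)
    have fc: "f k x \<in> carrier (obj D k)" if "x \<in> carrier (obj C k)" for x k
      using f that by (auto simp: cochain_map_def hom_def)
    show "f k ` cocycles C k \<subseteq> cocycles D k"
    proof (rule image_subsetI)
      fix x assume x: "x \<in> cocycles C k"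
      interpret group_hom "obj C (k + 1)" "obj D (k + 1)" "f (k + 1)"
        using C D f by (simp add: cochain_complex_def cochain_map_def group_hom_def group_hom_axioms_def comm_group_def)
      show "f k x \<in> cocycles D k"
        using x fd[of x k] fc[of x k] hom_one by (simp add: cocycles_def kernel_def)
    qed
    show "f k ` coboundaries C k \<subseteq> coboundaries D k"
    proof (rule image_subsetI)
      fix y assume "y \<in> coboundaries C k"
      then obtain x where x: "x \<in> carrier (obj C (k - 1))" "y = diff C (k - 1) x"
        by (auto simp: coboundaries_def)
      then have "f k y = diff D (k - 1) (f (k - 1) x)" using fd[of x "k - 1"] by simp
      then show "f k y \<in> coboundaries D k" using fc[OF x(1)] by (simp add: coboundaries_def)
    qed
  qed (use sub C D inj surj in auto)
  then show ?thesis using C D f by (simp add: quasi_isomorphism_def)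
qed

section \<open>Graph complexes\<close>

lemma carrier_chains: "carrier (chains n j X k) = {x. Poly_Mapping.keys x \<subseteq> {g \<in> X. degree n j g = k}}"
  and mult_chains [simp]: "x \<otimes>\<^bsub>chains n j X k\<^esub> y = x + y"
  and one_chains [simp]: "\<one>\<^bsub>chains n j X k\<^esub> = 0"
  by (simp_all add: chains_def)

lemma comm_group_chains: "comm_group (chains n j X k)"
proof (rule comm_groupI)
  fix x assume x: "x \<in> carrier (chains n j X k)"
  show "\<exists>y\<in>carrier (chains n j X k). y \<otimes>\<^bsub>chains n j X k\<^esub> x = \<one>\<^bsub>chains n j X k\<^esub>"
    by (rule bexI[of _ "- x"]) (use x in \<open>auto simp: carrier_chains\<close>)
next
  fix x y assume "x \<in> carrier (chains n j X k)" "y \<in> carrier (chains n j X k)"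
  then show "x \<otimes>\<^bsub>chains n j X k\<^esub> y \<in> carrier (chains n j X k)"
    using Poly_Mapping.keys_add[of x y] by (auto simp: carrier_chains)
qed (auto simp: carrier_chains add.assoc add.commute)

lemma inv_chains:
  assumes "x \<in> carrier (chains n j X k)"
  shows "inv\<^bsub>chains n j X k\<^esub> x = - x"
proof -
  interpret comm_group "chains n j X k" by (rule comm_group_chains)
  show ?thesis by (rule inv_equality) (use assms in \<open>auto simp: carrier_chains\<close>)
qed

lemma subgroup_relations:
  assumes "\<And>r. r \<in> orientation_relations n j X k \<Longrightarrow> r \<in> carrier (chains n j X k)"
  shows "subgroup (orientation_relations n j X k) (chains n j X k)"
proof (rule group.subgroupI[OF comm_group.axioms(2)[OF comm_group_chains]])
  show "orientation_relations n j X k \<noteq> {}" using relations_zero by blast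
qed (use assms in \<open>auto simp: inv_chains relations_neg relations_add\<close>)

text \<open>The common frame of both complexes: a map \<open>d\<close> whose linear extension
  squares to zero on chains and preserves the relations. It replaces \<open>contraction_sum\<close>,
  with which it agrees on \<open>X\<close>, by a sum over contractible edges.\<close>

locale graph_complex_data =
  fixes n j :: int and X :: "lgraph set" and P :: "lgraph \<Rightarrow> edge \<Rightarrow> bool" and d :: "lgraph \<Rightarrow> (lgraph \<Rightarrow>\<^sub>0 rat)"
  assumes contraction_sum: "g \<in> X \<Longrightarrow> contraction_sum n j P g = d g"
    and relations_chains: "r \<in> orientation_relations n j X k \<Longrightarrow> r \<in> carrier (chains n j X k)"
    and d_chains: "x \<in> carrier (chains n j X k) \<Longrightarrow> extend_linearly d x \<in> carrier (chains n j X (k + 1))"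
    and d_relations: "r \<in> orientation_relations n j X k \<Longrightarrow> extend_linearly d r \<in> orientation_relations n j X (k + 1)"
    and d_d: "x \<in> carrier (chains n j X k) \<Longrightarrow> extend_linearly d (extend_linearly d x) = 0"
begin

abbreviation "K \<equiv> graph_complex n j X P"
abbreviation "R k \<equiv> orientation_relations n j X k"
abbreviation "C k \<equiv> carrier (chains n j X k)"
abbreviation "cls k x \<equiv> R k #>\<^bsub>chains n j X k\<^esub> x"

lemma subgroup_R: "subgroup (R k) (chains n j X k)"
  by (rule subgroup_relations) (rule relations_chains)

lemma obj_eq: "obj K k = chains n j X k Mod R k"
  by (simp add: graph_complex_def)

lemma comm_group_obj: "comm_group (obj K k)"
  unfolding obj_eq by (rule comm_group.abelian_FactGroup[OF comm_group_chains subgroup_R])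

lemma carrier_obj: "carrier (obj K k) = cls k ` C k"
  by (simp add: obj_eq carrier_FactGroup)

lemma one_obj: "\<one>\<^bsub>obj K k\<^esub> = R k"
  by (simp add: obj_eq)

lemma cls_eq_iff: "x \<in> C k \<Longrightarrow> y \<in> C k \<Longrightarrow> cls k x = cls k y \<longleftrightarrow> x - y \<in> R k"
  by (simp add: r_coset_eq_iff[OF comm_group_chains subgroup_R] inv_chains)

lemma cls_eq_one_iff: "x \<in> C k \<Longrightarrow> cls k x = R k \<longleftrightarrow> x \<in> R k"
proof -
  assume x: "x \<in> C k"
  have 0: "0 \<in> C k" by (simp add: carrier_chains)
  have "cls k 0 = R k" by (simp add: r_coset_def)
  then show ?thesis using cls_eq_iff[OF x 0] by simp
qed

lemma mult_cls: "x \<in> C k \<Longrightarrow> y \<in> C k \<Longrightarrow> cls k x \<otimes>\<^bsub>obj K k\<^esub> cls k y = cls k (x + y)"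
  using normal.rcos_sum[OF comm_group.subgroup_imp_normal[OF comm_group_chains subgroup_R]]
  by (simp add: obj_eq)

lemma graph_map_cls:
  assumes Y: "\<And>r. r \<in> orientation_relations n j Y l \<Longrightarrow> r \<in> carrier (chains n j Y l)"
    and f: "\<And>x. x \<in> C k \<Longrightarrow> extend_linearly f x \<in> carrier (chains n j Y l)"
    and fr: "\<And>r. r \<in> R k \<Longrightarrow> extend_linearly f r \<in> orientation_relations n j Y l"
    and x: "x \<in> C k"
  shows "graph_map n j Y l f (cls k x) =
    orientation_relations n j Y l #>\<^bsub>chains n j Y l\<^esub> extend_linearly f x"
  unfolding graph_map_def
proof (rule coset_map_r_coset[OF comm_group_chains comm_group_chains subgroup_R])
  show "subgroup (orientation_relations n j Y l) (chains n j Y l)"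
    by (rule subgroup_relations) (rule Y)
  show "extend_linearly f \<in> hom (chains n j X k) (chains n j Y l)"
    using f by (auto intro!: homI simp: extend_linearly_add)
qed (use fr x in auto)

lemma extend_contraction_sum:
  "x \<in> C k \<Longrightarrow> extend_linearly (contraction_sum n j P) x = extend_linearly d x"
  by (rule extend_linearly_cong) (auto simp: carrier_chains contraction_sum)

lemma diff_cls: "x \<in> C k \<Longrightarrow> diff K k (cls k x) = cls (k + 1) (extend_linearly d x)"
proof -
  assume x: "x \<in> C k"
  have "diff K k (cls k x) = graph_map n j X (k + 1) (contraction_sum n j P) (cls k x)"
    by (simp add: graph_complex_def)
  also have "\<dots> = cls (k + 1) (extend_linearly (contraction_sum n j P) x)"
    by (rule graph_map_cls)
      (use relations_chains x d_chains d_relations in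
        \<open>auto simp: extend_contraction_sum extend_contraction_sum[OF relations_chains]\<close>)
  finally show ?thesis using extend_contraction_sum[OF x] by simp
qed

lemma chains_add: "x \<in> C k \<Longrightarrow> y \<in> C k \<Longrightarrow> x + y \<in> C k"
  using Poly_Mapping.keys_add[of x y] by (auto simp: carrier_chains)

lemma complex: "cochain_complex K"
  unfolding cochain_complex_def
proof (intro conjI allI ballI)
  fix k
  show "comm_group (obj K k)" by (rule comm_group_obj)
  show "diff K k \<in> hom (obj K k) (obj K (k + 1))"
  proof (rule homI)
    fix x assume "x \<in> carrier (obj K k)"
    then show "diff K k x \<in> carrier (obj K (k + 1))"
      unfolding carrier_obj using diff_cls d_chains by auto
  next
    fix x y assume "x \<in> carrier (obj K k)" "y \<in> carrier (obj K k)"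
    then show "diff K k (x \<otimes>\<^bsub>obj K k\<^esub> y) = diff K k x \<otimes>\<^bsub>obj K (k + 1)\<^esub> diff K k y"
      unfolding carrier_obj
      by (auto simp: mult_cls diff_cls chains_add d_chains extend_linearly_add)
  qed
  fix x assume "x \<in> carrier (obj K k)"
  then obtain c where c: "c \<in> C k" "x = cls k c" unfolding carrier_obj by blast
  have "diff K (k + 1) (diff K k x) = cls (k + 1 + 1) 0"
    using c diff_cls d_chains d_d by simp
  then show "diff K (k + 1) (diff K k x) = \<one>\<^bsub>obj K (k + 2)\<^esub>"
    unfolding one_obj by (simp add: add.assoc r_coset_def)
qed

text \<open>Cocycles are represented by chains whose differential is a relation. This translates
  cohomology of the quotient into the chain-level language of \<open>nonhairy_exact\<close>.\<close>

lemma cocycles_eq: "cocycles K k = cls k ` {x \<in> C k. extend_linearly d x \<in> R (k + 1)}"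
proof -
  have "cocycles K k = {X \<in> cls k ` C k. diff K k X = R (k + 1)}"
    by (simp add: cocycles_def kernel_def carrier_obj one_obj)
  moreover have "diff K k (cls k x) = R (k + 1) \<longleftrightarrow> extend_linearly d x \<in> R (k + 1)" if "x \<in> C k" for x
    unfolding diff_cls[OF that] by (rule cls_eq_one_iff[OF d_chains[OF that]])
  moreover have "{X \<in> c ` A. D X = r} = c ` {x \<in> A. Q x}"
    if "\<And>x. x \<in> A \<Longrightarrow> D (c x) = r \<longleftrightarrow> Q x" for c D r Q and A :: "(lgraph \<Rightarrow>\<^sub>0 rat) set"
    using that by blast
  note filter = this
  ultimately show ?thesis by (simp only: filter)
qed

lemma coboundaries_eq: "coboundaries K k = cls k ` extend_linearly d ` C (k - 1)"
proof -
  have "coboundaries K k = (\<lambda>x. diff K (k - 1) (cls (k - 1) x)) ` C (k - 1)"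
    by (simp add: coboundaries_def carrier_obj image_image)
  also have "\<dots> = (\<lambda>x. cls k (extend_linearly d x)) ` C (k - 1)"
    by (rule image_cong) (simp_all add: diff_cls)
  finally show ?thesis by (simp add: image_image)
qed

end

section \<open>The two complexes of the theorem\<close>

lemma plain_chains_carrier: "plain_chains n j k = carrier (chains n j plain_graphs k)"
  by (simp add: plain_chains_def carrier_chains)

interpretation plain: graph_complex_data n j plain_graphs
  "\<lambda>g e. \<not> is_chord g e \<and> \<not> is_loop g e" "dfull n j" for n j
proof
  fix r k assume "r \<in> relations n j k"
  then show "r \<in> carrier (chains n j plain_graphs k)" using keys_relations by (auto simp: carrier_chains)
qed (simp_all add: contraction_sum_plain dfull_relations
    dfull_chains dfull_dfull_chain flip: plain_chains_carrier)

lemma hairy_chains_plain: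
  "x \<in> carrier (chains n j hairy_graphs k) \<longleftrightarrow>
   x \<in> plain_chains n j k \<and> extend_linearly hproj x = x"
proof
  assume "x \<in> carrier (chains n j hairy_graphs k)"
  then show "x \<in> plain_chains n j k \<and> extend_linearly hproj x = x"
    using hproj_id[of x] by (auto simp: carrier_chains plain_chains_def hairy_graphs_eq)
next
  assume x: "x \<in> plain_chains n j k \<and> extend_linearly hproj x = x"
  then have "Poly_Mapping.keys x = {g \<in> Poly_Mapping.keys x. hairy g}" using keys_hproj[of x] by simp
  then show "x \<in> carrier (chains n j hairy_graphs k)"
    using x unfolding carrier_chains plain_chains_def hairy_graphs_eq by blast
qed

lemma hproj_chains:
  "x \<in> plain_chains n j k \<Longrightarrow> extend_linearly hproj x \<in> carrier (chains n j hairy_graphs k)"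
  using keys_hproj[of x] by (auto simp: carrier_chains plain_chains_def hairy_graphs_eq)

text \<open>The hairy differential is the plain one followed by the projection. Its square and its
  behaviour on relations are therefore inherited from the plain complex.\<close>

lemma dhairy_eq:
  "x \<in> carrier (chains n j hairy_graphs k) \<Longrightarrow>
   extend_linearly (dhairy n j) x = extend_linearly hproj (extend_linearly (dfull n j) x)"
  using hproj_dfull_chain[of x n j k] by (simp add: hairy_chains_plain)

interpretation hairy: graph_complex_data n j hairy_graphs
  "\<lambda>g e. \<not> is_loop g e \<and> \<not> is_hair g e" "dhairy n j" for n j
proof
  fix g assume "g \<in> hairy_graphs"
  then show "contraction_sum n j (\<lambda>g e. \<not> is_loop g e \<and> \<not> is_hair g e) g = dhairy n j g"
    by (rule contraction_sum_hairy)
next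
  fix r k assume r: "r \<in> orientation_relations n j hairy_graphs k"
  have "r \<in> relations n j k" using r hairy_relations_subset by blast
  then have rp: "r \<in> plain_chains n j k" using keys_relations by (auto simp: plain_chains_def)
  show rc: "r \<in> carrier (chains n j hairy_graphs k)"
    using r unfolding orientation_relations_def
  proof (induction rule: qfree.span_induct_alt)
    case base
    then show ?case by (simp add: carrier_chains)
  next
    case (step c x y)
    then obtain g s h where x: "x = Poly_Mapping.single h 1 - Poly_Mapping.single g s"
      "g \<in> hairy_graphs" "degree n j g = k" "relabel n j g s h" by blast
    then have "x \<in> orientation_relations n j hairy_graphs k"
      unfolding orientation_relations_def by (intro qfree.span_base) blast
    then have xr: "x \<in> relations n j k" using hairy_relations_subset by blast
    obtain t f where st: "step n j g s t f h" using relabel_imp_step[OF x(4)] by blast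
    have "hairy h" using step_hairy[OF st] x(2) by (auto simp: hairy_graphs_eq)
    then have "Poly_Mapping.keys x \<subseteq> hairy_graphs"
      using keys_relations[OF xr] x keys_diff[of "Poly_Mapping.single h (1::rat)" "Poly_Mapping.single g s"]
      by (auto simp: hairy_graphs_eq split: if_splits)
    then have "x \<in> carrier (chains n j hairy_graphs k)"
      using keys_relations[OF xr] by (auto simp: carrier_chains)
    then show ?case
      using step.IH Poly_Mapping.keys_add[of "qscale c x" y] keys_qscale[of c x] unfolding carrier_chains by blast
  qed
  show "extend_linearly (dhairy n j) r \<in> orientation_relations n j hairy_graphs (k + 1)"
    unfolding dhairy_eq[OF rc]
    by (intro hproj_relations dfull_relations subsetD[OF hairy_relations_subset r])
next
  fix x k assume x: "x \<in> carrier (chains n j hairy_graphs k)"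
  then have xp: "x \<in> plain_chains n j k" by (simp add: hairy_chains_plain)
  show d: "extend_linearly (dhairy n j) x \<in> carrier (chains n j hairy_graphs (k + 1))"
    unfolding dhairy_eq[OF x] by (intro hproj_chains dfull_chains xp)
  have "extend_linearly (dhairy n j) (extend_linearly (dhairy n j) x) =
      extend_linearly hproj (extend_linearly (dfull n j) (extend_linearly (dfull n j) x))"
    unfolding dhairy_eq[OF x] by (rule hproj_dfull_chain[OF dfull_chains[OF xp], symmetric])
  then show "extend_linearly (dhairy n j) (extend_linearly (dhairy n j) x) = 0"
    using dfull_dfull_chain[OF xp] by simp
qed

lemma hproj_complement:
  assumes "x \<in> plain_chains n j k"
  shows "x - extend_linearly hproj x \<in> nonhairy_chains n j k"
proof -
  have "Poly_Mapping.keys (extend_linearly hproj x) \<subseteq> hairy_graphs"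
    using hproj_chains[OF assms] by (auto simp: carrier_chains)
  then have "extend_linearly hproj (x - extend_linearly hproj x) = 0"
    by (simp add: extend_linearly_diff hproj_id)
  then have "{g \<in> Poly_Mapping.keys (x - extend_linearly hproj x). hairy g} = {}"
    using keys_hproj[of "x - extend_linearly hproj x"] by simp
  moreover have "Poly_Mapping.keys (x - extend_linearly hproj x) \<subseteq> Poly_Mapping.keys x"
    using keys_diff[of x "extend_linearly hproj x"] keys_hproj[of x] by auto
  ultimately show ?thesis using assms by (auto simp: nonhairy_chains_def plain_chains_def)
qed

lemma hproj_nonhairy: "x \<in> nonhairy_chains n j k \<Longrightarrow> extend_linearly hproj x = 0"
proof -
  assume "x \<in> nonhairy_chains n j k"
  then have "Poly_Mapping.keys (extend_linearly hproj x) = {}"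
    unfolding keys_hproj by (auto simp: nonhairy_chains_def)
  then show ?thesis by simp
qed

theorem theorem0p4:
  fixes n j :: int
  assumes "j \<ge> 2" and "n - j \<ge> 2"
  shows "quasi_isomorphism (PGC' n j) (HGC n j) (hairy_projection n j)"
proof -
  let ?d = "extend_linearly (dfull n j)" and ?dh = "extend_linearly (dhairy n j)"
    and ?p = "extend_linearly hproj" and ?f = "hairy_projection n j"
  let ?RH = "orientation_relations n j hairy_graphs"
  let ?CP = "\<lambda>k. carrier (chains n j plain_graphs k)" and ?CH = "\<lambda>k. carrier (chains n j hairy_graphs k)"
  let ?cls = "\<lambda>k x. relations n j k #>\<^bsub>chains n j plain_graphs k\<^esub> x"
    and ?clsH = "\<lambda>k x. ?RH k #>\<^bsub>chains n j hairy_graphs k\<^esub> x"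
  have CP: "?CP k = plain_chains n j k" for k by (simp add: plain_chains_carrier)
  have f: "?f k (?cls k x) = ?clsH k (?p x)" if "x \<in> ?CP k" for k x
    unfolding hairy_projection_def hproj_def[abs_def, symmetric]
    by (rule plain.graph_map_cls) (use that hairy.relations_chains hproj_chains hproj_relations in \<open>auto simp: CP\<close>)
  have pd: "?p (?d x) = ?dh (?p x)" if "x \<in> ?CP k" for k x
    using that hproj_dfull_chain by (simp add: CP)
  have p: "?p x \<in> ?CH k" if "x \<in> ?CP k" for k x
    using that hproj_chains by (simp add: CP)
  have diff_CP: "x - y \<in> ?CP k" if "x \<in> ?CP k" "y \<in> ?CP k" for x y k
    using that keys_diff[of x y] by (auto simp: carrier_chains)
  have diff_CH: "x - y \<in> ?CH k" if "x \<in> ?CH k" "y \<in> ?CH k" for x y k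
    using that keys_diff[of x y] by (auto simp: carrier_chains)
  have HP: "x \<in> ?CP k" "?p x = x" if "x \<in> ?CH k" for x k
    using that by (simp_all add: hairy_chains_plain CP)
  have NP: "x \<in> ?CP k" "?p x = 0" if "x \<in> nonhairy_chains n j k" for x k
    using that nonhairy_chains_subset hproj_nonhairy by (auto simp: CP)
  show ?thesis
    unfolding PGC'_def HGC_def
  proof (rule quasi_isomorphismI)
    show "cochain_map (plain.K n j) (hairy.K n j) ?f"
      unfolding cochain_map_def
    proof (intro conjI allI ballI)
      fix k
      show "?f k \<in> hom (obj (plain.K n j) k) (obj (hairy.K n j) k)"
      proof (rule homI)
        fix X assume "X \<in> carrier (obj (plain.K n j) k)"
        then show "?f k X \<in> carrier (obj (hairy.K n j) k)"
          unfolding plain.carrier_obj hairy.carrier_obj using f p by auto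
      next
        fix X Y assume "X \<in> carrier (obj (plain.K n j) k)" "Y \<in> carrier (obj (plain.K n j) k)"
        then obtain x y where xy: "x \<in> ?CP k" "y \<in> ?CP k" "X = ?cls k x" "Y = ?cls k y"
          unfolding plain.carrier_obj by blast
        show "?f k (X \<otimes>\<^bsub>obj (plain.K n j) k\<^esub> Y) = ?f k X \<otimes>\<^bsub>obj (hairy.K n j) k\<^esub> ?f k Y"
          unfolding xy(3,4) plain.mult_cls[OF xy(1,2)] f[OF plain.chains_add[OF xy(1,2)]] f[OF xy(1)] f[OF xy(2)]
            hairy.mult_cls[OF p[OF xy(1)] p[OF xy(2)]] extend_linearly_add ..
      qed
      fix X assume "X \<in> carrier (obj (plain.K n j) k)"
      then obtain x where x: "x \<in> ?CP k" "X = ?cls k x" unfolding plain.carrier_obj by blast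
      show "?f (k + 1) (diff (plain.K n j) k X) = diff (hairy.K n j) k (?f k X)"
        unfolding x(2) plain.diff_cls[OF x(1)] f[OF x(1)] f[OF plain.d_chains[OF x(1)]]
          hairy.diff_cls[OF p[OF x(1)]] pd[OF x(1)] ..
    qed
  next
    fix k X assume X: "X \<in> cocycles (plain.K n j) k" and fX: "?f k X \<in> coboundaries (hairy.K n j) k"
    obtain x where x: "x \<in> ?CP k" "X = ?cls k x" "?d x \<in> relations n j (k + 1)"
      using X unfolding plain.cocycles_eq by blast
    obtain y where y: "y \<in> ?CH (k - 1)" "?clsH k (?p x) = ?clsH k (?dh y)"
      using fX f[OF x(1)] x(2) unfolding hairy.coboundaries_eq by auto
    have yd: "?d y \<in> ?CP k" "?dh y \<in> ?CH k"
      using plain.d_chains[OF HP(1)[OF y(1)]] hairy.d_chains[OF y(1)] by simp_all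
    \<comment> \<open>The image of \<open>x\<close> is cohomologous to zero through
      \<open>y\<close>. After subtracting \<open>?d y\<close>, the projection of the cocycle is a
      relation, so its remaining non-hairy part is closed up to relations and
      \<open>nonhairy_exact\<close> applies.\<close>
    define u where "u = x - ?d y"
    have u: "u \<in> ?CP k" unfolding u_def by (rule diff_CP[OF x(1) yd(1)])
    have "?p u = ?p x - ?dh y"
      using pd[OF HP(1)[OF y(1)]] HP(2)[OF y(1)] by (simp add: u_def extend_linearly_diff)
    then have pu: "?p u \<in> relations n j k"
      using hairy.cls_eq_iff[OF p[OF x(1)] yd(2)] y(2) subsetD[OF hairy_relations_subset] by simp
    have "?d (u - ?p u) = ?d x - ?d (?d y) - ?d (?p u)"
      by (simp add: u_def extend_linearly_diff)
    also have "\<dots> \<in> relations n j (k + 1)"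
      using x(3) plain.d_d[OF HP(1)[OF y(1)]] dfull_relations[OF pu] by (simp add: relations_diff)
    finally have du: "?d (u - ?p u) \<in> relations n j (k + 1)" .
    obtain y' where y': "y' \<in> nonhairy_chains n j (k - 1)" "(u - ?p u) - ?d y' \<in> relations n j k"
      using nonhairy_exact[OF hproj_complement[OF u[unfolded CP]] du] by blast
    have yy: "y + y' \<in> ?CP (k - 1)" by (rule plain.chains_add[OF HP(1)[OF y(1)] NP(1)[OF y'(1)]])
    have "x - ?d (y + y') = ((u - ?p u) - ?d y') + ?p u"
      by (simp add: u_def extend_linearly_add)
    also have "\<dots> \<in> relations n j k" by (rule relations_add[OF y'(2) pu])
    finally have "?cls k x = ?cls k (?d (y + y'))"
      using plain.cls_eq_iff[OF x(1)] plain.d_chains[OF yy] by simp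
    then show "X \<in> coboundaries (plain.K n j) k"
      unfolding plain.coboundaries_eq x(2) using yy by blast
  next
    fix k Y assume "Y \<in> cocycles (hairy.K n j) k"
    then obtain y where y: "y \<in> ?CH k" "Y = ?clsH k y" "?dh y \<in> ?RH (k + 1)"
      unfolding hairy.cocycles_eq by blast
    note yP = HP[OF y(1)]
    have dy: "?d y \<in> plain_chains n j (k + 1)" using plain.d_chains[OF yP(1)] by (simp add: CP)
    have r: "?p (?d y) \<in> relations n j (k + 1)"
      using pd[OF yP(1)] yP(2) y(3) hairy_relations_subset by auto
    have "?d (?d y - ?p (?d y)) \<in> relations n j (k + 1 + 1)"
      using dfull_relations[OF r] plain.d_d[OF yP(1)]
      by (simp add: extend_linearly_diff relations_neg)
    \<comment> \<open>A hairy cocycle need not be closed among plain graphs. The non-hairy part of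
      its differential is closed up to relations, hence exact; subtracting \<open>y'\<close> makes
      the lift closed without changing its projection.\<close>
    then obtain y' where y': "y' \<in> nonhairy_chains n j k" "(?d y - ?p (?d y)) - ?d y' \<in> relations n j (k + 1)"
      using nonhairy_exact[OF hproj_complement[OF dy]] by auto
    define x where "x = y - y'"
    have x: "x \<in> ?CP k" unfolding x_def by (rule diff_CP[OF yP(1) NP(1)[OF y'(1)]])
    have px: "?p x = y" using yP(2) NP(2)[OF y'(1)] by (simp add: x_def extend_linearly_diff)
    have "?d x = ((?d y - ?p (?d y)) - ?d y') + ?p (?d y)" by (simp add: x_def extend_linearly_diff)
    also have "\<dots> \<in> relations n j (k + 1)" by (rule relations_add[OF y'(2) r])
    finally have "?cls k x \<in> cocycles (plain.K n j) k" unfolding plain.cocycles_eq using x by blast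
    \<comment> \<open>The lift projects to \<open>y\<close> itself, so the coboundary in the
      criterion is the class of 0.\<close>
    moreover have "0 \<in> ?CH k" "0 \<in> ?CH (k - 1)" by (simp_all add: carrier_chains)
    moreover from this have "?clsH k 0 \<in> coboundaries (hairy.K n j) k"
      unfolding hairy.coboundaries_eq by (metis extend_linearly_zero imageI)
    moreover have "Y = ?clsH k 0 \<otimes>\<^bsub>obj (hairy.K n j) k\<^esub> ?f k (?cls k x)"
      using hairy.mult_cls[OF \<open>0 \<in> ?CH k\<close> y(1)] by (simp add: f[OF x] px y(2))
    ultimately show "\<exists>X\<in>cocycles (plain.K n j) k. \<exists>b\<in>coboundaries (hairy.K n j) k.
        Y = b \<otimes>\<^bsub>obj (hairy.K n j) k\<^esub> ?f k X"
      by blast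
  qed (rule plain.complex hairy.complex)+
qed

end
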